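(* Let $X$ be a smooth affine supervariety, and let $u$ be an odd, everywhere vanishing vector field on $X$ such that for all $x\in X(\Bbbk)$ we have: (1) $u(T_x^*X)_{\overline1}=0$; (2) the map $u:(T_x^*X)_{\overline0}\to(T_x^*X)_{\overline1}$ is an isomorphism. Then there exists an isomorphism $X\cong\Pi\mathcal T_{X_0}$ such that $u$ corresponds to the de Rham differential.
   Context: $\Bbbk$ is an algebraically closed field of characteristic zero. A smooth affine supervariety $X=\operatorname{Spec}\Bbbk[X]$ is one whose algebra of functions is the exterior algebra of a finite rank vector bundle on a smooth affine variety $X_0$ (its even subscheme). For $x\in X(\Bbbk)$ with maximal ideal $\mathfrak m_x\subseteq\Bbbk[X]$, the cotangent space is $T_x^*X=\mathfrak m_x/\mathfrak m_x^2$, with parity decomposition $(T_x^*X)_{\overline0}\oplus(T_x^*X)_{\overline1}$. A vector field on $X$ is a superderivation of $\Bbbk[X]$; it is everywhere vanishing if its tangent vector at every closed point is zero, in which case it preserves each $\mathfrak m_x$ and acts on each $T_x^*X$. For an affine variety $X_0$, the odd tangent bundle $\Pi\mathcal T_{X_0}$ is the supervariety with algebra of functions $\Omega^\bullet_{X_0}$, the algebra of de Rham differential forms on $X_0$, where $\Omega^1_{X_0}$ consists of odd elements; the de Rham differential $d$ is an odd, everywhere vanishing vector field on it.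
   Formalization: The vector field u is additionally assumed to satisfy u² = 0; without this the claim fails (e.g. u = ξ₁∂/∂x₁ + ξ₂∂/∂x₂ + ξ₁ξ₂∂/∂ξ₁ on affine superspace A^{2|2}), and the conclusion forces u² = 0 since d² = 0. *)

theory Defs
  imports "HOL-Algebra.Algebra" "HOL-Library.Extended_Nat"
begin

section \<open>Linear algebra over a commutative ring\<close>

definition linear_map ::
    "('r, 'c) ring_scheme \<Rightarrow> ('r, 'a, 'd) module_scheme \<Rightarrow> ('r, 'b, 'e) module_scheme \<Rightarrow> ('a \<Rightarrow> 'b) \<Rightarrow> bool"
  where "linear_map R M N h \<longleftrightarrow>
    h \<in> carrier M \<rightarrow> carrier N \<and>
    (\<forall>x\<in>carrier M. \<forall>y\<in>carrier M. h (x \<oplus>\<^bsub>M\<^esub> y) = h x \<oplus>\<^bsub>N\<^esub> h y) \<and>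
    (\<forall>r\<in>carrier R. \<forall>x\<in>carrier M. h (r \<odot>\<^bsub>M\<^esub> x) = r \<odot>\<^bsub>N\<^esub> h x)"

text \<open>In the records below that are used only as modules, the ring fields
  \<^const>\<open>monoid.mult\<close> and \<^const>\<open>one\<close> carry no meaning.\<close>

definition free_module :: "('r, 'c) ring_scheme \<Rightarrow> nat \<Rightarrow> ('r, nat \<Rightarrow> 'r) module"
  where "free_module R n =
    \<lparr>carrier = {..<n} \<rightarrow>\<^sub>E carrier R, monoid.mult = undefined, monoid.one = undefined,
     ring.zero = (\<lambda>i\<in>{..<n}. \<zero>\<^bsub>R\<^esub>), ring.add = (\<lambda>v w. \<lambda>i\<in>{..<n}. v i \<oplus>\<^bsub>R\<^esub> w i),
     smult = (\<lambda>r v. \<lambda>i\<in>{..<n}. r \<otimes>\<^bsub>R\<^esub> v i)\<rparr>"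

text \<open>Finitely generated projective: a direct summand of some \<open>R\<^sup>n\<close>.  These are the modules of
  sections of finite rank vector bundles on \<open>Spec R\<close>.\<close>

definition fg_projective :: "('r, 'c) ring_scheme \<Rightarrow> ('r, 'm, 'd) module_scheme \<Rightarrow> bool"
  where "fg_projective R M \<longleftrightarrow> module R M \<and>
    (\<exists>n i p. linear_map R M (free_module R n) i \<and> linear_map R (free_module R n) M p \<and>
      (\<forall>x\<in>carrier M. p (i x) = x))"

definition has_dim :: "('k, 'c) ring_scheme \<Rightarrow> ('k, 'v, 'd) module_scheme \<Rightarrow> nat \<Rightarrow> bool"
  where "has_dim K V n \<longleftrightarrow>
    (\<exists>b \<in> {..<n} \<rightarrow> carrier V.
      bij_betw (\<lambda>c. \<Oplus>\<^bsub>V\<^esub>i\<in>{..<n}. c i \<odot>\<^bsub>V\<^esub> b i) ({..<n} \<rightarrow>\<^sub>E carrier K) (carrier V))"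

definition gen_submodule :: "('r, 'c) ring_scheme \<Rightarrow> ('r, 'm, 'd) module_scheme \<Rightarrow> 'm set \<Rightarrow> 'm set"
  where "gen_submodule R M S = \<Inter>{N. submodule N R M \<and> S \<subseteq> N}"

definition quot_module :: "('r, 'm, 'd) module_scheme \<Rightarrow> 'm set \<Rightarrow> ('r, 'm set) module"
  where "quot_module M N =
    \<lparr>carrier = a_rcosets\<^bsub>M\<^esub> N, monoid.mult = undefined, monoid.one = undefined, ring.zero = N, ring.add = set_add M,
     smult = (\<lambda>r Y. \<Union>x\<in>Y. N +>\<^bsub>M\<^esub> (r \<odot>\<^bsub>M\<^esub> x))\<rparr>"

text \<open>Finitely supported functions with a single value.\<close>

definition single :: "('r, 'c) ring_scheme \<Rightarrow> 'x \<Rightarrow> 'r \<Rightarrow> 'x \<Rightarrow> 'r"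
  where "single R x r = (\<lambda>y. if y = x then r else \<zero>\<^bsub>R\<^esub>)"


section \<open>Superalgebras\<close>

record ('k, 'a) superalgebra = "('k, 'a) module" +
  even_part :: "'a set"
  odd_part :: "'a set"

definition superalgebra :: "('k, 'c) ring_scheme \<Rightarrow> ('k, 'a, 'd) superalgebra_scheme \<Rightarrow> bool"
  where "superalgebra K A \<longleftrightarrow>
    ring A \<and> module K A \<and>
    (\<forall>c\<in>carrier K. \<forall>a\<in>carrier A. \<forall>b\<in>carrier A.
      (c \<odot>\<^bsub>A\<^esub> a) \<otimes>\<^bsub>A\<^esub> b = c \<odot>\<^bsub>A\<^esub> (a \<otimes>\<^bsub>A\<^esub> b) \<and> a \<otimes>\<^bsub>A\<^esub> (c \<odot>\<^bsub>A\<^esub> b) = c \<odot>\<^bsub>A\<^esub> (a \<otimes>\<^bsub>A\<^esub> b)) \<and>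
    submodule (even_part A) K A \<and> submodule (odd_part A) K A \<and>
    even_part A \<inter> odd_part A = {\<zero>\<^bsub>A\<^esub>} \<and> even_part A <+>\<^bsub>A\<^esub> odd_part A = carrier A \<and>
    \<one>\<^bsub>A\<^esub> \<in> even_part A \<and>
    (\<forall>a\<in>even_part A. \<forall>b\<in>even_part A. a \<otimes>\<^bsub>A\<^esub> b \<in> even_part A) \<and>
    (\<forall>a\<in>even_part A. \<forall>b\<in>odd_part A. a \<otimes>\<^bsub>A\<^esub> b \<in> odd_part A) \<and>
    (\<forall>a\<in>odd_part A. \<forall>b\<in>odd_part A. a \<otimes>\<^bsub>A\<^esub> b \<in> even_part A) \<and>
    (\<forall>a\<in>even_part A. \<forall>b\<in>carrier A. a \<otimes>\<^bsub>A\<^esub> b = b \<otimes>\<^bsub>A\<^esub> a) \<and>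
    (\<forall>a\<in>odd_part A. \<forall>b\<in>odd_part A. a \<otimes>\<^bsub>A\<^esub> b = \<ominus>\<^bsub>A\<^esub> (b \<otimes>\<^bsub>A\<^esub> a))"

definition superalgebra_iso ::
    "('k, 'c) ring_scheme \<Rightarrow> ('k, 'a, 'd) superalgebra_scheme \<Rightarrow> ('k, 'b, 'e) superalgebra_scheme \<Rightarrow> ('a \<Rightarrow> 'b) \<Rightarrow> bool"
  where "superalgebra_iso K A B \<phi> \<longleftrightarrow>
    \<phi> \<in> ring_iso A B \<and> linear_map K A B \<phi> \<and>
    \<phi> ` even_part A = even_part B \<and> \<phi> ` odd_part A = odd_part B"

definition quot_superalgebra :: "('k, 'a, 'd) superalgebra_scheme \<Rightarrow> 'a set \<Rightarrow> ('k, 'a set) superalgebra"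
  where "quot_superalgebra A I =
    \<lparr>carrier = a_rcosets\<^bsub>A\<^esub> I, monoid.mult = rcoset_mult A I, monoid.one = I +>\<^bsub>A\<^esub> \<one>\<^bsub>A\<^esub>, ring.zero = I, ring.add = set_add A,
     smult = (\<lambda>c Y. \<Union>x\<in>Y. I +>\<^bsub>A\<^esub> (c \<odot>\<^bsub>A\<^esub> x)),
     even_part = (\<lambda>a. I +>\<^bsub>A\<^esub> a) ` even_part A, odd_part = (\<lambda>a. I +>\<^bsub>A\<^esub> a) ` odd_part A\<rparr>"

text \<open>Odd superderivations: \<open>u (a b) = u(a) b + (-1)\<^bsup>|a|\<^esup> a u(b)\<close>.\<close>

definition odd_superderivation ::
    "('k, 'c) ring_scheme \<Rightarrow> ('k, 'a, 'd) superalgebra_scheme \<Rightarrow> ('a \<Rightarrow> 'a) \<Rightarrow> bool"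
  where "odd_superderivation K A u \<longleftrightarrow>
    linear_map K A A u \<and>
    u ` even_part A \<subseteq> odd_part A \<and> u ` odd_part A \<subseteq> even_part A \<and>
    (\<forall>a\<in>even_part A. \<forall>b\<in>carrier A. u (a \<otimes>\<^bsub>A\<^esub> b) = u a \<otimes>\<^bsub>A\<^esub> b \<oplus>\<^bsub>A\<^esub> a \<otimes>\<^bsub>A\<^esub> u b) \<and>
    (\<forall>a\<in>odd_part A. \<forall>b\<in>carrier A. u (a \<otimes>\<^bsub>A\<^esub> b) = u a \<otimes>\<^bsub>A\<^esub> b \<ominus>\<^bsub>A\<^esub> a \<otimes>\<^bsub>A\<^esub> u b)"


section \<open>The exterior algebra of a module\<close>

text \<open>The tensor algebra of \<open>M\<close> is presented as a quotient of the free associative \<open>R\<close>-algebra on the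
  set \<^term>\<open>carrier M\<close>: finitely supported \<open>R\<close>-valued functions on words in \<open>M\<close>.  Here \<open>R\<close> is a
  commutative algebra over a base field, which acts on coefficients; the parity is that of the
  word length.\<close>

definition free_alg :: "('k, 'r, 'c) module_scheme \<Rightarrow> ('r, 'm, 'd) module_scheme \<Rightarrow> ('k, 'm list \<Rightarrow> 'r) superalgebra"
  where "free_alg R M =
    (let C = {p. finite {w. p w \<noteq> \<zero>\<^bsub>R\<^esub>} \<and> (\<forall>w. p w \<in> carrier R) \<and>
                 (\<forall>w. \<not> set w \<subseteq> carrier M \<longrightarrow> p w = \<zero>\<^bsub>R\<^esub>)}
     in \<lparr>carrier = C,
         monoid.mult = (\<lambda>p q w. \<Oplus>\<^bsub>R\<^esub>i\<in>{..length w}. p (take i w) \<otimes>\<^bsub>R\<^esub> q (drop i w)),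
         monoid.one = single R [] \<one>\<^bsub>R\<^esub>,
         ring.zero = (\<lambda>w. \<zero>\<^bsub>R\<^esub>),
         ring.add = (\<lambda>p q w. p w \<oplus>\<^bsub>R\<^esub> q w),
         smult = (\<lambda>c p w. c \<odot>\<^bsub>R\<^esub> p w),
         even_part = {p \<in> C. \<forall>w. odd (length w) \<longrightarrow> p w = \<zero>\<^bsub>R\<^esub>},
         odd_part = {p \<in> C. \<forall>w. even (length w) \<longrightarrow> p w = \<zero>\<^bsub>R\<^esub>}\<rparr>)"

definition ext_relations :: "('k, 'r, 'c) module_scheme \<Rightarrow> ('r, 'm, 'd) module_scheme \<Rightarrow> ('m list \<Rightarrow> 'r) set"
  where "ext_relations R M =
    {single R [x \<oplus>\<^bsub>M\<^esub> y] \<one>\<^bsub>R\<^esub> \<ominus>\<^bsub>free_alg R M\<^esub> (single R [x] \<one>\<^bsub>R\<^esub> \<oplus>\<^bsub>free_alg R M\<^esub> single R [y] \<one>\<^bsub>R\<^esub>)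
      | x y. x \<in> carrier M \<and> y \<in> carrier M} \<union>
    {single R [r \<odot>\<^bsub>M\<^esub> x] \<one>\<^bsub>R\<^esub> \<ominus>\<^bsub>free_alg R M\<^esub> single R [x] r
      | r x. r \<in> carrier R \<and> x \<in> carrier M} \<union>
    {single R [x, x] \<one>\<^bsub>R\<^esub> | x. x \<in> carrier M}"

definition ext_ideal :: "('k, 'r, 'c) module_scheme \<Rightarrow> ('r, 'm, 'd) module_scheme \<Rightarrow> ('m list \<Rightarrow> 'r) set"
  where "ext_ideal R M = Idl\<^bsub>free_alg R M\<^esub> (ext_relations R M)"

definition exterior_algebra ::
    "('k, 'r, 'c) module_scheme \<Rightarrow> ('r, 'm, 'd) module_scheme \<Rightarrow> ('k, ('m list \<Rightarrow> 'r) set) superalgebra"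
  where "exterior_algebra R M = quot_superalgebra (free_alg R M) (ext_ideal R M)"

text \<open>The canonical maps from \<open>R\<close> (degree 0) and \<open>M\<close> (degree 1).\<close>

definition ext_scalar :: "('k, 'r, 'c) module_scheme \<Rightarrow> ('r, 'm, 'd) module_scheme \<Rightarrow> 'r \<Rightarrow> ('m list \<Rightarrow> 'r) set"
  where "ext_scalar R M r = ext_ideal R M +>\<^bsub>free_alg R M\<^esub> single R [] r"

definition ext_vector :: "('k, 'r, 'c) module_scheme \<Rightarrow> ('r, 'm, 'd) module_scheme \<Rightarrow> 'm \<Rightarrow> ('m list \<Rightarrow> 'r) set"
  where "ext_vector R M x = ext_ideal R M +>\<^bsub>free_alg R M\<^esub> single R [x] \<one>\<^bsub>R\<^esub>"


section \<open>Differential forms\<close>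

text \<open>Kaehler differentials of a commutative \<open>K\<close>-algebra \<open>R\<close>: the free \<open>R\<close>-module on symbols
  \<open>\<delta> f\<close> for \<open>f \<in> R\<close>, modulo additivity, the Leibniz rule and \<open>K\<close>-linearity.\<close>

definition kaehler_free :: "('r, 'c) ring_scheme \<Rightarrow> ('r, 'r \<Rightarrow> 'r) module"
  where "kaehler_free R =
    \<lparr>carrier = {p. finite {f. p f \<noteq> \<zero>\<^bsub>R\<^esub>} \<and> (\<forall>f. p f \<in> carrier R) \<and>
                   (\<forall>f. f \<notin> carrier R \<longrightarrow> p f = \<zero>\<^bsub>R\<^esub>)},
     monoid.mult = undefined, monoid.one = undefined,
     ring.zero = (\<lambda>f. \<zero>\<^bsub>R\<^esub>), ring.add = (\<lambda>p q f. p f \<oplus>\<^bsub>R\<^esub> q f),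
     smult = (\<lambda>r p f. r \<otimes>\<^bsub>R\<^esub> p f)\<rparr>"

definition kaehler_relations :: "('k, 'b) ring_scheme \<Rightarrow> ('k, 'r, 'c) module_scheme \<Rightarrow> ('r \<Rightarrow> 'r) set"
  where "kaehler_relations K R =
    (let F = kaehler_free R; \<delta> = (\<lambda>f. single R f \<one>\<^bsub>R\<^esub>) in
      {\<delta> (f \<oplus>\<^bsub>R\<^esub> g) \<ominus>\<^bsub>F\<^esub> (\<delta> f \<oplus>\<^bsub>F\<^esub> \<delta> g) | f g. f \<in> carrier R \<and> g \<in> carrier R} \<union>
      {\<delta> (f \<otimes>\<^bsub>R\<^esub> g) \<ominus>\<^bsub>F\<^esub> (f \<odot>\<^bsub>F\<^esub> \<delta> g \<oplus>\<^bsub>F\<^esub> g \<odot>\<^bsub>F\<^esub> \<delta> f) | f g. f \<in> carrier R \<and> g \<in> carrier R} \<union>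
      {\<delta> (c \<odot>\<^bsub>R\<^esub> f) \<ominus>\<^bsub>F\<^esub> ((c \<odot>\<^bsub>R\<^esub> \<one>\<^bsub>R\<^esub>) \<odot>\<^bsub>F\<^esub> \<delta> f) | c f. c \<in> carrier K \<and> f \<in> carrier R})"

definition kaehler_submodule :: "('k, 'b) ring_scheme \<Rightarrow> ('k, 'r, 'c) module_scheme \<Rightarrow> ('r \<Rightarrow> 'r) set"
  where "kaehler_submodule K R = gen_submodule R (kaehler_free R) (kaehler_relations K R)"

definition kaehler :: "('k, 'b) ring_scheme \<Rightarrow> ('k, 'r, 'c) module_scheme \<Rightarrow> ('r, ('r \<Rightarrow> 'r) set) module"
  where "kaehler K R = quot_module (kaehler_free R) (kaehler_submodule K R)"

definition kaehler_d :: "('k, 'b) ring_scheme \<Rightarrow> ('k, 'r, 'c) module_scheme \<Rightarrow> 'r \<Rightarrow> ('r \<Rightarrow> 'r) set"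
  where "kaehler_d K R f = kaehler_submodule K R +>\<^bsub>kaehler_free R\<^esub> single R f \<one>\<^bsub>R\<^esub>"

text \<open>The algebra of functions on the odd tangent bundle of \<open>Spec R\<close>.\<close>

definition de_rham_algebra ::
    "('k, 'b) ring_scheme \<Rightarrow> ('k, 'r, 'c) module_scheme \<Rightarrow> ('k, (('r \<Rightarrow> 'r) set list \<Rightarrow> 'r) set) superalgebra"
  where "de_rham_algebra K R = exterior_algebra R (kaehler K R)"

text \<open>The unique odd derivation of square zero that extends the universal derivation
  \<open>R \<rightarrow> \<Omega>\<^sup>1\<close>; values outside the carrier are normalised to make it unique as a function.\<close>

definition de_rham_d ::
    "('k, 'b) ring_scheme \<Rightarrow> ('k, 'r, 'c) module_scheme \<Rightarrow>
      (('r \<Rightarrow> 'r) set list \<Rightarrow> 'r) set \<Rightarrow> (('r \<Rightarrow> 'r) set list \<Rightarrow> 'r) set"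
  where "de_rham_d K R =
    (THE d. d \<in> extensional (carrier (de_rham_algebra K R)) \<and>
      odd_superderivation K (de_rham_algebra K R) d \<and>
      (\<forall>f\<in>carrier R. d (ext_scalar R (kaehler K R) f) = ext_vector R (kaehler K R) (kaehler_d K R f)) \<and>
      (\<forall>\<omega>\<in>carrier (de_rham_algebra K R). d (d \<omega>) = \<zero>\<^bsub>de_rham_algebra K R\<^esub>))"


section \<open>Points and cotangent spaces\<close>

text \<open>\<open>K\<close>-points are \<open>K\<close>-algebra homomorphisms to \<open>K\<close>.  In characteristic not 2 they
  automatically kill the odd part of a superalgebra, whose elements square to zero.\<close>

definition points :: "('k, 'c) ring_scheme \<Rightarrow> ('k, 'a, 'd) superalgebra_scheme \<Rightarrow> ('a \<Rightarrow> 'k) set"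
  where "points K A =
    {x \<in> ring_hom A K. \<forall>c\<in>carrier K. \<forall>a\<in>carrier A. x (c \<odot>\<^bsub>A\<^esub> a) = c \<otimes>\<^bsub>K\<^esub> x a}"

definition point_ideal :: "('k, 'c) ring_scheme \<Rightarrow> ('k, 'a, 'd) superalgebra_scheme \<Rightarrow> ('a \<Rightarrow> 'k) \<Rightarrow> 'a set"
  where "point_ideal K A x = a_kernel A K x"

definition point_ideal_sq :: "('k, 'c) ring_scheme \<Rightarrow> ('k, 'a, 'd) superalgebra_scheme \<Rightarrow> ('a \<Rightarrow> 'k) \<Rightarrow> 'a set"
  where "point_ideal_sq K A x = ideal_prod A (point_ideal K A x) (point_ideal K A x)"

text \<open>The superspace \<open>\<mm> / \<mm>\<^sup>2\<close>, obtained by restricting the record \<open>A\<close> to \<open>\<mm>\<close> before passing to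
  the quotient; of its multiplicative structure no use is made.\<close>

definition cotangent_space ::
    "('k, 'c) ring_scheme \<Rightarrow> ('k, 'a, 'd) superalgebra_scheme \<Rightarrow> ('a \<Rightarrow> 'k) \<Rightarrow> ('k, 'a set) superalgebra"
  where "cotangent_space K A x =
    quot_superalgebra
      (A\<lparr>carrier := point_ideal K A x,
         even_part := even_part A \<inter> point_ideal K A x,
         odd_part := odd_part A \<inter> point_ideal K A x\<rparr>)
      (point_ideal_sq K A x)"

text \<open>The action on \<open>\<mm> / \<mm>\<^sup>2\<close> induced by a vector field preserving \<open>\<mm>\<close>:
  the class of \<open>f\<close> goes to the class of \<open>u f\<close>.  It is linear because \<open>u\<close> is, so it is an
  isomorphism between two subspaces as soon as it is bijective between them.\<close>

definition cotangent_map ::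
    "('k, 'c) ring_scheme \<Rightarrow> ('k, 'a, 'd) superalgebra_scheme \<Rightarrow> ('a \<Rightarrow> 'a) \<Rightarrow> ('a \<Rightarrow> 'k) \<Rightarrow> 'a set \<Rightarrow> 'a set"
  where "cotangent_map K A u x Y = (\<Union>f\<in>Y. point_ideal_sq K A x +>\<^bsub>A\<^esub> u f)"

text \<open>The tangent vector of \<open>u\<close> at \<open>x\<close> is the functional \<open>f \<mapsto> (u f)(x)\<close>.\<close>

definition everywhere_vanishing ::
    "('k, 'c) ring_scheme \<Rightarrow> ('k, 'a, 'd) superalgebra_scheme \<Rightarrow> ('a \<Rightarrow> 'a) \<Rightarrow> bool"
  where "everywhere_vanishing K A u \<longleftrightarrow>
    (\<forall>x\<in>points K A. \<forall>f\<in>carrier A. x (u f) = \<zero>\<^bsub>K\<^esub>)"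

text \<open>Vanishing of the square of an odd vector field.  It is not a consequence of conditions on the
  cotangent spaces: on the algebra of polynomials in even \<open>x\<^sub>1, x\<^sub>2\<close> and odd \<open>\<xi>\<^sub>1, \<xi>\<^sub>2\<close>, the
  everywhere vanishing field \<open>\<xi>\<^sub>1 \<partial>/\<partial>x\<^sub>1 + \<xi>\<^sub>2 \<partial>/\<partial>x\<^sub>2 + \<xi>\<^sub>1\<xi>\<^sub>2 \<partial>/\<partial>\<xi>\<^sub>1\<close> acts on every cotangent space
  like the de Rham differential, but its square maps \<open>x\<^sub>1\<close> to \<open>\<xi>\<^sub>1\<xi>\<^sub>2\<close>.\<close>

definition homological :: "('k, 'a, 'd) superalgebra_scheme \<Rightarrow> ('a \<Rightarrow> 'a) \<Rightarrow> bool"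
  where "homological A u \<longleftrightarrow> (\<forall>f\<in>carrier A. u (u f) = \<zero>\<^bsub>A\<^esub>)"


section \<open>Smooth affine supervarieties\<close>

definition fin_gen_algebra :: "('k, 'c) ring_scheme \<Rightarrow> ('k, 'r, 'd) module_scheme \<Rightarrow> bool"
  where "fin_gen_algebra K R \<longleftrightarrow>
    (\<exists>S. finite S \<and> S \<subseteq> carrier R \<and>
      (\<forall>B. subring B R \<and> submodule B K R \<and> S \<subseteq> B \<longrightarrow> B = carrier R))"

text \<open>Varieties are reduced, and not required to be irreducible.\<close>

definition affine_variety :: "('k, 'c) ring_scheme \<Rightarrow> ('k, 'r, 'd) module_scheme \<Rightarrow> bool"
  where "affine_variety K R \<longleftrightarrow>
    algebra K R \<and> fin_gen_algebra K R \<and>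
    (\<forall>a\<in>carrier R. \<forall>n::nat. a [^]\<^bsub>R\<^esub> n = \<zero>\<^bsub>R\<^esub> \<longrightarrow> a = \<zero>\<^bsub>R\<^esub>)"

definition height :: "('r, 'c) ring_scheme \<Rightarrow> 'r set \<Rightarrow> enat"
  where "height R P =
    Sup {enat n | n. \<exists>c. (\<forall>i\<le>n. primeideal (c i) R) \<and> (\<forall>i<n. c i \<subset> c (Suc i)) \<and> c n = P}"

text \<open>Smoothness at the \<open>K\<close>-points: the local ring at \<open>\<mm>\<close>, whose Krull dimension is the height of
  \<open>\<mm>\<close>, is regular, i.e. of dimension equal to that of \<open>\<mm> / \<mm>\<^sup>2\<close>.\<close>

definition smooth_affine_variety :: "('k, 'c) ring_scheme \<Rightarrow> ('k, 'r, 'd) superalgebra_scheme \<Rightarrow> bool"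
  where "smooth_affine_variety K R \<longleftrightarrow>
    affine_variety K R \<and>
    (\<forall>x\<in>points K R. \<exists>n. has_dim K (cotangent_space K R x) n \<and> height R (point_ideal K R x) = enat n)"

text \<open>The algebra of functions on \<open>X\<^sub>0\<close>: the quotient by the ideal generated by the odd functions.\<close>

definition even_subscheme :: "('k, 'a, 'd) superalgebra_scheme \<Rightarrow> ('k, 'a set) superalgebra"
  where "even_subscheme A = quot_superalgebra A (Idl\<^bsub>A\<^esub> (odd_part A))"

text \<open>The superalgebra \<open>A\<close> is the exterior algebra of the vector bundle on \<open>X\<^sub>0\<close> with module of
  sections \<open>E\<close>.  The isomorphism is not part of the structure.\<close>

definition smooth_affine_supervariety ::
    "('k, 'c) ring_scheme \<Rightarrow> ('k, 'a, 'd) superalgebra_scheme \<Rightarrow> ('a set, 'e, 'f) module_scheme \<Rightarrow> bool"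
  where "smooth_affine_supervariety K A E \<longleftrightarrow>
    superalgebra K A \<and>
    smooth_affine_variety K (even_subscheme A) \<and>
    fg_projective (even_subscheme A) E \<and>
    (\<exists>\<psi>. superalgebra_iso K A (exterior_algebra (even_subscheme A) E) \<psi>)"

end

theory Submission
  imports Defs
begin

text \<open>A splitting \<open>s : R \<rightarrow> A\<close> of the functions on \<open>X\<^sub>0\<close> turns \<open>f \<mapsto> u (s f)\<close> into a derivation with
  values in the odd part of \<open>A\<close>, hence into an \<open>R\<close>-linear map \<open>h : \<Omega> \<rightarrow> A\<close> and a homomorphism \<open>H\<close>
  from the de Rham algebra to \<open>A\<close>.  The component \<open>\<Omega> \<rightarrow> E\<close> of \<open>h\<close> of degree one is surjective
  modulo every maximal ideal \<open>\<mm>\<^sub>x\<close> by the assumption on cotangent spaces, hence surjective by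
  Nakayama's lemma and the Nullstellensatz; it splits because \<open>E\<close> is projective, and its kernel, a
  finitely generated direct summand of \<open>\<Omega>\<close>, equals \<open>\<mm>\<^sub>x\<close> times itself for every \<open>x\<close>, hence is zero.
  Thus \<open>H\<close> is an isomorphism up to terms of higher degree, and therefore an isomorphism.  Transport
  of \<open>u\<close> along \<open>H\<close> is an odd derivation of square zero that extends the universal derivation, and
  there is only one of these.\<close>

section \<open>Points of finitely generated algebras\<close>

text \<open>The obstacle is that \<open>u\<close> need not respect the grading of the exterior
  algebra: \<open>u (s f)\<close> may have components of degree three and more. So \<open>H\<close>
  is not a graded map, and the cotangent spaces control only its part of lowest degree; the degree
  filtration, finite because \<open>E\<close> is finitely generated, has to absorb the rest. That
  the kernel of \<open>\<Omega> \<rightarrow> E\<close> is m_x times itself has the following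
  reason. Modulo m_x \<open>\<Omega>\<close> every form is \<open>d f\<close> with \<open>f\<close>
  in m_x. If the form maps to zero in \<open>E\<close>, then \<open>u (s f)\<close> lies in the
  square of the maximal ideal of \<open>A\<close> over \<open>x\<close>; injectivity on the
  cotangent space puts \<open>f\<close> into the square of m_x, and the Leibniz rule puts
  \<open>d f\<close> into m_x \<open>\<Omega>\<close>. The projection along the splitting is linear
  over \<open>R\<close> and carries m_x \<open>\<Omega>\<close> to m_x times the kernel, which is
  why surjectivity has to be proved and split before injectivity. The vanishing of the square of
  \<open>u\<close> enters at the end: that exact differentials are killed is what determines an odd
  derivation on one-forms.\<close>

lemma (in algebraically_closed) finsum_root:
  fixes c :: "nat \<Rightarrow> 'a"
  assumes c: "\<And>i. c i \<in> carrier L" and n: "n \<ge> 1" and nz: "c n \<noteq> \<zero>"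
  shows "\<exists>x\<in>carrier L. (\<Oplus>i\<in>{..n}. c i \<otimes> x [^] i) = \<zero>"
proof -
  \<comment> \<open>Algebraic closedness concerns polynomials as coefficient lists, leading
    coefficient first, whereas evaluation in \<open>UP\<close> unfolds to a finite sum;
    \<open>p m\<close> is the list that belongs to the sum up to degree \<open>m\<close>.\<close>
  define p :: "nat \<Rightarrow> 'a list" where "p = (\<lambda>n. map c (rev [0..<Suc n]))"
  have ev: "eval (p m) x = (\<Oplus>i\<in>{..m}. c i \<otimes> x [^] i)" if "x \<in> carrier L" for m x
  proof (induction m)
    case 0
    then show ?case using c that by (simp add: p_def)
  next
    case (Suc m)
    have "p (Suc m) = c (Suc m) # p m" by (simp add: p_def)
    then have "eval (p (Suc m)) x = c (Suc m) \<otimes> x [^] (length (p m)) \<oplus> eval (p m) x"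
      by simp
    also have "length (p m) = Suc m" by (simp add: p_def)
    finally show ?case using Suc c that by (simp add: Pi_def del: nat_pow_Suc)
  qed
  have car: "p n \<in> carrier (poly_ring L)"
    using c nz by (auto simp: p_def univ_poly_def polynomial_def)
  have "size (roots (p n)) = n"
    using roots_over_carrier[OF car] by (simp add: splitted_def p_def)
  with n obtain x where "x \<in># roots (p n)" by (metis not_one_le_zero size_empty multiset_nonemptyE)
  then have "is_root (p n) x" using roots_mem_iff_is_root[OF car] by simp
  then show ?thesis using ev by (auto simp: is_root_def)
qed

lemma (in domain) nat_pow_nonzero:
  "x \<in> carrier R \<Longrightarrow> x \<noteq> \<zero> \<Longrightarrow> x [^] (n::nat) \<noteq> \<zero>"
  by (induction n) (auto dest: integral)

text \<open>Two preimages under \<open>\<alpha>\<close> of the same element differ by an element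
  that \<open>\<alpha>\<close>, hence \<open>\<beta>\<close>, kills. The source is written as an
  image inside \<open>D\<close>, so that both subrings generated by evaluation and quotient rings
  are covered.\<close>

lemma ring_hom_factor:
  assumes P: "ring P" and D: "ring D" and K: "ring K"
    and \<alpha>: "\<alpha> \<in> ring_hom P D" and \<beta>: "\<beta> \<in> ring_hom P K"
    and ker: "\<And>p. p \<in> carrier P \<Longrightarrow> \<alpha> p = \<zero>\<^bsub>D\<^esub> \<Longrightarrow> \<beta> p = \<zero>\<^bsub>K\<^esub>"
  shows "\<exists>\<phi>\<in>ring_hom (D\<lparr>carrier := \<alpha> ` carrier P\<rparr>) K. \<forall>p\<in>carrier P. \<phi> (\<alpha> p) = \<beta> p"
proof -
  interpret P: ring P by fact
  interpret D: ring D by fact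
  interpret K: ring K by fact
  interpret a: ring_hom_ring P D \<alpha>
    by (rule ring_hom_ringI2) (use P D \<alpha> in auto)
  interpret b: ring_hom_ring P K \<beta>
    by (rule ring_hom_ringI2) (use P K \<beta> in auto)
  define g where "g = (\<lambda>y. SOME p. p \<in> carrier P \<and> \<alpha> p = y)"
  have g: "g (\<alpha> p) \<in> carrier P \<and> \<alpha> (g (\<alpha> p)) = \<alpha> p" if "p \<in> carrier P" for p
    unfolding g_def by (rule someI_ex) (use that in auto)
  have eq: "\<beta> (g (\<alpha> p)) = \<beta> p" if p: "p \<in> carrier P" for p
  proof -
    have "\<alpha> (g (\<alpha> p) \<ominus>\<^bsub>P\<^esub> p) = \<zero>\<^bsub>D\<^esub>"
      using g[OF p] p by (simp add: P.minus_eq D.r_neg)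
    then have "\<beta> (g (\<alpha> p) \<ominus>\<^bsub>P\<^esub> p) = \<zero>\<^bsub>K\<^esub>" using ker g[OF p] p by blast
    then show ?thesis using g[OF p] p
      by (simp add: P.minus_eq) (metis K.minus_eq K.r_right_minus_eq b.hom_closed)
  qed
  show ?thesis
  proof (intro bexI[of _ "\<beta> \<circ> g"] ballI)
    show "(\<beta> \<circ> g) (\<alpha> p) = \<beta> p" if "p \<in> carrier P" for p using eq[OF that] by simp
    show "\<beta> \<circ> g \<in> ring_hom (D\<lparr>carrier := \<alpha> ` carrier P\<rparr>) K"
    proof (rule ring_hom_memI)
      fix x y assume "x \<in> carrier (D\<lparr>carrier := \<alpha> ` carrier P\<rparr>)" "y \<in> carrier (D\<lparr>carrier := \<alpha> ` carrier P\<rparr>)"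
      then obtain p q where pq: "p \<in> carrier P" "q \<in> carrier P" "x = \<alpha> p" "y = \<alpha> q" by auto
      show "(\<beta> \<circ> g) (x \<otimes>\<^bsub>D\<lparr>carrier := \<alpha> ` carrier P\<rparr>\<^esub> y) = (\<beta> \<circ> g) x \<otimes>\<^bsub>K\<^esub> (\<beta> \<circ> g) y"
        using eq[of "p \<otimes>\<^bsub>P\<^esub> q"] pq eq by simp
      show "(\<beta> \<circ> g) (x \<oplus>\<^bsub>D\<lparr>carrier := \<alpha> ` carrier P\<rparr>\<^esub> y) = (\<beta> \<circ> g) x \<oplus>\<^bsub>K\<^esub> (\<beta> \<circ> g) y"
        using eq[of "p \<oplus>\<^bsub>P\<^esub> q"] pq eq by simp
    next
      show "(\<beta> \<circ> g) \<one>\<^bsub>D\<lparr>carrier := \<alpha> ` carrier P\<rparr>\<^esub> = \<one>\<^bsub>K\<^esub>"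
        using eq[of "\<one>\<^bsub>P\<^esub>"] by simp
    next
      fix x assume "x \<in> carrier (D\<lparr>carrier := \<alpha> ` carrier P\<rparr>)"
      then obtain p where "p \<in> carrier P" "x = \<alpha> p" by auto
      then show "(\<beta> \<circ> g) x \<in> carrier K" using eq by simp
    qed
  qed
qed

text \<open>The domain \<open>D\<close> is an algebra over \<open>K\<close> through \<open>\<kappa>\<close>.\<close>

definition separated_by_points ::
    "('k, 'c) ring_scheme \<Rightarrow> ('d, 'e) ring_scheme \<Rightarrow> ('k \<Rightarrow> 'd) \<Rightarrow> 'd set \<Rightarrow> bool"
  where "separated_by_points K D \<kappa> B \<longleftrightarrow>
    (\<forall>v\<in>B. v \<noteq> \<zero>\<^bsub>D\<^esub> \<longrightarrow>
      (\<exists>\<phi>\<in>ring_hom (D\<lparr>carrier := B\<rparr>) K. (\<forall>c\<in>carrier K. \<phi> (\<kappa> c) = c) \<and> \<phi> v \<noteq> \<zero>\<^bsub>K\<^esub>))"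

text \<open>If \<open>t\<close> is transcendental over \<open>B\<close>, it may be sent to any element of \<open>K\<close>
  that is not a root of the polynomial defining \<open>v\<close>.  If it is algebraic with relation \<open>p\<close> of minimal
  degree, it may be sent to any root of the image of \<open>p\<close>, by pseudo-division by \<open>p\<close>; that \<open>v\<close> does
  not vanish is ensured by a nonzero multiple of \<open>v\<close> that lies in \<open>B\<close>.\<close>

lemma separated_by_points_adjoin:
  assumes K: "algebraically_closed K" and D: "domain D" and B: "subring B D"
    and \<kappa>: "\<kappa> \<in> carrier K \<rightarrow> B" and t: "t \<in> carrier D"
    and sep: "separated_by_points K D \<kappa> B"
  shows "\<exists>T. subring T D \<and> B \<subseteq> T \<and> t \<in> T \<and> separated_by_points K D \<kappa> T"
proof -
  interpret K: algebraically_closed K by fact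
  interpret D: "domain" D by fact
  define S where "S = D\<lparr>carrier := B\<rparr>"
  define P where "P = UP S"
  have Bsub: "B \<subseteq> carrier D" using subringE(1)[OF B] .
  have cS: "carrier S = B" "\<zero>\<^bsub>S\<^esub> = \<zero>\<^bsub>D\<^esub>" "\<one>\<^bsub>S\<^esub> = \<one>\<^bsub>D\<^esub>" "x \<otimes>\<^bsub>S\<^esub> y = x \<otimes>\<^bsub>D\<^esub> y" "x \<oplus>\<^bsub>S\<^esub> y = x \<oplus>\<^bsub>D\<^esub> y" for x y
    by (simp_all add: S_def)
  interpret S: "domain" S unfolding S_def by (rule D.subring_is_domain[OF B])
  interpret P: UP_domain S P by unfold_locales (rule eq_reflection[OF P_def])
  have idh: "id \<in> ring_hom S D" using Bsub by (auto simp: ring_hom_def cS)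
  interpret e: UP_pre_univ_prop S D id P
    by unfold_locales (fact idh | rule eq_reflection[OF P_def])+
  define ev where "ev = UnivPoly.eval S D id t"
  have evh: "ev \<in> ring_hom P D" unfolding ev_def using e.eval_ring_hom[OF t] .
  interpret ev: ring_hom_cring P D ev by unfold_locales (fact evh)
  have ev_const: "ev (UnivPoly.monom P b 0) = b" if "b \<in> B" for b
    using e.eval_const[OF t, of b] that by (simp add: ev_def cS)
  have ev_t: "ev (UnivPoly.monom P \<one>\<^bsub>S\<^esub> 1) = t" using e.eval_monom1[OF t] by (simp add: ev_def)
  define T where "T = ev ` carrier P"
  have Tsub: "subring T D"
    unfolding T_def using ring_hom_ring.img_is_subring[OF ring_hom_ringI2[OF P.P.ring_axioms D.ring_axioms evh] P.P.carrier_is_subring] .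
  have BT: "B \<subseteq> T"
  proof
    fix b assume "b \<in> B"
    then show "b \<in> T" unfolding T_def using ev_const[of b]
      by (intro image_eqI[of _ _ "UnivPoly.monom P b 0"]) (auto simp: cS)
  qed
  have tT: "t \<in> T" unfolding T_def using ev_t by (intro image_eqI[of _ _ "UnivPoly.monom P \<one>\<^bsub>S\<^esub> 1"]) auto
  define I where "I = {p \<in> carrier P. ev p = \<zero>\<^bsub>D\<^esub>}"
  define ek where "ek = (\<lambda>\<phi> k. UnivPoly.eval S K \<phi> k)"
  have ek_hom: "ek \<phi> k \<in> ring_hom P K" and ek_const: "\<And>b. b \<in> B \<Longrightarrow> ek \<phi> k (UnivPoly.monom P b 0) = \<phi> b"
    and ek_sum: "\<And>p. p \<in> carrier P \<Longrightarrow> ek \<phi> k p = (\<Oplus>\<^bsub>K\<^esub>i\<in>{..deg S p}. \<phi> (UnivPoly.coeff P p i) \<otimes>\<^bsub>K\<^esub> k [^]\<^bsub>K\<^esub> i)"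
    if "\<phi> \<in> ring_hom S K" "k \<in> carrier K" for \<phi> k
  proof -
    interpret f: UP_pre_univ_prop S K \<phi> P
      by unfold_locales (fact that(1) | rule eq_reflection[OF P_def])+
    show "ek \<phi> k \<in> ring_hom P K" unfolding ek_def using f.eval_ring_hom[OF that(2)] .
    show "ek \<phi> k (UnivPoly.monom P b 0) = \<phi> b" if "b \<in> B" for b
      using f.eval_const[OF \<open>k \<in> carrier K\<close>, of b] that by (simp add: ek_def cS)
    show "ek \<phi> k p = (\<Oplus>\<^bsub>K\<^esub>i\<in>{..deg S p}. \<phi> (UnivPoly.coeff P p i) \<otimes>\<^bsub>K\<^esub> k [^]\<^bsub>K\<^esub> i)" if "p \<in> carrier P" for p
      unfolding ek_def using P.eval_on_carrier[OF that] .
  qed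
  \<comment> \<open>\<open>I\<close> is the ideal of relations satisfied by \<open>t\<close>:
    sending \<open>t\<close> to \<open>k\<close> is well defined on \<open>T\<close> as soon as the
    induced evaluation kills \<open>I\<close>.\<close>
  have descend: "\<exists>\<psi>\<in>ring_hom (D\<lparr>carrier := T\<rparr>) K. (\<forall>c\<in>carrier K. \<psi> (\<kappa> c) = c) \<and> (\<forall>p\<in>carrier P. \<psi> (ev p) = ek \<phi> k p)"
    if \<phi>: "\<phi> \<in> ring_hom S K" and k: "k \<in> carrier K" and \<phi>\<kappa>: "\<forall>c\<in>carrier K. \<phi> (\<kappa> c) = c"
      and ker: "\<And>p. p \<in> I \<Longrightarrow> ek \<phi> k p = \<zero>\<^bsub>K\<^esub>" for \<phi> k
  proof -
    obtain \<psi> where \<psi>: "\<psi> \<in> ring_hom (D\<lparr>carrier := T\<rparr>) K" "\<forall>p\<in>carrier P. \<psi> (ev p) = ek \<phi> k p"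
      using ring_hom_factor[OF P.P.ring_axioms D.ring_axioms K.ring_axioms evh ek_hom[OF \<phi> k]] ker
      unfolding T_def I_def by auto
    have "\<psi> (\<kappa> c) = c" if "c \<in> carrier K" for c
    proof -
      have b: "\<kappa> c \<in> B" using \<kappa> that by auto
      then have "\<psi> (ev (UnivPoly.monom P (\<kappa> c) 0)) = ek \<phi> k (UnivPoly.monom P (\<kappa> c) 0)"
        using \<psi>(2) by (simp add: cS)
      then show ?thesis using ev_const[OF b] ek_const[OF \<phi> k b] \<phi>\<kappa> that by simp
    qed
    with \<psi> show ?thesis by blast
  qed
  have "\<exists>\<psi>\<in>ring_hom (D\<lparr>carrier := T\<rparr>) K. (\<forall>c\<in>carrier K. \<psi> (\<kappa> c) = c) \<and> \<psi> v \<noteq> \<zero>\<^bsub>K\<^esub>"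
    if v: "v \<in> T" "v \<noteq> \<zero>\<^bsub>D\<^esub>" for v
  proof -
    obtain q where q: "q \<in> carrier P" "v = ev q" using v unfolding T_def by auto
    have q0: "q \<noteq> \<zero>\<^bsub>P\<^esub>" using q v ev.hom_zero by auto
    have lc: "UnivPoly.coeff P p (deg S p) \<in> B \<and> UnivPoly.coeff P p (deg S p) \<noteq> \<zero>\<^bsub>D\<^esub>"
      if "p \<in> carrier P" "p \<noteq> \<zero>\<^bsub>P\<^esub>" for p
      using P.lcoeff_nonzero2[OF that] P.lcoeff_closed[OF that(1)] by (simp add: cS)
    show ?thesis
    proof (cases "I \<subseteq> {\<zero>\<^bsub>P\<^esub>}")
      case True
      obtain \<phi> where \<phi>: "\<phi> \<in> ring_hom S K" "\<forall>c\<in>carrier K. \<phi> (\<kappa> c) = c" "\<phi> (UnivPoly.coeff P q (deg S q)) \<noteq> \<zero>\<^bsub>K\<^esub>"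
        using sep lc[OF q(1) q0] unfolding separated_by_points_def S_def by blast
      interpret f: ring_hom_ring S K \<phi> by (rule ring_hom_ringI2) (use \<phi> S.ring_axioms K.ring_axioms in auto)
      have cK: "\<phi> (UnivPoly.coeff P q i) \<in> carrier K" for i using q(1) by simp
      have "\<exists>k\<in>carrier K. ek \<phi> k q \<noteq> \<zero>\<^bsub>K\<^esub>"
      proof (cases "deg S q = 0")
        case True
        have "ek \<phi> \<zero>\<^bsub>K\<^esub> q \<noteq> \<zero>\<^bsub>K\<^esub>"
          using ek_sum[OF \<phi>(1) _ q(1), of "\<zero>\<^bsub>K\<^esub>"] True \<phi>(3) cK by simp
        then show ?thesis by blast
      next
        case False
        define c where "c = (\<lambda>i. \<phi> (UnivPoly.coeff P q i))"
        \<comment> \<open>Lowering the constant term by one and taking a root gives a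
          \<open>k\<close> at which \<open>q\<close> has the value one; the degree is positive, so
          the leading coefficient is not affected. This replaces the argument that \<open>K\<close>
          is infinite while \<open>q\<close> has finitely many roots.\<close>
        define c' where "c' = (\<lambda>i. if i = 0 then c 0 \<ominus>\<^bsub>K\<^esub> \<one>\<^bsub>K\<^esub> else c i)"
        have c: "c i \<in> carrier K" "c' i \<in> carrier K" for i using cK by (auto simp: c_def c'_def)
        have "c' (deg S q) \<noteq> \<zero>\<^bsub>K\<^esub>" using False \<phi>(3) by (simp add: c_def c'_def)
        then obtain k where k: "k \<in> carrier K" "(\<Oplus>\<^bsub>K\<^esub>i\<in>{..deg S q}. c' i \<otimes>\<^bsub>K\<^esub> k [^]\<^bsub>K\<^esub> i) = \<zero>\<^bsub>K\<^esub>"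
          using K.finsum_root[of c' "deg S q"] c False by auto
        obtain n where n: "deg S q = Suc n" using False by (cases "deg S q") auto
        have "(\<Oplus>\<^bsub>K\<^esub>i\<in>{..deg S q}. c i \<otimes>\<^bsub>K\<^esub> k [^]\<^bsub>K\<^esub> i) = (\<Oplus>\<^bsub>K\<^esub>i\<in>{..n}. c (Suc i) \<otimes>\<^bsub>K\<^esub> k [^]\<^bsub>K\<^esub> (Suc i)) \<oplus>\<^bsub>K\<^esub> c 0"
          unfolding n using c k(1) by (subst K.finsum_Suc2) (simp_all add: Pi_def)
        moreover have "(\<Oplus>\<^bsub>K\<^esub>i\<in>{..deg S q}. c' i \<otimes>\<^bsub>K\<^esub> k [^]\<^bsub>K\<^esub> i) = (\<Oplus>\<^bsub>K\<^esub>i\<in>{..n}. c (Suc i) \<otimes>\<^bsub>K\<^esub> k [^]\<^bsub>K\<^esub> (Suc i)) \<oplus>\<^bsub>K\<^esub> (c 0 \<ominus>\<^bsub>K\<^esub> \<one>\<^bsub>K\<^esub>)"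
          unfolding n using c k(1) by (subst K.finsum_Suc2) (simp_all add: Pi_def c'_def)
        moreover have X: "(\<Oplus>\<^bsub>K\<^esub>i\<in>{..n}. c (Suc i) \<otimes>\<^bsub>K\<^esub> k [^]\<^bsub>K\<^esub> (Suc i)) \<in> carrier K" (is "?X \<in> _")
          using c k(1) by (intro K.finsum_closed) auto
        ultimately have "?X \<oplus>\<^bsub>K\<^esub> c 0 \<ominus>\<^bsub>K\<^esub> \<one>\<^bsub>K\<^esub> = \<zero>\<^bsub>K\<^esub>" and e1: "ek \<phi> k q = ?X \<oplus>\<^bsub>K\<^esub> c 0"
          using k(2) c ek_sum[OF \<phi>(1) k(1) q(1)] by (simp_all add: K.minus_eq K.a_assoc c_def)
        then have "ek \<phi> k q = \<one>\<^bsub>K\<^esub>" using X c by simp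
        then show ?thesis using k by (intro bexI[of _ k]) simp_all
      qed
      then obtain k where k: "k \<in> carrier K" "ek \<phi> k q \<noteq> \<zero>\<^bsub>K\<^esub>" by blast
      have "ek \<phi> k p = \<zero>\<^bsub>K\<^esub>" if "p \<in> I" for p
        using True that ring_hom_zero[OF ek_hom[OF \<phi>(1) k(1)] P.P.ring_axioms K.ring_axioms] by auto
      then obtain \<psi> where "\<psi> \<in> ring_hom (D\<lparr>carrier := T\<rparr>) K" "\<forall>c\<in>carrier K. \<psi> (\<kappa> c) = c" "\<forall>p\<in>carrier P. \<psi> (ev p) = ek \<phi> k p"
        using descend[OF \<phi>(1) k(1) \<phi>(2)] by blast
      then show ?thesis using q k(2) by auto
    next
      case False
      have ex: "\<exists>p. p \<in> I \<and> p \<noteq> \<zero>\<^bsub>P\<^esub>" using False by auto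
      obtain p where p: "p \<in> I" "p \<noteq> \<zero>\<^bsub>P\<^esub>" and pmin': "\<And>r. r \<in> I \<and> r \<noteq> \<zero>\<^bsub>P\<^esub> \<Longrightarrow> deg S p \<le> deg S r"
        using ex_has_least_nat[of "\<lambda>p. p \<in> I \<and> p \<noteq> \<zero>\<^bsub>P\<^esub>" _ "deg S"] ex by blast
      have pmin: "r = \<zero>\<^bsub>P\<^esub>" if "r \<in> I" "deg S r < deg S p" for r
        using pmin'[of r] that by linarith
      have pP: "p \<in> carrier P" using p by (simp add: I_def)
      define a where "a = UnivPoly.coeff P p (deg S p)"
      have a: "a \<in> B" "a \<noteq> \<zero>\<^bsub>D\<^esub>" using lc[OF pP p(2)] by (auto simp: a_def)
      have smult: "b [^]\<^bsub>S\<^esub> n \<in> B" "b [^]\<^bsub>S\<^esub> n \<noteq> \<zero>\<^bsub>D\<^esub>" if "b \<in> B" "b \<noteq> \<zero>\<^bsub>D\<^esub>" for b and n::nat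
        using S.nat_pow_closed[of b n] S.nat_pow_nonzero[of b n] that by (auto simp: cS)
      have smev: "ev (b \<odot>\<^bsub>P\<^esub> f) = b \<otimes>\<^bsub>D\<^esub> ev f" if "b \<in> B" "f \<in> carrier P" for b f
        using that by (simp add: P.monom_mult_is_smult[symmetric] cS ev_const)
      have degpos: "deg S p \<ge> 1"
      proof (rule ccontr)
        assume "\<not> deg S p \<ge> 1"
        then have d0: "deg S p = 0" by simp
        then have "p = UnivPoly.monom P a 0" using P.deg_zero_impl_monom[OF pP] by (simp add: a_def)
        then show False using ev_const[OF a(1)] a(2) p(1) by (simp add: I_def)
      qed
      \<comment> \<open>\<open>J\<close> is the ideal of polynomials whose value at \<open>t\<close>
        is a multiple of \<open>v\<close> in \<open>T\<close>. An element of \<open>J\<close>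
        outside \<open>I\<close> of least degree turns out to be a constant \<open>b\<close>, which
        is the nonzero multiple of \<open>v\<close> in \<open>B\<close>.\<close>
      define J where "J = {f \<in> carrier P. \<exists>y\<in>T. ev f = v \<otimes>\<^bsub>D\<^esub> y}"
      have vD: "v \<in> carrier D" using q by simp
      have TD: "T \<subseteq> carrier D" using subringE(1)[OF Tsub] .
      have Jdiff: "b \<odot>\<^bsub>P\<^esub> f \<ominus>\<^bsub>P\<^esub> g \<in> J" if "f \<in> J" "g \<in> J" "b \<in> B" for f g b
      proof -
        obtain y z where y: "y \<in> T" "ev f = v \<otimes>\<^bsub>D\<^esub> y" and z: "z \<in> T" "ev g = v \<otimes>\<^bsub>D\<^esub> z"
          and fg: "f \<in> carrier P" "g \<in> carrier P" using \<open>f \<in> J\<close> \<open>g \<in> J\<close> unfolding J_def by auto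
        have car: "y \<in> carrier D" "z \<in> carrier D" "b \<in> carrier D" using y z TD Bsub that by auto
        have "ev (b \<odot>\<^bsub>P\<^esub> f \<ominus>\<^bsub>P\<^esub> g) = v \<otimes>\<^bsub>D\<^esub> (b \<otimes>\<^bsub>D\<^esub> y \<ominus>\<^bsub>D\<^esub> z)"
          using fg that(3) y z car vD by (simp add: P.P.minus_eq D.minus_eq cS smev D.r_distr D.r_minus D.m_lcomm)
        moreover have "b \<otimes>\<^bsub>D\<^esub> y \<ominus>\<^bsub>D\<^esub> z \<in> T"
          using subringE(5,6,7)[OF Tsub] BT that(3) y z by (metis D.minus_eq subringE(5)[OF Tsub] subsetD)
        ultimately show ?thesis using fg that(3) by (auto simp: J_def cS)
      qed
      have IJ: "f \<in> J" if "f \<in> I" for f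
        using that vD subringE(2)[OF Tsub] by (auto simp: I_def J_def intro!: bexI[of _ "\<zero>\<^bsub>D\<^esub>"])
      have Jmult: "f \<otimes>\<^bsub>P\<^esub> g \<in> J" if fJ: "f \<in> J" and gP: "g \<in> carrier P" for f g
      proof -
        obtain y where y: "y \<in> T" "ev f = v \<otimes>\<^bsub>D\<^esub> y" and f: "f \<in> carrier P" using fJ unfolding J_def by auto
        have "ev g \<in> T" using gP by (auto simp: T_def)
        then show ?thesis using y f gP vD TD subringE(6)[OF Tsub, of y "ev g"]
          by (auto simp: J_def D.m_assoc intro!: bexI[of _ "y \<otimes>\<^bsub>D\<^esub> ev g"])
      qed
      have qJ: "q \<in> J" using q vD subringE(3)[OF Tsub] by (auto simp: J_def intro!: bexI[of _ "\<one>\<^bsub>D\<^esub>"])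
      have qI: "q \<notin> I" using q v by (simp add: I_def)
      obtain r where r: "r \<in> J" "r \<notin> I" and rmin': "\<And>s. s \<in> J \<and> s \<notin> I \<Longrightarrow> deg S r \<le> deg S s"
        using ex_has_least_nat[of "\<lambda>p. p \<in> J \<and> p \<notin> I" q "deg S"] qJ qI by blast
      have rmin: "s \<in> I" if "s \<in> J" "deg S s < deg S r" for s
        using rmin'[of s] that by linarith
      have rP: "r \<in> carrier P" using r by (simp add: J_def)
      have zI: "\<zero>\<^bsub>P\<^esub> \<in> I" using ev.hom_zero by (simp add: I_def)
      have r0: "r \<noteq> \<zero>\<^bsub>P\<^esub>" using r zI by auto
      define b where "b = UnivPoly.coeff P r (deg S r)"
      have b: "b \<in> B" "b \<noteq> \<zero>\<^bsub>D\<^esub>" using lc[OF rP r0] by (auto simp: b_def)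
      have rem: "s = b' \<odot>\<^bsub>P\<^esub> f \<ominus>\<^bsub>P\<^esub> g \<otimes>\<^bsub>P\<^esub> h" if "b' \<odot>\<^bsub>P\<^esub> f = g \<otimes>\<^bsub>P\<^esub> h \<oplus>\<^bsub>P\<^esub> s"
        "b' \<in> B" "f \<in> carrier P" "g \<in> carrier P" "h \<in> carrier P" "s \<in> carrier P" for b' f g h s
        using that by (simp add: P.P.minus_eq P.P.a_assoc P.P.a_comm P.P.r_neg1 P.P.r_neg2 P.P.minus_equality cS)
          (metis P.P.a_comm P.P.a_inv_closed P.P.m_closed P.P.r_neg1 P.P.a_assoc)
      \<comment> \<open>Otherwise pseudo-division by \<open>p\<close> yields a remainder whose value
        is that of \<open>r\<close> times a power of \<open>a\<close>: it is again in
        \<open>J\<close> and outside \<open>I\<close>, but of smaller degree.\<close>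
      have deglt: "deg S r < deg S p"
      proof (rule ccontr)
        assume ge: "\<not> deg S r < deg S p"
        obtain h s k where hs: "h \<in> carrier P" "s \<in> carrier P" "a [^]\<^bsub>S\<^esub> (k::nat) \<odot>\<^bsub>P\<^esub> r = p \<otimes>\<^bsub>P\<^esub> h \<oplus>\<^bsub>P\<^esub> s"
          "s = \<zero>\<^bsub>P\<^esub> \<or> deg S s < deg S p"
          using P.long_div_theorem[OF pP rP p(2)] unfolding a_def by blast
        have "s \<in> J" unfolding rem[OF hs(3) smult(1)[OF a] rP pP hs(1,2)]
          using Jdiff Jmult IJ p r hs smult a by blast
        moreover have "ev s = a [^]\<^bsub>S\<^esub> k \<otimes>\<^bsub>D\<^esub> ev r"
        proof -
          have "ev (a [^]\<^bsub>S\<^esub> k \<odot>\<^bsub>P\<^esub> r) = ev s" unfolding hs(3) using hs p pP by (simp add: I_def)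
          then show ?thesis using smev smult a rP by simp
        qed
        then have "ev s \<noteq> \<zero>\<^bsub>D\<^esub>" using smult[OF a, of k] r rP Bsub D.integral by (force simp: I_def)
        then have "s \<notin> I" by (simp add: I_def)
        ultimately show False using hs(4) rmin[of s] ge zI by auto
      qed
      \<comment> \<open>If the degree were positive, \<open>p\<close> could be pseudo-divided by
        \<open>r\<close>. The remainder lies in \<open>J\<close> below the degree of
        \<open>r\<close>, hence in \<open>I\<close>, hence is zero by minimality of
        \<open>p\<close>. So \<open>r\<close> divides a multiple of \<open>p\<close>, and since
        \<open>D\<close> is a domain the cofactor \<open>h\<close> is a nonzero relation of smaller
        degree than \<open>p\<close>.\<close>
      have "deg S r = 0"
      proof (rule ccontr)
        assume e: "deg S r \<noteq> 0"
        obtain h s k where hs: "h \<in> carrier P" "s \<in> carrier P" "b [^]\<^bsub>S\<^esub> (k::nat) \<odot>\<^bsub>P\<^esub> p = r \<otimes>\<^bsub>P\<^esub> h \<oplus>\<^bsub>P\<^esub> s"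
          "s = \<zero>\<^bsub>P\<^esub> \<or> deg S s < deg S r"
          using P.long_div_theorem[OF rP pP r0] unfolding b_def by blast
        have "s \<in> J" unfolding rem[OF hs(3) smult(1)[OF b] pP rP hs(1,2)]
          using Jdiff Jmult IJ p r hs smult b by blast
        then have "s \<in> I" using hs(4) rmin zI by auto
        then have s0: "s = \<zero>\<^bsub>P\<^esub>" using hs(4) pmin deglt by auto
        have eq: "b [^]\<^bsub>S\<^esub> k \<odot>\<^bsub>P\<^esub> p = r \<otimes>\<^bsub>P\<^esub> h" using hs rP s0 by simp
        have dg: "deg S (b [^]\<^bsub>S\<^esub> k \<odot>\<^bsub>P\<^esub> p) = deg S p"
          using P.deg_smult[of "b [^]\<^bsub>S\<^esub> k" p] smult[OF b, of k] pP by (simp add: cS)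
        have h0: "h \<noteq> \<zero>\<^bsub>P\<^esub>" using eq dg rP degpos by auto
        have "ev r \<otimes>\<^bsub>D\<^esub> ev h = \<zero>\<^bsub>D\<^esub>"
        proof -
          have "ev (b [^]\<^bsub>S\<^esub> k \<odot>\<^bsub>P\<^esub> p) = \<zero>\<^bsub>D\<^esub>"
            using smev[OF smult(1)[OF b, of k] pP] p smult[OF b, of k] Bsub by (auto simp: I_def)
          then show ?thesis unfolding eq using rP hs by simp
        qed
        then have "h \<in> I" using D.integral[of "ev r" "ev h"] rP r hs by (auto simp: I_def)
        then have "deg S h \<ge> deg S p" using pmin h0 by force
        moreover have "deg S p = deg S r + deg S h" using dg eq P.deg_mult[OF r0 h0 rP hs(1)] by simp
        ultimately show False using e by simp
      qed
      then have rb: "r = UnivPoly.monom P b 0" using P.deg_zero_impl_monom[OF rP] by (simp add: b_def)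
      then obtain y where y: "y \<in> T" "b = v \<otimes>\<^bsub>D\<^esub> y" using r(1) ev_const[OF b(1)] by (auto simp: J_def)
      \<comment> \<open>A nonzero value at \<open>a\<close> keeps the image of \<open>p\<close> of
        positive degree, so that it has a root, and allows powers of \<open>a\<close> to be
        cancelled; a nonzero value at \<open>b\<close> keeps \<open>v\<close> from
        vanishing.\<close>
      have "a \<otimes>\<^bsub>D\<^esub> b \<in> B" "a \<otimes>\<^bsub>D\<^esub> b \<noteq> \<zero>\<^bsub>D\<^esub>"
        using a b subringE(6)[OF B] D.integral Bsub by blast+
      then obtain \<phi> where \<phi>: "\<phi> \<in> ring_hom S K" "\<forall>c\<in>carrier K. \<phi> (\<kappa> c) = c" "\<phi> (a \<otimes>\<^bsub>D\<^esub> b) \<noteq> \<zero>\<^bsub>K\<^esub>"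
        using sep unfolding separated_by_points_def S_def by blast
      interpret f: ring_hom_ring S K \<phi> by (rule ring_hom_ringI2) (use \<phi> S.ring_axioms K.ring_axioms in auto)
      have "\<phi> (a \<otimes>\<^bsub>D\<^esub> b) = \<phi> a \<otimes>\<^bsub>K\<^esub> \<phi> b" using f.hom_mult[of a b] a b by (simp add: cS)
      then have \<phi>ab: "\<phi> a \<noteq> \<zero>\<^bsub>K\<^esub>" "\<phi> b \<noteq> \<zero>\<^bsub>K\<^esub>" "\<phi> a \<in> carrier K" "\<phi> b \<in> carrier K"
        using \<phi>(3) a b f.hom_closed by (auto simp: cS)
      obtain k where k: "k \<in> carrier K" "ek \<phi> k p = \<zero>\<^bsub>K\<^esub>"
        using K.finsum_root[of "\<lambda>i. \<phi> (UnivPoly.coeff P p i)" "deg S p"] degpos \<phi>ab(1) ek_sum[OF \<phi>(1) _ pP] pP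
        unfolding a_def by auto
      interpret ek: ring_hom_ring P K "ek \<phi> k"
        by (rule ring_hom_ringI2) (use ek_hom[OF \<phi>(1) k(1)] P.P.ring_axioms K.ring_axioms in auto)
      \<comment> \<open>Pseudo-division of \<open>s\<close> by \<open>p\<close> leaves a relation of
        degree below \<open>p\<close>, hence zero. So a power of \<open>a\<close> times
        \<open>s\<close> is a multiple of \<open>p\<close>, and the root \<open>k\<close> kills
        it.\<close>
      have "ek \<phi> k s = \<zero>\<^bsub>K\<^esub>" if s: "s \<in> I" for s
      proof -
        have sP: "s \<in> carrier P" using s by (simp add: I_def)
        obtain h s' n where hs: "h \<in> carrier P" "s' \<in> carrier P" "a [^]\<^bsub>S\<^esub> (n::nat) \<odot>\<^bsub>P\<^esub> s = p \<otimes>\<^bsub>P\<^esub> h \<oplus>\<^bsub>P\<^esub> s'"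
          "s' = \<zero>\<^bsub>P\<^esub> \<or> deg S s' < deg S p"
          using P.long_div_theorem[OF pP sP p(2)] unfolding a_def by blast
        have an: "a [^]\<^bsub>S\<^esub> n \<in> B" using smult a by blast
        have "ev (a [^]\<^bsub>S\<^esub> n \<odot>\<^bsub>P\<^esub> s) = ev s'" unfolding hs(3) using hs p pP by (simp add: I_def)
        then have "s' \<in> I" using smev[OF an sP] s an Bsub hs by (auto simp: I_def)
        then have "s' = \<zero>\<^bsub>P\<^esub>" using hs(4) pmin by auto
        then have "ek \<phi> k (a [^]\<^bsub>S\<^esub> n \<odot>\<^bsub>P\<^esub> s) = \<zero>\<^bsub>K\<^esub>" using hs pP k by simp
        moreover have "ek \<phi> k (a [^]\<^bsub>S\<^esub> n \<odot>\<^bsub>P\<^esub> s) = (\<phi> a [^]\<^bsub>K\<^esub> n) \<otimes>\<^bsub>K\<^esub> ek \<phi> k s"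
          using an sP a ek_const[OF \<phi>(1) k(1) an] by (simp add: P.monom_mult_is_smult[symmetric] cS f.hom_nat_pow)
        moreover have "\<phi> a [^]\<^bsub>K\<^esub> n \<noteq> \<zero>\<^bsub>K\<^esub>" using \<phi>ab K.nat_pow_nonzero by simp
        ultimately show ?thesis using K.integral[of "\<phi> a [^]\<^bsub>K\<^esub> n" "ek \<phi> k s"] \<phi>ab sP by auto
      qed
      then obtain \<psi> where \<psi>: "\<psi> \<in> ring_hom (D\<lparr>carrier := T\<rparr>) K" "\<forall>c\<in>carrier K. \<psi> (\<kappa> c) = c" "\<forall>p\<in>carrier P. \<psi> (ev p) = ek \<phi> k p"
        using descend[OF \<phi>(1) k(1) \<phi>(2)] by blast
      have "\<psi> b = \<phi> b"
        using \<psi>(3) rb rP ev_const[OF b(1)] ek_const[OF \<phi>(1) k(1) b(1)] by metis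
      moreover have "\<psi> b = \<psi> v \<otimes>\<^bsub>K\<^esub> \<psi> y" using ring_hom_mult[OF \<psi>(1), of v y] v y by simp
      moreover have "\<psi> y \<in> carrier K" using ring_hom_closed[OF \<psi>(1)] y by simp
      ultimately have "\<psi> v \<noteq> \<zero>\<^bsub>K\<^esub>" using \<phi>ab by auto
      then show ?thesis using \<psi> by blast
    qed
  qed
  then show ?thesis using Tsub BT tT unfolding separated_by_points_def by blast
qed

text \<open>A ring homomorphism from a field to a domain is injective, and its inverse on the image
  is the required point.\<close>

lemma separated_by_points_base:
  assumes K: "field K" and D: "domain D" and \<kappa>: "\<kappa> \<in> ring_hom K D"
  shows "separated_by_points K D \<kappa> (\<kappa> ` carrier K)"
proof -
  interpret K: field K by fact
  interpret D: "domain" D by fact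
  interpret k: ring_hom_ring K D \<kappa> by (rule ring_hom_ringI2) (use \<kappa> K.ring_axioms D.ring_axioms in auto)
  have "c = \<zero>\<^bsub>K\<^esub>" if c: "c \<in> carrier K" "\<kappa> c = \<zero>\<^bsub>D\<^esub>" for c
  proof (rule ccontr)
    assume "c \<noteq> \<zero>\<^bsub>K\<^esub>"
    then have "c \<otimes>\<^bsub>K\<^esub> inv\<^bsub>K\<^esub> c = \<one>\<^bsub>K\<^esub>" "inv\<^bsub>K\<^esub> c \<in> carrier K"
      using c K.field_Units K.Units_r_inv K.Units_inv_closed by auto
    then have "\<kappa> c \<otimes>\<^bsub>D\<^esub> \<kappa> (inv\<^bsub>K\<^esub> c) = \<one>\<^bsub>D\<^esub>" "\<kappa> (inv\<^bsub>K\<^esub> c) \<in> carrier D"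
      using c k.hom_mult[of c "inv\<^bsub>K\<^esub> c"] by auto
    then show False using c(2) by simp
  qed
  then obtain \<phi> where \<phi>: "\<phi> \<in> ring_hom (D\<lparr>carrier := \<kappa> ` carrier K\<rparr>) K" "\<forall>c\<in>carrier K. \<phi> (\<kappa> c) = id c"
    using ring_hom_factor[OF K.ring_axioms D.ring_axioms K.ring_axioms \<kappa> id_ring_hom] by auto
  show ?thesis
    unfolding separated_by_points_def
  proof (intro ballI impI bexI[of _ \<phi>] conjI)
    fix v assume "v \<in> \<kappa> ` carrier K" "v \<noteq> \<zero>\<^bsub>D\<^esub>"
    then show "\<phi> v \<noteq> \<zero>\<^bsub>K\<^esub>" using \<phi>(2) by auto
  qed (use \<phi> in auto)
qed

lemma separated_by_points_finite:
  assumes K: "algebraically_closed K" and D: "domain D" and \<kappa>: "\<kappa> \<in> ring_hom K D"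
    and F: "finite F" "F \<subseteq> carrier D"
  shows "\<exists>T. subring T D \<and> \<kappa> ` carrier K \<subseteq> T \<and> F \<subseteq> T \<and> separated_by_points K D \<kappa> T"
  using F
proof (induction F)
  case empty
  interpret K: algebraically_closed K by fact
  interpret D: "domain" D by fact
  have "subring (\<kappa> ` carrier K) D"
    using ring_hom_ring.img_is_subring[OF ring_hom_ringI2[OF K.ring_axioms D.ring_axioms \<kappa>] K.carrier_is_subring] .
  then show ?case using separated_by_points_base[OF K.field_axioms D \<kappa>] by blast
next
  case (insert t F)
  then obtain T where T: "subring T D" "\<kappa> ` carrier K \<subseteq> T" "F \<subseteq> T" "separated_by_points K D \<kappa> T"
    by auto
  then obtain T' where "subring T' D" "T \<subseteq> T'" "t \<in> T'" "separated_by_points K D \<kappa> T'"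
    using separated_by_points_adjoin[OF K D T(1) _ _ T(4), of t] insert.prems by blast
  with T show ?case by blast
qed

text \<open>Zorn's lemma for the ideals that contain \<open>I\<close> and omit
  \<open>\<one>\<close>; this omission is what unions of chains preserve.\<close>

lemma (in cring) exists_maximalideal:
  assumes I: "ideal I R" "\<one> \<notin> I"
  shows "\<exists>M. maximalideal M R \<and> I \<subseteq> M"
proof -
  define AA where "AA = {J. ideal J R \<and> \<one> \<notin> J \<and> I \<subseteq> J}"
  have "\<exists>M\<in>AA. \<forall>Y\<in>AA. M \<subseteq> Y \<longrightarrow> Y = M"
  proof (rule subset_Zorn_nonempty)
    show "AA \<noteq> {}" using I by (auto simp: AA_def)
    fix CC assume C: "CC \<noteq> {}" "subset.chain AA CC"
    then have id: "ideal J R" and mem: "\<one> \<notin> J \<and> I \<subseteq> J" if "J \<in> CC" for J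
      using that unfolding subset_chain_def AA_def by auto
    have two: "\<exists>L\<in>CC. J \<subseteq> L \<and> J' \<subseteq> L" if "J \<in> CC" "J' \<in> CC" for J J'
    proof -
      have "J \<subseteq> J' \<or> J' \<subseteq> J" using that C(2) unfolding subset_chain_def by auto
      then show ?thesis using that by (elim disjE) auto
    qed
    have "ideal (\<Union>CC) R"
    proof (rule idealI[OF ring_axioms])
      show "subgroup (\<Union>CC) (add_monoid R)"
      proof (rule add.subgroupI)
        show "\<Union>CC \<subseteq> carrier R" using id ideal.Icarr by fastforce
        obtain J where J: "J \<in> CC" using C(1) by auto
        show "\<Union>CC \<noteq> {}" using J additive_subgroup.zero_closed[OF ideal.axioms(1)[OF id[OF J]]] by auto
        show "\<ominus> a \<in> \<Union>CC" if a: "a \<in> \<Union>CC" for a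
        proof -
          obtain J where J: "J \<in> CC" "a \<in> J" using a by auto
          then show ?thesis using additive_subgroup.a_inv_closed[OF ideal.axioms(1)[OF id[OF J(1)]]] by auto
        qed
        show "a \<oplus> b \<in> \<Union>CC" if ab: "a \<in> \<Union>CC" "b \<in> \<Union>CC" for a b
        proof -
          obtain J J' where J: "J \<in> CC" "a \<in> J" "J' \<in> CC" "b \<in> J'" using ab by auto
          then obtain L where L: "L \<in> CC" "a \<in> L" "b \<in> L" using two[of J J'] by auto
          then show ?thesis using additive_subgroup.a_closed[OF ideal.axioms(1)[OF id[OF L(1)]]] by auto
        qed
      qed
    next
      fix a x assume a: "a \<in> \<Union>CC" and x: "x \<in> carrier R"
      obtain J where J: "J \<in> CC" "a \<in> J" using a by auto
      show "x \<otimes> a \<in> \<Union>CC" using J ideal.I_l_closed[OF id[OF J(1)] J(2) x] by auto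
      show "a \<otimes> x \<in> \<Union>CC" using J ideal.I_r_closed[OF id[OF J(1)] J(2) x] by auto
    qed
    moreover have "\<one> \<notin> \<Union>CC" "I \<subseteq> \<Union>CC"
      using C(1) mem by auto
    ultimately show "\<Union>CC \<in> AA" by (simp add: AA_def)
  qed
  then obtain M where M: "M \<in> AA" "\<And>Y. Y \<in> AA \<Longrightarrow> M \<subseteq> Y \<Longrightarrow> Y = M" by blast
  have "maximalideal M R"
  proof (rule maximalidealI)
    show "ideal M R" "carrier R \<noteq> M" using M(1) by (auto simp: AA_def)
    fix J assume J: "ideal J R" "M \<subseteq> J" "J \<subseteq> carrier R"
    show "J = M \<or> J = carrier R"
    proof (cases "\<one> \<in> J")
      case True
      then show ?thesis using ideal.one_imp_carrier[OF J(1)] by simp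
    next
      case False
      then show ?thesis using M J by (auto simp: AA_def)
    qed
  qed
  then show ?thesis using M(1) by (auto simp: AA_def)
qed

text \<open>For a maximal ideal \<open>M\<close> above \<open>I\<close>, the images of the
  generators lie in a subring of the field R/M that is separated by points. A point of this subring,
  obtained from separation at the unit, pulls back to \<open>R\<close> and kills \<open>M\<close>;
  so R/M need not be identified with \<open>K\<close>.\<close>

theorem weak_nullstellensatz:
  assumes K: "algebraically_closed K" and R: "algebra K R" and fg: "fin_gen_algebra K R"
    and I: "ideal I R" "\<one>\<^bsub>R\<^esub> \<notin> I"
  shows "\<exists>x\<in>ring_hom R K. (\<forall>c\<in>carrier K. \<forall>a\<in>carrier R. x (c \<odot>\<^bsub>R\<^esub> a) = c \<otimes>\<^bsub>K\<^esub> x a) \<and> (\<forall>a\<in>I. x a = \<zero>\<^bsub>K\<^esub>)"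
proof -
  interpret K: algebraically_closed K by fact
  interpret R: algebra K R by fact
  interpret R: cring R by (rule R.M_cring)
  obtain M where M: "maximalideal M R" "I \<subseteq> M" using R.exists_maximalideal[OF I] by blast
  interpret M: maximalideal M R by fact
  define D where "D = R Quot M"
  interpret D: field D unfolding D_def by (rule M.quotient_is_field[OF R.cring_axioms])
  have qh: "(+>\<^bsub>R\<^esub>) M \<in> ring_hom R D" unfolding D_def by (rule M.rcos_ring_hom)
  interpret q: ring_hom_ring R D "(+>\<^bsub>R\<^esub>) M"
    by (rule ring_hom_ringI2) (use qh R.ring_axioms D.ring_axioms in auto)
  define \<iota> where "\<iota> = (\<lambda>c. c \<odot>\<^bsub>R\<^esub> \<one>\<^bsub>R\<^esub>)"
  have smult: "c \<odot>\<^bsub>R\<^esub> a = \<iota> c \<otimes>\<^bsub>R\<^esub> a" if "c \<in> carrier K" "a \<in> carrier R" for c a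
    using that R.smult_assoc2[of c "\<one>\<^bsub>R\<^esub>" a] by (simp add: \<iota>_def)
  have \<iota>: "\<iota> \<in> ring_hom K R"
  proof (rule ring_hom_memI)
    fix c e assume c: "c \<in> carrier K" "e \<in> carrier K"
    show "\<iota> (c \<otimes>\<^bsub>K\<^esub> e) = \<iota> c \<otimes>\<^bsub>R\<^esub> \<iota> e"
      using c smult[of c "\<iota> e"] R.smult_assoc1[of c e "\<one>\<^bsub>R\<^esub>"] by (simp add: \<iota>_def)
    show "\<iota> (c \<oplus>\<^bsub>K\<^esub> e) = \<iota> c \<oplus>\<^bsub>R\<^esub> \<iota> e"
      using c by (simp add: \<iota>_def R.smult_l_distr)
  qed (auto simp: \<iota>_def)
  define \<kappa> where "\<kappa> = (+>\<^bsub>R\<^esub>) M \<circ> \<iota>"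
  have \<kappa>: "\<kappa> \<in> ring_hom K D" unfolding \<kappa>_def by (rule ring_hom_trans[OF \<iota> qh])
  obtain S where S: "finite S" "S \<subseteq> carrier R"
    and gen: "\<And>B. subring B R \<Longrightarrow> submodule B K R \<Longrightarrow> S \<subseteq> B \<Longrightarrow> B = carrier R"
    using fg unfolding fin_gen_algebra_def by blast
  obtain T where T: "subring T D" "\<kappa> ` carrier K \<subseteq> T" "(+>\<^bsub>R\<^esub>) M ` S \<subseteq> T" and sep: "separated_by_points K D \<kappa> T"
    using separated_by_points_finite[OF K D.domain_axioms \<kappa>, of "(+>\<^bsub>R\<^esub>) M ` S"] S q.hom_closed by blast
  \<comment> \<open>The preimage of \<open>T\<close> is a subalgebra that contains the generators,
    hence all of \<open>R\<close>; so \<open>\<phi>\<close> is defined on every residue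
    class.\<close>
  define B where "B = {a \<in> carrier R. M +>\<^bsub>R\<^esub> a \<in> T}"
  have "subring B R"
    by (rule R.subringI) (auto simp: B_def subringE(3,5,6,7)[OF T(1)])
  moreover have "submodule B K R"
  proof (rule R.submoduleI)
    fix c a assume "c \<in> carrier K" "a \<in> B"
    moreover have "M +>\<^bsub>R\<^esub> \<iota> c \<in> T" if "c \<in> carrier K" for c using T(2) that by (auto simp: \<kappa>_def)
    ultimately show "c \<odot>\<^bsub>R\<^esub> a \<in> B"
      using smult[of c a] ring_hom_closed[OF \<iota>, of c] subringE(6)[OF T(1)] by (auto simp: B_def)
  qed (auto simp: B_def subringE(2,3,5,6,7)[OF T(1)])
  moreover have "S \<subseteq> B" using S T(3) by (auto simp: B_def)
  ultimately have BR: "B = carrier R" by (rule gen)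
  obtain \<phi> where \<phi>: "\<phi> \<in> ring_hom (D\<lparr>carrier := T\<rparr>) K" "\<forall>c\<in>carrier K. \<phi> (\<kappa> c) = c"
    using sep subringE(3)[OF T(1)] D.one_not_zero unfolding separated_by_points_def by blast
  define x where "x = \<phi> \<circ> (+>\<^bsub>R\<^esub>) M"
  have inT: "M +>\<^bsub>R\<^esub> a \<in> T" if "a \<in> carrier R" for a using that BR by (auto simp: B_def)
  have x: "x \<in> ring_hom R K"
    unfolding x_def
    by (rule ring_hom_trans[OF _ \<phi>(1)]) (auto simp: ring_hom_def inT)
  show ?thesis
  proof (intro bexI[OF _ x] conjI ballI)
    fix c a assume c: "c \<in> carrier K" "a \<in> carrier R"
    have "x (\<iota> c) = c" using \<phi>(2) c by (auto simp: x_def \<kappa>_def)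
    then show "x (c \<odot>\<^bsub>R\<^esub> a) = c \<otimes>\<^bsub>K\<^esub> x a"
      using smult[OF c] ring_hom_mult[OF x] ring_hom_closed[OF \<iota>] c by simp
  next
    fix a assume a: "a \<in> I"
    then have aM: "a \<in> M" using M by auto
    have "\<zero>\<^bsub>D\<^esub> = M" unfolding D_def FactRing_def by simp
    then have "M +>\<^bsub>R\<^esub> a = \<zero>\<^bsub>D\<^esub>" using M.a_rcos_const[OF aM] by metis
    moreover have "M +>\<^bsub>R\<^esub> \<zero>\<^bsub>R\<^esub> = \<zero>\<^bsub>D\<^esub>" by (rule q.hom_zero)
    ultimately have "x a = x \<zero>\<^bsub>R\<^esub>" by (simp add: x_def)
    then show "x a = \<zero>\<^bsub>K\<^esub>" using ring_hom_zero[OF x R.ring_axioms K.ring_axioms] by simp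
  qed
qed

section \<open>Nakayama's lemma\<close>

text \<open>For \<open>I\<close> the whole ring this is the submodule generated by \<open>F\<close>;
  for an ideal \<open>I\<close> and a generating set \<open>F\<close> it is the product of
  \<open>I\<close> with the module. One inductive set serves both and avoids indexed sums.\<close>

inductive_set ispan ::
    "('r, 'c) ring_scheme \<Rightarrow> ('r, 'm, 'd) module_scheme \<Rightarrow> 'r set \<Rightarrow> 'm set \<Rightarrow> 'm set"
  for R M I F where
    zero: "\<zero>\<^bsub>M\<^esub> \<in> ispan R M I F"
  | step: "a \<in> I \<Longrightarrow> c \<in> F \<Longrightarrow> y \<in> ispan R M I F \<Longrightarrow> a \<odot>\<^bsub>M\<^esub> c \<oplus>\<^bsub>M\<^esub> y \<in> ispan R M I F"

context module
begin

lemma ispan_closed: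
  assumes "ideal I R" "F \<subseteq> carrier M" and y: "y \<in> ispan R M I F"
  shows "y \<in> carrier M"
  using y by induction (use assms(2) ideal.Icarr[OF assms(1)] in auto)

lemma ispan_add:
  assumes "ideal I R" "F \<subseteq> carrier M" and x: "x \<in> ispan R M I F" and y: "y \<in> ispan R M I F"
  shows "x \<oplus>\<^bsub>M\<^esub> y \<in> ispan R M I F"
  using x
proof induction
  case zero
  then show ?case using y ispan_closed[OF assms(1,2) y] by simp
next
  case (step a c z)
  have "a \<in> carrier R" "c \<in> carrier M" using step assms ideal.Icarr by auto
  then have "a \<odot>\<^bsub>M\<^esub> c \<oplus>\<^bsub>M\<^esub> z \<oplus>\<^bsub>M\<^esub> y = a \<odot>\<^bsub>M\<^esub> c \<oplus>\<^bsub>M\<^esub> (z \<oplus>\<^bsub>M\<^esub> y)"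
    using ispan_closed[OF assms(1,2)] step y by (simp add: M.a_assoc)
  then show ?case using step by (simp add: ispan.step)
qed

lemma ispan_smult:
  assumes "ideal I R" "F \<subseteq> carrier M" and r: "r \<in> carrier R" and x: "x \<in> ispan R M I F"
  shows "r \<odot>\<^bsub>M\<^esub> x \<in> ispan R M I F"
  using x
proof induction
  case zero
  then show ?case using r by (simp add: ispan.zero)
next
  case (step a c z)
  have "a \<in> carrier R" "c \<in> carrier M" using step assms ideal.Icarr by auto
  then have "r \<odot>\<^bsub>M\<^esub> (a \<odot>\<^bsub>M\<^esub> c \<oplus>\<^bsub>M\<^esub> z) = (r \<otimes> a) \<odot>\<^bsub>M\<^esub> c \<oplus>\<^bsub>M\<^esub> r \<odot>\<^bsub>M\<^esub> z"
    using ispan_closed[OF assms(1,2)] step r by (simp add: smult_r_distr smult_assoc1)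
  then show ?case using step r ideal.I_l_closed[OF assms(1)] by (simp add: ispan.step)
qed

lemma ispan_incl:
  assumes "ideal I R" "F \<subseteq> carrier M" "a \<in> I" "c \<in> F"
  shows "a \<odot>\<^bsub>M\<^esub> c \<in> ispan R M I F"
  using ispan.step[where R=R and M=M, OF assms(3,4) ispan.zero] assms(2,4) ideal.Icarr[OF assms(1,3)] by auto

lemma span_submodule:
  assumes "F \<subseteq> carrier M"
  shows "submodule (ispan R M (carrier R) F) R M"
proof (rule submoduleI)
  note id = R.oneideal
  show "\<ominus>\<^bsub>M\<^esub> a \<in> ispan R M (carrier R) F" if "a \<in> ispan R M (carrier R) F" for a
    using ispan_smult[OF id assms _ that, of "\<ominus> \<one>"] ispan_closed[OF id assms that] smult_l_minus[of \<one> a] by simp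
qed (use assms ispan_closed[OF R.oneideal] ispan_add[OF R.oneideal] ispan_smult[OF R.oneideal] ispan.zero in auto)

lemma span_incl:
  assumes "F \<subseteq> carrier M" "c \<in> F"
  shows "c \<in> ispan R M (carrier R) F"
  using ispan_incl[OF R.oneideal assms(1) R.one_closed assms(2)] assms by auto

lemma span_least:
  assumes N: "submodule N R M" and F: "F \<subseteq> N" and x: "x \<in> ispan R M (carrier R) F"
  shows "x \<in> N"
  using x by induction (use F submodule.smult_closed[OF N] submoduleE(5)[OF N] subgroup.one_closed[OF submodule.axioms(1)[OF N]] in auto)

lemma ispan_smult_span:
  assumes I: "ideal I R" "F \<subseteq> carrier M" and r: "r \<in> I" and x: "x \<in> ispan R M (carrier R) F"
  shows "r \<odot>\<^bsub>M\<^esub> x \<in> ispan R M I F"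
  using x
proof induction
  case zero
  then show ?case using ideal.Icarr[OF I(1) r] by (simp add: ispan.zero)
next
  case (step a c z)
  have "a \<in> carrier R" "c \<in> carrier M" "z \<in> carrier M" "r \<in> carrier R"
    using step I r ideal.Icarr ispan_closed[OF R.oneideal I(2)] by auto
  then have "r \<odot>\<^bsub>M\<^esub> (a \<odot>\<^bsub>M\<^esub> c \<oplus>\<^bsub>M\<^esub> z) = (r \<otimes> a) \<odot>\<^bsub>M\<^esub> c \<oplus>\<^bsub>M\<^esub> r \<odot>\<^bsub>M\<^esub> z"
    by (simp add: smult_r_distr smult_assoc1)
  then show ?case using step r ideal.I_r_closed[OF I(1)] by (simp add: ispan.step)
qed

text \<open>Occurrences of \<open>c\<close> are collected in one coefficient, which stays in
  \<open>I\<close> because \<open>I\<close> is closed under sums. This isolates a generator for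
  elimination, both in Nakayama's lemma and in the vanishing of long exterior products.\<close>

lemma ispan_insertD:
  assumes I: "ideal I R" and F: "insert c F \<subseteq> carrier M" and x: "x \<in> ispan R M I (insert c F)"
  shows "\<exists>a\<in>I. \<exists>y\<in>ispan R M I F. x = a \<odot>\<^bsub>M\<^esub> c \<oplus>\<^bsub>M\<^esub> y"
  using x
proof induction
  case zero
  show ?case
    using F additive_subgroup.zero_closed[OF ideal.axioms(1)[OF I]] by (intro bexI[of _ \<zero>] bexI[OF _ ispan.zero]) auto
next
  case (step a d z)
  then obtain b y where y: "b \<in> I" "y \<in> ispan R M I F" "z = b \<odot>\<^bsub>M\<^esub> c \<oplus>\<^bsub>M\<^esub> y" by blast
  have car: "a \<in> carrier R" "b \<in> carrier R" "c \<in> carrier M" "d \<in> carrier M" "y \<in> carrier M"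
    using step y F ideal.Icarr[OF I] ispan_closed[OF I _ y(2)] by auto
  show ?case
  proof (cases "d = c")
    case True
    have "a \<odot>\<^bsub>M\<^esub> d \<oplus>\<^bsub>M\<^esub> z = (a \<oplus> b) \<odot>\<^bsub>M\<^esub> c \<oplus>\<^bsub>M\<^esub> y"
      using car y(3) True by (simp add: smult_l_distr M.a_assoc)
    moreover have "a \<oplus> b \<in> I"
      using step y additive_subgroup.a_closed[OF ideal.axioms(1)[OF I]] by simp
    ultimately show ?thesis using y by blast
  next
    case False
    have "a \<odot>\<^bsub>M\<^esub> d \<oplus>\<^bsub>M\<^esub> z = b \<odot>\<^bsub>M\<^esub> c \<oplus>\<^bsub>M\<^esub> (a \<odot>\<^bsub>M\<^esub> d \<oplus>\<^bsub>M\<^esub> y)"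
      using car y(3) by (simp add: M.a_lcomm)
    then show ?thesis using y step False ispan.step[of a I d F y R M] by auto
  qed
qed

text \<open>Relative to a submodule \<open>N\<close>, and by elimination of one generator at a time
  instead of the adjugate matrix; the factors \<open>s\<close> are needed for the induction.\<close>

lemma nakayama:
  assumes N: "submodule N R M" and I: "ideal I R" and F: "finite F" "F \<subseteq> carrier M"
    and gen: "\<And>c. c \<in> F \<Longrightarrow>
      \<exists>s\<in>carrier R. s \<ominus> \<one> \<in> I \<and> (\<exists>n\<in>N. \<exists>y\<in>ispan R M I F. s \<odot>\<^bsub>M\<^esub> c = n \<oplus>\<^bsub>M\<^esub> y)"
  shows "\<exists>r\<in>carrier R. r \<ominus> \<one> \<in> I \<and> (\<forall>c\<in>F. r \<odot>\<^bsub>M\<^esub> c \<in> N)"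
  using F gen
proof (induction F)
  case empty
  show ?case using additive_subgroup.zero_closed[OF ideal.axioms(1)[OF I]]
    by (intro bexI[of _ \<one>]) (auto simp: R.r_neg R.minus_eq)
next
  case (insert c F)
  note Iadd = additive_subgroup.a_closed[OF ideal.axioms(1)[OF I]]
  note Ineg = additive_subgroup.a_inv_closed[OF ideal.axioms(1)[OF I]]
  have N_sub: "N \<subseteq> carrier M" using submoduleE(1)[OF N] .
  have F: "F \<subseteq> carrier M" "c \<in> carrier M" using insert.prems(1) by auto
  obtain s' n y' where s': "s' \<in> carrier R" "s' \<ominus> \<one> \<in> I" "n \<in> N" "y' \<in> ispan R M I (insert c F)" "s' \<odot>\<^bsub>M\<^esub> c = n \<oplus>\<^bsub>M\<^esub> y'"
    using insert.prems(2)[of c] by blast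
  obtain a y where ay: "a \<in> I" "y \<in> ispan R M I F" "y' = a \<odot>\<^bsub>M\<^esub> c \<oplus>\<^bsub>M\<^esub> y"
    using ispan_insertD[OF I insert.prems(1) s'(4)] by blast
  have aR: "a \<in> carrier R" using ideal.Icarr[OF I ay(1)] .
  have yM: "y \<in> carrier M" using ispan_closed[OF I F(1) ay(2)] .
  have nM: "n \<in> carrier M" using s'(3) N_sub by auto
  \<comment> \<open>Subtracting the coefficient \<open>a\<close> moves the generator
    \<open>c\<close> to the left hand side; since \<open>a\<close> is in \<open>I\<close>, the new
    factor is still congruent to one modulo \<open>I\<close>.\<close>
  define s where "s = s' \<ominus> a"
  have s: "s \<in> carrier R" using s' aR by (simp add: s_def)
  have mulI: "u \<otimes> v \<ominus> \<one> \<in> I" if "u \<in> carrier R" "v \<in> carrier R" "u \<ominus> \<one> \<in> I" "v \<ominus> \<one> \<in> I" for u v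
  proof -
    have "u \<otimes> v \<ominus> \<one> = u \<otimes> (v \<ominus> \<one>) \<oplus> (u \<ominus> \<one>)"
      using that by (simp add: R.minus_eq R.r_distr R.a_assoc R.r_minus R.r_neg1 R.l_neg)
    then show ?thesis using that ideal.I_l_closed[OF I] Iadd by simp
  qed
  have sI: "s \<ominus> \<one> \<in> I"
  proof -
    have "s \<ominus> \<one> = (s' \<ominus> \<one>) \<oplus> \<ominus> a" using s' aR by (simp add: s_def R.minus_eq R.a_assoc R.a_comm R.a_lcomm)
    then show ?thesis using s' ay Iadd Ineg by simp
  qed
  have sc: "s \<odot>\<^bsub>M\<^esub> c = n \<oplus>\<^bsub>M\<^esub> y"
  proof -
    have "s \<odot>\<^bsub>M\<^esub> c = s' \<odot>\<^bsub>M\<^esub> c \<oplus>\<^bsub>M\<^esub> \<ominus>\<^bsub>M\<^esub> (a \<odot>\<^bsub>M\<^esub> c)"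
      using s' aR F by (simp add: s_def R.minus_eq smult_l_distr smult_l_minus)
    then show ?thesis unfolding s'(5) ay(3) using nM yM aR F
      by (simp add: M.a_assoc M.a_comm M.a_lcomm M.r_neg M.r_neg1 M.r_neg2)
  qed
  \<comment> \<open>Only the multiple \<open>s c\<close>, not \<open>c\<close> itself, is expressed
    through the other generators. So the equation for \<open>f\<close> is multiplied by
    \<open>s\<close> before \<open>c\<close> is substituted, which is where the factor in the
    hypothesis comes from.\<close>
  have "\<exists>t\<in>carrier R. t \<ominus> \<one> \<in> I \<and> (\<exists>n\<in>N. \<exists>y\<in>ispan R M I F. t \<odot>\<^bsub>M\<^esub> f = n \<oplus>\<^bsub>M\<^esub> y)" if f: "f \<in> F" for f
  proof -
    obtain t m z' where t: "t \<in> carrier R" "t \<ominus> \<one> \<in> I" "m \<in> N" "z' \<in> ispan R M I (insert c F)" "t \<odot>\<^bsub>M\<^esub> f = m \<oplus>\<^bsub>M\<^esub> z'"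
      using insert.prems(2)[of f] f by blast
    obtain b z where bz: "b \<in> I" "z \<in> ispan R M I F" "z' = b \<odot>\<^bsub>M\<^esub> c \<oplus>\<^bsub>M\<^esub> z"
      using ispan_insertD[OF I insert.prems(1) t(4)] by blast
    have car: "b \<in> carrier R" "z \<in> carrier M" "m \<in> carrier M" "f \<in> carrier M"
      using ideal.Icarr[OF I bz(1)] ispan_closed[OF I F(1) bz(2)] t(3) N_sub f F by auto
    have "(s \<otimes> t) \<odot>\<^bsub>M\<^esub> f = s \<odot>\<^bsub>M\<^esub> m \<oplus>\<^bsub>M\<^esub> (b \<odot>\<^bsub>M\<^esub> (s \<odot>\<^bsub>M\<^esub> c) \<oplus>\<^bsub>M\<^esub> s \<odot>\<^bsub>M\<^esub> z)"
    proof -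
      have "(s \<otimes> t) \<odot>\<^bsub>M\<^esub> f = s \<odot>\<^bsub>M\<^esub> (m \<oplus>\<^bsub>M\<^esub> (b \<odot>\<^bsub>M\<^esub> c \<oplus>\<^bsub>M\<^esub> z))"
        using s t(1,5) car bz(3) by (simp add: smult_assoc1)
      moreover have "s \<odot>\<^bsub>M\<^esub> (b \<odot>\<^bsub>M\<^esub> c) = b \<odot>\<^bsub>M\<^esub> (s \<odot>\<^bsub>M\<^esub> c)"
        using s car F by (simp add: smult_assoc1[symmetric] R.m_comm)
      ultimately show ?thesis using s car F by (simp add: smult_r_distr)
    qed
    also have "\<dots> = (s \<odot>\<^bsub>M\<^esub> m \<oplus>\<^bsub>M\<^esub> b \<odot>\<^bsub>M\<^esub> n) \<oplus>\<^bsub>M\<^esub> (b \<odot>\<^bsub>M\<^esub> y \<oplus>\<^bsub>M\<^esub> s \<odot>\<^bsub>M\<^esub> z)"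
      unfolding sc using s car nM yM by (simp add: smult_r_distr M.a_assoc)
    finally have "(s \<otimes> t) \<odot>\<^bsub>M\<^esub> f = (s \<odot>\<^bsub>M\<^esub> m \<oplus>\<^bsub>M\<^esub> b \<odot>\<^bsub>M\<^esub> n) \<oplus>\<^bsub>M\<^esub> (b \<odot>\<^bsub>M\<^esub> y \<oplus>\<^bsub>M\<^esub> s \<odot>\<^bsub>M\<^esub> z)" .
    moreover have "s \<odot>\<^bsub>M\<^esub> m \<oplus>\<^bsub>M\<^esub> b \<odot>\<^bsub>M\<^esub> n \<in> N"
      using submoduleE(4,5)[OF N] s car t s' by simp
    moreover have "b \<odot>\<^bsub>M\<^esub> y \<oplus>\<^bsub>M\<^esub> s \<odot>\<^bsub>M\<^esub> z \<in> ispan R M I F"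
      using ispan_add[OF I F(1)] ispan_smult[OF I F(1)] ay bz s car by simp
    moreover have "s \<otimes> t \<ominus> \<one> \<in> I" using mulI s t sI by simp
    ultimately show ?thesis using s t by (intro bexI[of _ "s \<otimes> t"]) auto
  qed
  then obtain r where r: "r \<in> carrier R" "r \<ominus> \<one> \<in> I" "\<forall>c\<in>F. r \<odot>\<^bsub>M\<^esub> c \<in> N"
    using insert.IH F by blast
  have rN: "r \<odot>\<^bsub>M\<^esub> z \<in> N" if "z \<in> ispan R M I F" for z
    using that
  proof induction
    case zero
    then show ?case using r subgroup.one_closed[OF submodule.axioms(1)[OF N]] by simp
  next
    case (step a c z)
    have "a \<in> carrier R" "c \<in> carrier M" "z \<in> carrier M" using step ideal.Icarr[OF I] F ispan_closed[OF I F(1)] by auto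
    then have "r \<odot>\<^bsub>M\<^esub> (a \<odot>\<^bsub>M\<^esub> c \<oplus>\<^bsub>M\<^esub> z) = a \<odot>\<^bsub>M\<^esub> (r \<odot>\<^bsub>M\<^esub> c) \<oplus>\<^bsub>M\<^esub> r \<odot>\<^bsub>M\<^esub> z"
      using r by (simp add: smult_r_distr smult_assoc1[symmetric] R.m_comm)
    then show ?case using step r submoduleE(4,5)[OF N] \<open>a \<in> carrier R\<close> by simp
  qed
  show ?case
  proof (intro bexI[of _ "r \<otimes> s"] conjI ballI)
    show "r \<otimes> s \<ominus> \<one> \<in> I" using mulI r s sI by simp
    fix f assume f: "f \<in> insert c F"
    show "(r \<otimes> s) \<odot>\<^bsub>M\<^esub> f \<in> N"
    proof (cases "f = c")
      case True
      have "(r \<otimes> s) \<odot>\<^bsub>M\<^esub> c = r \<odot>\<^bsub>M\<^esub> n \<oplus>\<^bsub>M\<^esub> r \<odot>\<^bsub>M\<^esub> y"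
        using r s F sc nM yM by (simp add: smult_assoc1 smult_r_distr)
      then show ?thesis using True rN ay(2) submoduleE(4,5)[OF N] r s' by simp
    next
      case False
      then have "f \<in> F" using f by auto
      then have "(r \<otimes> s) \<odot>\<^bsub>M\<^esub> f = s \<odot>\<^bsub>M\<^esub> (r \<odot>\<^bsub>M\<^esub> f)"
        using r s F by (subst R.m_comm) (auto simp: smult_assoc1)
      then show ?thesis using r s submoduleE(4)[OF N] \<open>f \<in> F\<close> by simp
    qed
  qed (use r s in simp)
qed

end

text \<open>The condition of \<open>points\<close> as a predicate, for algebras that carry no
  parity.\<close>

definition point :: "('k, 'c) ring_scheme \<Rightarrow> ('k, 'r, 'd) module_scheme \<Rightarrow> ('r \<Rightarrow> 'k) \<Rightarrow> bool"
  where "point K R x \<longleftrightarrow> x \<in> ring_hom R K \<and>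
    (\<forall>c\<in>carrier K. \<forall>a\<in>carrier R. x (c \<odot>\<^bsub>R\<^esub> a) = c \<otimes>\<^bsub>K\<^esub> x a)"

text \<open>The elements of \<open>R\<close> that move \<open>F\<close> into \<open>N\<close> form
  an ideal. If it were proper, some point \<open>x\<close> would vanish on it; but Nakayama's lemma
  at \<open>x\<close> provides an element of it with value one at \<open>x\<close>. This ideal takes
  the place of localisation.\<close>

lemma nakayama_points:
  assumes K: "algebraically_closed K" and R: "algebra K R" and fg: "fin_gen_algebra K R"
    and M: "module R M" and N: "submodule N R M" and F: "finite F" "F \<subseteq> carrier M"
    and fib: "\<And>x c. point K R x \<Longrightarrow> c \<in> F \<Longrightarrow> \<exists>n\<in>N. \<exists>y\<in>ispan R M (a_kernel R K x) F. c = n \<oplus>\<^bsub>M\<^esub> y"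
  shows "F \<subseteq> N"
proof -
  interpret K: algebraically_closed K by fact
  interpret M: module R M by fact
  define I where "I = {r \<in> carrier R. \<forall>c\<in>F. r \<odot>\<^bsub>M\<^esub> c \<in> N}"
  have FM: "c \<in> carrier M" if "c \<in> F" for c using that F by auto
  have I: "ideal I R"
  proof (rule idealI[OF M.R.ring_axioms])
    show "subgroup I (add_monoid R)"
    proof (rule M.R.add.subgroupI)
      have "\<zero>\<^bsub>R\<^esub> \<in> I" using FM subgroup.one_closed[OF submodule.axioms(1)[OF N]] by (simp add: I_def)
      then show "I \<noteq> {}" by auto
    next
      fix a b assume ab: "a \<in> I" "b \<in> I"
      then show "\<ominus>\<^bsub>R\<^esub> a \<in> I" using FM M.submoduleE(3)[OF N] by (simp add: I_def M.smult_l_minus)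
      show "a \<oplus>\<^bsub>R\<^esub> b \<in> I" using ab FM M.submoduleE(5)[OF N] by (simp add: I_def M.smult_l_distr)
    qed (simp add: I_def)
    fix a x assume a: "a \<in> I" "x \<in> carrier R"
    then show "x \<otimes>\<^bsub>R\<^esub> a \<in> I"
      using FM M.submoduleE(4)[OF N] by (simp add: I_def M.smult_assoc1)
    then show "a \<otimes>\<^bsub>R\<^esub> x \<in> I" using a by (simp add: I_def M.R.m_comm[of a x])
  qed
  have "\<one>\<^bsub>R\<^esub> \<in> I"
  proof (rule ccontr)
    assume "\<one>\<^bsub>R\<^esub> \<notin> I"
    then obtain x where x: "point K R x" "\<forall>a\<in>I. x a = \<zero>\<^bsub>K\<^esub>"
      using weak_nullstellensatz[OF K R fg I] unfolding point_def by blast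
    interpret x: ring_hom_ring R K x
      by (rule ring_hom_ringI2) (use x K.ring_axioms M.R.ring_axioms in \<open>auto simp: point_def\<close>)
    have "\<exists>r\<in>carrier R. r \<ominus>\<^bsub>R\<^esub> \<one>\<^bsub>R\<^esub> \<in> a_kernel R K x \<and> (\<forall>c\<in>F. r \<odot>\<^bsub>M\<^esub> c \<in> N)"
    proof (rule M.nakayama[OF N x.kernel_is_ideal F])
      fix c assume c: "c \<in> F"
      then obtain n y where "n \<in> N" "y \<in> ispan R M (a_kernel R K x) F" "c = n \<oplus>\<^bsub>M\<^esub> y" using fib[OF x(1)] by blast
      then show "\<exists>s\<in>carrier R. s \<ominus>\<^bsub>R\<^esub> \<one>\<^bsub>R\<^esub> \<in> a_kernel R K x \<and>
          (\<exists>n\<in>N. \<exists>y\<in>ispan R M (a_kernel R K x) F. s \<odot>\<^bsub>M\<^esub> c = n \<oplus>\<^bsub>M\<^esub> y)"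
        using c F additive_subgroup.zero_closed[OF ideal.axioms(1)[OF x.kernel_is_ideal]]
        by (intro bexI[of _ "\<one>\<^bsub>R\<^esub>"] conjI) (auto simp: M.R.minus_eq M.R.r_neg subset_iff)
    qed
    then obtain r where r: "r \<in> carrier R" "r \<ominus>\<^bsub>R\<^esub> \<one>\<^bsub>R\<^esub> \<in> a_kernel R K x" "\<forall>c\<in>F. r \<odot>\<^bsub>M\<^esub> c \<in> N"
      by blast
    then have "x r = \<zero>\<^bsub>K\<^esub>" using x(2) by (simp add: I_def)
    moreover have "x (r \<ominus>\<^bsub>R\<^esub> \<one>\<^bsub>R\<^esub>) = \<zero>\<^bsub>K\<^esub>" using r(2) unfolding a_kernel_def' by blast
    moreover have "x (r \<ominus>\<^bsub>R\<^esub> \<one>\<^bsub>R\<^esub>) = x r \<ominus>\<^bsub>K\<^esub> \<one>\<^bsub>K\<^esub>"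
      using r(1) x.hom_add[of r "\<ominus>\<^bsub>R\<^esub> \<one>\<^bsub>R\<^esub>"] x.hom_a_inv[of "\<one>\<^bsub>R\<^esub>"] x.hom_one unfolding a_minus_def by simp
    ultimately show False using K.r_right_minus_eq[of "\<zero>\<^bsub>K\<^esub>" "\<one>\<^bsub>K\<^esub>"] by simp
  qed
  then show ?thesis using FM by (auto simp: I_def)
qed

section \<open>Linear maps, quotients and finitely supported functions\<close>

lemma (in abelian_group) minus_eq_zero_iff:
  assumes "x \<in> carrier G" "y \<in> carrier G"
  shows "x \<ominus> y = \<zero> \<longleftrightarrow> x = y"
  unfolding a_minus_def using assms by (metis a_inv_closed minus_equality minus_minus r_neg)

lemma linear_mapI:
  assumes "\<And>x. x \<in> carrier M \<Longrightarrow> h x \<in> carrier N"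
    and "\<And>x y. x \<in> carrier M \<Longrightarrow> y \<in> carrier M \<Longrightarrow> h (x \<oplus>\<^bsub>M\<^esub> y) = h x \<oplus>\<^bsub>N\<^esub> h y"
    and "\<And>r x. r \<in> carrier R \<Longrightarrow> x \<in> carrier M \<Longrightarrow> h (r \<odot>\<^bsub>M\<^esub> x) = r \<odot>\<^bsub>N\<^esub> h x"
  shows "linear_map R M N h"
  using assms unfolding linear_map_def by auto

lemma linear_mapD:
  assumes "linear_map R M N h"
  shows "x \<in> carrier M \<Longrightarrow> h x \<in> carrier N"
    and "x \<in> carrier M \<Longrightarrow> y \<in> carrier M \<Longrightarrow> h (x \<oplus>\<^bsub>M\<^esub> y) = h x \<oplus>\<^bsub>N\<^esub> h y"
    and "r \<in> carrier R \<Longrightarrow> x \<in> carrier M \<Longrightarrow> h (r \<odot>\<^bsub>M\<^esub> x) = r \<odot>\<^bsub>N\<^esub> h x"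
  using assms unfolding linear_map_def by auto

lemma linear_map_zero:
  assumes "module R M" "module R N" "linear_map R M N h"
  shows "h \<zero>\<^bsub>M\<^esub> = \<zero>\<^bsub>N\<^esub>"
proof -
  interpret M: module R M by fact
  interpret N: module R N by fact
  show ?thesis
    using linear_mapD(3)[OF assms(3) M.R.zero_closed M.M.zero_closed] linear_mapD(1)[OF assms(3) M.M.zero_closed] by simp
qed

lemma linear_map_a_inv:
  assumes "module R M" "module R N" "linear_map R M N h" "x \<in> carrier M"
  shows "h (\<ominus>\<^bsub>M\<^esub> x) = \<ominus>\<^bsub>N\<^esub> h x"
proof -
  interpret M: module R M by fact
  interpret N: module R N by fact
  show ?thesis
    using linear_mapD(3)[OF assms(3), of "\<ominus>\<^bsub>R\<^esub> \<one>\<^bsub>R\<^esub>" x] linear_mapD(1)[OF assms(3,4)] assms(4)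
    by (simp add: M.smult_l_minus N.smult_l_minus)
qed

lemma linear_map_minus:
  assumes "module R M" "module R N" "linear_map R M N h" "x \<in> carrier M" "y \<in> carrier M"
  shows "h (x \<ominus>\<^bsub>M\<^esub> y) = h x \<ominus>\<^bsub>N\<^esub> h y"
proof -
  interpret M: module R M by fact
  show ?thesis unfolding a_minus_def
    using linear_mapD(2)[OF assms(3,4), of "\<ominus>\<^bsub>M\<^esub> y"] linear_map_a_inv[OF assms(1-3,5)] assms(5) by simp
qed

lemma linear_map_kernel_submodule:
  assumes "module R M" "module R N" "linear_map R M N h"
  shows "submodule {x \<in> carrier M. h x = \<zero>\<^bsub>N\<^esub>} R M"
proof -
  interpret M: module R M by fact
  interpret N: module R N by fact
  show ?thesis
    by (rule M.submoduleI)
      (use linear_map_zero[OF assms] linear_map_a_inv[OF assms] linear_mapD[OF assms(3)] in auto)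
qed

lemma linear_map_image_submodule:
  assumes "module R M" "module R N" "linear_map R M N h"
  shows "submodule (h ` carrier M) R N"
proof -
  interpret M: module R M by fact
  interpret N: module R N by fact
  show ?thesis
  proof (rule N.submoduleI)
    show "\<zero>\<^bsub>N\<^esub> \<in> h ` carrier M" using linear_map_zero[OF assms] by (metis M.M.zero_closed imageI)
    show "\<ominus>\<^bsub>N\<^esub> a \<in> h ` carrier M" if "a \<in> h ` carrier M" for a
      using that by (auto simp flip: linear_map_a_inv[OF assms])
    show "a \<oplus>\<^bsub>N\<^esub> b \<in> h ` carrier M" if "a \<in> h ` carrier M" "b \<in> h ` carrier M" for a b
      using that by (auto simp flip: linear_mapD(2)[OF assms(3)])
    show "r \<odot>\<^bsub>N\<^esub> a \<in> h ` carrier M" if "r \<in> carrier R" "a \<in> h ` carrier M" for r a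
      using that by (auto simp flip: linear_mapD(3)[OF assms(3)])
  qed (use linear_mapD(1)[OF assms(3)] in auto)
qed

lemma submodule_abelian_subgroup:
  assumes "module R M" "submodule N R M"
  shows "abelian_subgroup N M"
proof -
  interpret M: module R M by fact
  show ?thesis using submodule.axioms(1)[OF assms(2)] M.M.abelian_group_axioms
    by (intro abelian_subgroupI3 additive_subgroupI)
qed

section \<open>Quotient modules and generated submodules\<close>

context module
begin

lemma coset_eq_iff:
  assumes "submodule N R M" "x \<in> carrier M" "y \<in> carrier M"
  shows "N +>\<^bsub>M\<^esub> x = N +>\<^bsub>M\<^esub> y \<longleftrightarrow> x \<ominus>\<^bsub>M\<^esub> y \<in> N"
proof -
  interpret N: abelian_subgroup N M by (rule submodule_abelian_subgroup[OF module_axioms assms(1)])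
  show ?thesis
    unfolding a_minus_def
    using assms(2,3) N.a_rcos_module[of y x] N.a_repr_independence'[of x y] N.a_rcos_self[of x] by metis
qed

lemma quot_module_carrier: "carrier (quot_module M N) = (\<lambda>x. N +>\<^bsub>M\<^esub> x) ` carrier M"
  by (auto simp: quot_module_def A_RCOSETS_def')

lemma quot_module_add:
  assumes "submodule N R M" "x \<in> carrier M" "y \<in> carrier M"
  shows "(N +>\<^bsub>M\<^esub> x) \<oplus>\<^bsub>quot_module M N\<^esub> (N +>\<^bsub>M\<^esub> y) = N +>\<^bsub>M\<^esub> (x \<oplus>\<^bsub>M\<^esub> y)"
proof -
  interpret N: abelian_subgroup N M by (rule submodule_abelian_subgroup[OF module_axioms assms(1)])
  show ?thesis using N.a_rcos_sum[OF assms(2,3)] by (simp add: quot_module_def)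
qed

lemma quot_module_smult:
  assumes "submodule N R M" "r \<in> carrier R" "x \<in> carrier M"
  shows "r \<odot>\<^bsub>quot_module M N\<^esub> (N +>\<^bsub>M\<^esub> x) = N +>\<^bsub>M\<^esub> (r \<odot>\<^bsub>M\<^esub> x)"
proof -
  interpret N: abelian_subgroup N M by (rule submodule_abelian_subgroup[OF module_axioms assms(1)])
  have "N +>\<^bsub>M\<^esub> (r \<odot>\<^bsub>M\<^esub> y) = N +>\<^bsub>M\<^esub> (r \<odot>\<^bsub>M\<^esub> x)" if y: "y \<in> N +>\<^bsub>M\<^esub> x" for y
  proof -
    have yM: "y \<in> carrier M" using N.a_elemrcos_carrier[OF assms(3) y] .
    have "N +>\<^bsub>M\<^esub> y = N +>\<^bsub>M\<^esub> x" using N.a_repr_independence'[OF y assms(3)] by simp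
    then have "y \<ominus>\<^bsub>M\<^esub> x \<in> N" using coset_eq_iff[OF assms(1) yM assms(3)] by simp
    then have "r \<odot>\<^bsub>M\<^esub> (y \<ominus>\<^bsub>M\<^esub> x) \<in> N" using submoduleE(4)[OF assms(1)] assms by simp
    moreover have "r \<odot>\<^bsub>M\<^esub> (y \<ominus>\<^bsub>M\<^esub> x) = r \<odot>\<^bsub>M\<^esub> y \<ominus>\<^bsub>M\<^esub> r \<odot>\<^bsub>M\<^esub> x"
      using assms yM by (simp add: M.minus_eq smult_r_distr smult_r_minus)
    ultimately show ?thesis using coset_eq_iff[OF assms(1)] assms yM by simp
  qed
  moreover have "N +>\<^bsub>M\<^esub> x \<noteq> {}" using N.a_rcos_self[OF assms(3)] by blast
  ultimately have "(\<Union>y\<in>N +>\<^bsub>M\<^esub> x. N +>\<^bsub>M\<^esub> (r \<odot>\<^bsub>M\<^esub> y)) = N +>\<^bsub>M\<^esub> (r \<odot>\<^bsub>M\<^esub> x)"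
    by (intro SUP_eq_const)
  then show ?thesis by (simp add: quot_module_def)
qed

lemma quot_module_zero:
  assumes "submodule N R M"
  shows "\<zero>\<^bsub>quot_module M N\<^esub> = N +>\<^bsub>M\<^esub> \<zero>\<^bsub>M\<^esub>"
  using submoduleE(1)[OF assms] by (simp add: quot_module_def)

lemma quot_module_module:
  assumes N: "submodule N R M"
  shows "module R (quot_module M N)"
proof (rule moduleI[OF R.is_cring])
  let ?Q = "quot_module M N"
  note simps = quot_module_add[OF N] quot_module_smult[OF N] quot_module_zero[OF N]
  show "abelian_group ?Q"
  proof (rule abelian_groupI)
    show "\<zero>\<^bsub>?Q\<^esub> \<in> carrier ?Q" by (simp add: simps quot_module_carrier)
    fix U assume "U \<in> carrier ?Q"
    then obtain x where x: "x \<in> carrier M" "U = N +>\<^bsub>M\<^esub> x" by (auto simp: quot_module_carrier)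
    show "\<zero>\<^bsub>?Q\<^esub> \<oplus>\<^bsub>?Q\<^esub> U = U" using x by (simp add: simps)
    show "\<exists>V\<in>carrier ?Q. V \<oplus>\<^bsub>?Q\<^esub> U = \<zero>\<^bsub>?Q\<^esub>"
      using x by (intro bexI[of _ "N +>\<^bsub>M\<^esub> (\<ominus>\<^bsub>M\<^esub> x)"]) (auto simp: simps quot_module_carrier M.l_neg)
    fix V assume "V \<in> carrier ?Q"
    then obtain y where y: "y \<in> carrier M" "V = N +>\<^bsub>M\<^esub> y" by (auto simp: quot_module_carrier)
    show "U \<oplus>\<^bsub>?Q\<^esub> V \<in> carrier ?Q" using x y by (simp add: simps quot_module_carrier)
    show "U \<oplus>\<^bsub>?Q\<^esub> V = V \<oplus>\<^bsub>?Q\<^esub> U" using x y by (simp add: simps M.a_comm)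
    fix W assume "W \<in> carrier ?Q"
    then obtain z where z: "z \<in> carrier M" "W = N +>\<^bsub>M\<^esub> z" by (auto simp: quot_module_carrier)
    show "U \<oplus>\<^bsub>?Q\<^esub> V \<oplus>\<^bsub>?Q\<^esub> W = U \<oplus>\<^bsub>?Q\<^esub> (V \<oplus>\<^bsub>?Q\<^esub> W)" using x y z by (simp add: simps M.a_assoc)
  qed
qed (auto simp: quot_module_carrier quot_module_add[OF N] quot_module_smult[OF N]
    smult_l_distr smult_r_distr smult_assoc1)

lemma quot_module_lift:
  assumes N: "submodule N R M" and T: "module R T" and h: "linear_map R M T h"
    and ker: "\<And>x. x \<in> N \<Longrightarrow> h x = \<zero>\<^bsub>T\<^esub>"
  shows "\<exists>h'. linear_map R (quot_module M N) T h' \<and> (\<forall>x\<in>carrier M. h' (N +>\<^bsub>M\<^esub> x) = h x)"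
proof -
  interpret T: module R T by fact
  define h' where "h' = (\<lambda>U. h (SOME x. x \<in> carrier M \<and> U = N +>\<^bsub>M\<^esub> x))"
  have h': "h' (N +>\<^bsub>M\<^esub> x) = h x" if x: "x \<in> carrier M" for x
  proof -
    define y where "y = (SOME y. y \<in> carrier M \<and> N +>\<^bsub>M\<^esub> x = N +>\<^bsub>M\<^esub> y)"
    have y: "y \<in> carrier M \<and> N +>\<^bsub>M\<^esub> x = N +>\<^bsub>M\<^esub> y" unfolding y_def by (rule someI) (use x in simp)
    then have "x \<ominus>\<^bsub>M\<^esub> y \<in> N" using coset_eq_iff[OF N x, of y] by blast
    then have "h x \<ominus>\<^bsub>T\<^esub> h y = \<zero>\<^bsub>T\<^esub>" using ker linear_map_minus[OF module_axioms T h x] y by metis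
    then have "h x = h y" using linear_mapD(1)[OF h x] linear_mapD(1)[OF h, of y] y
      by (simp add: T.M.minus_eq_zero_iff)
    then have "h y = h x" ..
    then show ?thesis by (simp only: h'_def y_def)
  qed
  have "linear_map R (quot_module M N) T h'"
    by (rule linear_mapI)
      (auto simp: quot_module_carrier quot_module_add[OF N] quot_module_smult[OF N] h' linear_mapD[OF h])
  then show ?thesis using h' by blast
qed

lemma gen_submodule_submodule:
  assumes "S \<subseteq> carrier M"
  shows "submodule (gen_submodule R M S) R M" "S \<subseteq> gen_submodule R M S"
proof -
  have sub: "gen_submodule R M S \<subseteq> carrier M"
    using carrier_is_submodule assms by (auto simp: gen_submodule_def)
  show "S \<subseteq> gen_submodule R M S" unfolding gen_submodule_def by blast
  show "submodule (gen_submodule R M S) R M"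
  proof (rule submoduleI[OF sub])
    show "\<zero>\<^bsub>M\<^esub> \<in> gen_submodule R M S"
    proof -
      have "\<zero>\<^bsub>M\<^esub> \<in> L" if "submodule L R M" for L
        using subgroup.one_closed[OF submodule.axioms(1)[OF that]] by simp
      then show ?thesis by (simp add: gen_submodule_def)
    qed
    fix a b assume ab: "a \<in> gen_submodule R M S" "b \<in> gen_submodule R M S"
    show "\<ominus>\<^bsub>M\<^esub> a \<in> gen_submodule R M S"
      using ab submoduleE(3) by (simp add: gen_submodule_def)
    show "a \<oplus>\<^bsub>M\<^esub> b \<in> gen_submodule R M S"
      using ab submoduleE(5) by (simp add: gen_submodule_def)
  next
    fix a b assume ab: "a \<in> carrier R" "b \<in> gen_submodule R M S"
    show "a \<odot>\<^bsub>M\<^esub> b \<in> gen_submodule R M S"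
      using ab submoduleE(4) by (simp add: gen_submodule_def)
  qed
qed

lemma gen_submodule_least:
  "submodule N R M \<Longrightarrow> S \<subseteq> N \<Longrightarrow> gen_submodule R M S \<subseteq> N"
  unfolding gen_submodule_def by blast

end

text \<open>The free module on \<open>W\<close>. It is the common form of the module of symbols for
  differentials, of the free algebra on words and of its even and odd parts, so that linear
  extension and induction over supports are needed only once.\<close>

definition fs_module :: "('r, 'c) ring_scheme \<Rightarrow> 'x set \<Rightarrow> ('r, 'x \<Rightarrow> 'r) module"
  where "fs_module R W =
    \<lparr>carrier = {p. finite {f. p f \<noteq> \<zero>\<^bsub>R\<^esub>} \<and> (\<forall>f. p f \<in> carrier R) \<and>
                   (\<forall>f. f \<notin> W \<longrightarrow> p f = \<zero>\<^bsub>R\<^esub>)},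
     monoid.mult = undefined, monoid.one = undefined,
     ring.zero = (\<lambda>f. \<zero>\<^bsub>R\<^esub>), ring.add = (\<lambda>p q f. p f \<oplus>\<^bsub>R\<^esub> q f),
     smult = (\<lambda>r p f. r \<otimes>\<^bsub>R\<^esub> p f)\<rparr>"

lemma kaehler_free_eq: "kaehler_free R = fs_module R (carrier R)"
  by (simp add: kaehler_free_def fs_module_def)

definition lin_ext :: "('r, 'c) ring_scheme \<Rightarrow> ('r, 'm, 'd) module_scheme \<Rightarrow> ('x \<Rightarrow> 'm) \<Rightarrow> ('x \<Rightarrow> 'r) \<Rightarrow> 'm"
  where "lin_ext R T g p = (\<Oplus>\<^bsub>T\<^esub>f\<in>{f. p f \<noteq> \<zero>\<^bsub>R\<^esub>}. p f \<odot>\<^bsub>T\<^esub> g f)"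

context cring
begin

lemma fs_module_module: "module R (fs_module R W)"
proof (rule moduleI[OF is_cring])
  have fin: "finite {f. p f \<oplus> q f \<noteq> \<zero>}" if "finite {f. p f \<noteq> \<zero>}" "finite {f. q f \<noteq> \<zero>}" for p q :: "_ \<Rightarrow> 'a"
    by (rule finite_subset[OF _ finite_UnI[OF that]]) auto
  have fin2: "finite {f. r \<otimes> p f \<noteq> \<zero>}" if "finite {f. p f \<noteq> \<zero>}" "r \<in> carrier R" for p :: "_ \<Rightarrow> 'a" and r
    by (rule finite_subset[OF _ that(1)]) (use that(2) in auto)
  show "abelian_group (fs_module R W)"
  proof (rule abelian_groupI)
    fix p assume p: "p \<in> carrier (fs_module R W)"
    then have "(\<lambda>f. \<ominus> p f) \<in> carrier (fs_module R W)"
      by (auto simp: fs_module_def elim!: finite_subset[rotated])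
    then show "\<exists>y\<in>carrier (fs_module R W). y \<oplus>\<^bsub>fs_module R W\<^esub> p = \<zero>\<^bsub>fs_module R W\<^esub>"
      by (rule bexI[rotated]) (use p in \<open>auto simp: fs_module_def l_neg\<close>)
  qed (auto simp: fs_module_def fin intro!: ext a_assoc a_comm)
  show "r \<odot>\<^bsub>fs_module R W\<^esub> p \<in> carrier (fs_module R W)" if "r \<in> carrier R" "p \<in> carrier (fs_module R W)" for r p
    using that fin2 by (auto simp: fs_module_def)
qed (auto simp: fs_module_def l_distr r_distr m_assoc)

lemma single_closed:
  "x \<in> W \<Longrightarrow> r \<in> carrier R \<Longrightarrow> single R x r \<in> carrier (fs_module R W)"
  by (auto simp: fs_module_def single_def)

lemma single_smult:
  "r \<in> carrier R \<Longrightarrow> s \<in> carrier R \<Longrightarrow> r \<odot>\<^bsub>fs_module R W\<^esub> single R x s = single R x (r \<otimes> s)"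
  by (auto simp: fs_module_def single_def)

text \<open>The induction runs over finite sets that contain the support: setting one value to zero
  leaves a function supported in a smaller set.\<close>

lemma fs_module_induct [consumes 1, case_names zero step]:
  assumes p: "p \<in> carrier (fs_module R W)"
    and zero: "P (\<lambda>_. \<zero>)"
    and step: "\<And>x r p. x \<in> W \<Longrightarrow> r \<in> carrier R \<Longrightarrow> p \<in> carrier (fs_module R W) \<Longrightarrow> P p \<Longrightarrow>
      P (single R x r \<oplus>\<^bsub>fs_module R W\<^esub> p)"
  shows "P p"
proof -
  have "\<forall>p\<in>carrier (fs_module R W). {f. p f \<noteq> \<zero>} \<subseteq> S \<longrightarrow> P p" if "finite S" for S
    using that
  proof induction
    case empty
    have "p = (\<lambda>_. \<zero>)" if "{f. p f \<noteq> \<zero>} \<subseteq> {}" for p :: "_ \<Rightarrow> 'a" using that by auto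
    then show ?case using zero by auto
  next
    case (insert x S)
    show ?case
    proof (intro ballI impI)
      fix p assume p: "p \<in> carrier (fs_module R W)" "{f. p f \<noteq> \<zero>} \<subseteq> insert x S"
      show "P p"
      proof (cases "x \<in> W")
        case True
        define q where "q = p(x := \<zero>)"
        have q: "q \<in> carrier (fs_module R W)"
          using p by (auto simp: fs_module_def q_def elim!: finite_subset[rotated])
        have "{f. q f \<noteq> \<zero>} \<subseteq> S" using p(2) by (auto simp: q_def)
        then have "P q" using insert.IH q by blast
        moreover have "p = single R x (p x) \<oplus>\<^bsub>fs_module R W\<^esub> q"
          using p by (auto simp: fs_module_def single_def q_def)
        moreover have "p x \<in> carrier R" using p by (auto simp: fs_module_def)
        ultimately show ?thesis using step[OF True _ q] by metis
      next
        case False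
        then have "p x = \<zero>" using p(1) by (auto simp: fs_module_def)
        then have "{f. p f \<noteq> \<zero>} \<subseteq> S" using p(2) by auto
        then show ?thesis using insert.IH p(1) by blast
      qed
    qed
  qed
  moreover have "finite {f. p f \<noteq> \<zero>}" using p by (simp add: fs_module_def)
  ultimately show ?thesis using p by blast
qed

text \<open>Additivity involves three functions with different supports; with all sums extended to
  one finite set, where the additional terms vanish, they can be compared term by term.\<close>

lemma lin_ext_superset:
  assumes T: "module R T" and g: "g \<in> W \<rightarrow> carrier T" and p: "p \<in> carrier (fs_module R W)"
    and S: "finite S" "{f. p f \<noteq> \<zero>} \<subseteq> S" "S \<subseteq> W"
  shows "lin_ext R T g p = (\<Oplus>\<^bsub>T\<^esub>f\<in>S. p f \<odot>\<^bsub>T\<^esub> g f)"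
proof -
  interpret T: module R T by fact
  show ?thesis unfolding lin_ext_def
  proof (rule T.M.add.finprod_mono_neutral_cong_left[OF S(1,2)])
    show "p f \<odot>\<^bsub>T\<^esub> g f = \<zero>\<^bsub>T\<^esub>" if "f \<in> S - {f. p f \<noteq> \<zero>}" for f
      using that g S by (auto simp: Pi_iff subset_iff)
    show "(\<lambda>f. p f \<odot>\<^bsub>T\<^esub> g f) \<in> S \<rightarrow> carrier T"
      using p g S(3) by (auto simp: fs_module_def Pi_iff subset_iff)
  qed auto
qed

lemma lin_ext_linear:
  assumes T: "module R T" and g: "g \<in> W \<rightarrow> carrier T"
  shows "linear_map R (fs_module R W) T (lin_ext R T g)"
proof -
  interpret T: module R T by fact
  interpret F: module R "fs_module R W" by (rule fs_module_module)
  have supp: "finite {f. p f \<noteq> \<zero>} \<and> {f. p f \<noteq> \<zero>} \<subseteq> W" if "p \<in> carrier (fs_module R W)" for p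
    using that by (auto simp: fs_module_def)
  have val: "p f \<in> carrier R" if "p \<in> carrier (fs_module R W)" for p f
    using that by (auto simp: fs_module_def)
  show ?thesis
  proof (rule linear_mapI)
    fix p assume p: "p \<in> carrier (fs_module R W)"
    show "lin_ext R T g p \<in> carrier T"
      unfolding lin_ext_def using supp[OF p] val[OF p] g by (intro T.M.finsum_closed) (auto simp: Pi_iff)
    fix q assume q: "q \<in> carrier (fs_module R W)"
    let ?S = "{f. p f \<noteq> \<zero>} \<union> {f. q f \<noteq> \<zero>}"
    have S: "finite ?S" "?S \<subseteq> W" using supp p q by auto
    have gS: "g f \<in> carrier T" if "f \<in> ?S" for f using that S g by (auto simp: Pi_iff)
    have "{f. (p \<oplus>\<^bsub>fs_module R W\<^esub> q) f \<noteq> \<zero>} \<subseteq> ?S" by (auto simp: fs_module_def)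
    then have "lin_ext R T g (p \<oplus>\<^bsub>fs_module R W\<^esub> q) = (\<Oplus>\<^bsub>T\<^esub>f\<in>?S. (p f \<oplus> q f) \<odot>\<^bsub>T\<^esub> g f)"
      using lin_ext_superset[OF T g F.M.a_closed[OF p q] S(1) _ S(2)] by (simp add: fs_module_def)
    also have "\<dots> = (\<Oplus>\<^bsub>T\<^esub>f\<in>?S. p f \<odot>\<^bsub>T\<^esub> g f \<oplus>\<^bsub>T\<^esub> q f \<odot>\<^bsub>T\<^esub> g f)"
      using gS val p q by (intro T.M.finsum_cong') (auto simp: T.smult_l_distr)
    also have "\<dots> = (\<Oplus>\<^bsub>T\<^esub>f\<in>?S. p f \<odot>\<^bsub>T\<^esub> g f) \<oplus>\<^bsub>T\<^esub> (\<Oplus>\<^bsub>T\<^esub>f\<in>?S. q f \<odot>\<^bsub>T\<^esub> g f)"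
      using gS val p q by (intro T.M.finsum_addf) auto
    also have "\<dots> = lin_ext R T g p \<oplus>\<^bsub>T\<^esub> lin_ext R T g q"
      using lin_ext_superset[OF T g p S(1) _ S(2)] lin_ext_superset[OF T g q S(1) _ S(2)] by auto
    finally show "lin_ext R T g (p \<oplus>\<^bsub>fs_module R W\<^esub> q) = lin_ext R T g p \<oplus>\<^bsub>T\<^esub> lin_ext R T g q" .
  next
    fix r p assume r: "r \<in> carrier R" and p: "p \<in> carrier (fs_module R W)"
    let ?S = "{f. p f \<noteq> \<zero>}"
    have S: "finite ?S" "?S \<subseteq> W" using supp p by auto
    have gS: "g f \<in> carrier T" if "f \<in> ?S" for f using that S(2) g by (auto simp: Pi_iff subset_iff)
    have "{f. (r \<odot>\<^bsub>fs_module R W\<^esub> p) f \<noteq> \<zero>} \<subseteq> ?S" using r by (auto simp: fs_module_def)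
    then have "lin_ext R T g (r \<odot>\<^bsub>fs_module R W\<^esub> p) = (\<Oplus>\<^bsub>T\<^esub>f\<in>?S. (r \<otimes> p f) \<odot>\<^bsub>T\<^esub> g f)"
      using lin_ext_superset[OF T g F.smult_closed[OF r p] S(1) _ S(2)] by (simp add: fs_module_def)
    also have "\<dots> = (\<Oplus>\<^bsub>T\<^esub>f\<in>?S. r \<odot>\<^bsub>T\<^esub> (p f \<odot>\<^bsub>T\<^esub> g f))"
      using gS val p r by (intro T.M.finsum_cong') (auto simp: T.smult_assoc1)
    also have "\<dots> = r \<odot>\<^bsub>T\<^esub> lin_ext R T g p"
      unfolding lin_ext_def using gS val[OF p] r S by (intro T.finsum_smult_ldistr[symmetric]) auto
    finally show "lin_ext R T g (r \<odot>\<^bsub>fs_module R W\<^esub> p) = r \<odot>\<^bsub>T\<^esub> lin_ext R T g p" .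
  qed
qed

lemma lin_ext_single:
  assumes T: "module R T" and g: "g \<in> W \<rightarrow> carrier T" and x: "x \<in> W" "r \<in> carrier R"
  shows "lin_ext R T g (single R x r) = r \<odot>\<^bsub>T\<^esub> g x"
proof -
  interpret T: module R T by fact
  have gx: "g x \<in> carrier T" using g x by auto
  have "lin_ext R T g (single R x r) = (\<Oplus>\<^bsub>T\<^esub>f\<in>{x}. single R x r f \<odot>\<^bsub>T\<^esub> g f)"
    by (rule lin_ext_superset[OF T g single_closed[OF x]]) (use x in \<open>auto simp: single_def\<close>)
  also have "\<dots> = r \<odot>\<^bsub>T\<^esub> g x" using gx x T.M.finsum_singleton[of x "{x}" "\<lambda>f. r \<odot>\<^bsub>T\<^esub> g f"]
    by (simp add: single_def T.M.finsum_insert)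
  finally show ?thesis .
qed

end

section \<open>Differentials\<close>

text \<open>The target is a module over \<open>R\<close> only, so linearity over \<open>K\<close> is
  expressed through the multiples of the unit of \<open>R\<close>.\<close>

definition derivation ::
    "('k, 'b) ring_scheme \<Rightarrow> ('k, 'r, 'c) module_scheme \<Rightarrow> ('r, 'm, 'd) module_scheme \<Rightarrow> ('r \<Rightarrow> 'm) \<Rightarrow> bool"
  where "derivation K R T D \<longleftrightarrow> D \<in> carrier R \<rightarrow> carrier T \<and>
    (\<forall>f\<in>carrier R. \<forall>g\<in>carrier R. D (f \<oplus>\<^bsub>R\<^esub> g) = D f \<oplus>\<^bsub>T\<^esub> D g) \<and>
    (\<forall>f\<in>carrier R. \<forall>g\<in>carrier R. D (f \<otimes>\<^bsub>R\<^esub> g) = f \<odot>\<^bsub>T\<^esub> D g \<oplus>\<^bsub>T\<^esub> g \<odot>\<^bsub>T\<^esub> D f) \<and>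
    (\<forall>c\<in>carrier K. \<forall>f\<in>carrier R. D (c \<odot>\<^bsub>R\<^esub> f) = (c \<odot>\<^bsub>R\<^esub> \<one>\<^bsub>R\<^esub>) \<odot>\<^bsub>T\<^esub> D f)"

lemma derivationD:
  assumes "derivation K R T D"
  shows "f \<in> carrier R \<Longrightarrow> D f \<in> carrier T"
    and "f \<in> carrier R \<Longrightarrow> g \<in> carrier R \<Longrightarrow> D (f \<oplus>\<^bsub>R\<^esub> g) = D f \<oplus>\<^bsub>T\<^esub> D g"
    and "f \<in> carrier R \<Longrightarrow> g \<in> carrier R \<Longrightarrow> D (f \<otimes>\<^bsub>R\<^esub> g) = f \<odot>\<^bsub>T\<^esub> D g \<oplus>\<^bsub>T\<^esub> g \<odot>\<^bsub>T\<^esub> D f"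
    and "c \<in> carrier K \<Longrightarrow> f \<in> carrier R \<Longrightarrow> D (c \<odot>\<^bsub>R\<^esub> f) = (c \<odot>\<^bsub>R\<^esub> \<one>\<^bsub>R\<^esub>) \<odot>\<^bsub>T\<^esub> D f"
  using assms unfolding derivation_def by auto

lemma derivation_zero:
  assumes "cring R" "module R T" "derivation K R T D"
  shows "D \<zero>\<^bsub>R\<^esub> = \<zero>\<^bsub>T\<^esub>"
proof -
  interpret T: module R T by fact
  have "D \<zero>\<^bsub>R\<^esub> = D \<zero>\<^bsub>R\<^esub> \<oplus>\<^bsub>T\<^esub> D \<zero>\<^bsub>R\<^esub>"
    using derivationD(2)[OF assms(3) T.R.zero_closed T.R.zero_closed] by simp
  then show ?thesis using derivationD(1)[OF assms(3) T.R.zero_closed] by (metis T.M.add.l_cancel_one)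
qed

lemma derivation_scalar:
  assumes "algebra K R" "module R T" "derivation K R T D" "c \<in> carrier K"
  shows "D (c \<odot>\<^bsub>R\<^esub> \<one>\<^bsub>R\<^esub>) = \<zero>\<^bsub>T\<^esub>"
proof -
  interpret R: cring R by (rule algebra.M_cring[OF assms(1)])
  interpret KR: algebra K R by fact
  interpret T: module R T by fact
  have "D \<one>\<^bsub>R\<^esub> = D \<one>\<^bsub>R\<^esub> \<oplus>\<^bsub>T\<^esub> D \<one>\<^bsub>R\<^esub>"
    using derivationD(3)[OF assms(3) R.one_closed R.one_closed] derivationD(1)[OF assms(3) R.one_closed] by simp
  then have "D \<one>\<^bsub>R\<^esub> = \<zero>\<^bsub>T\<^esub>" using derivationD(1)[OF assms(3) R.one_closed] by (metis T.M.add.l_cancel_one)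
  then show ?thesis using derivationD(4)[OF assms(3,4) R.one_closed] assms(4) by simp
qed

lemma kaehler_relations_closed:
  assumes "algebra K R"
  shows "kaehler_relations K R \<subseteq> carrier (kaehler_free R)"
proof -
  interpret R: cring R by (rule algebra.M_cring[OF assms])
  interpret KR: algebra K R by fact
  interpret F: module R "kaehler_free R" unfolding kaehler_free_eq by (rule R.fs_module_module)
  have s: "single R f \<one>\<^bsub>R\<^esub> \<in> carrier (kaehler_free R)" if "f \<in> carrier R" for f
    unfolding kaehler_free_eq by (rule R.single_closed) (use that in auto)
  show ?thesis by (auto simp: kaehler_relations_def Let_def s)
qed

lemma kaehler_submodule_submodule:
  assumes "algebra K R"
  shows "submodule (kaehler_submodule K R) R (kaehler_free R)"
    and "kaehler_relations K R \<subseteq> kaehler_submodule K R"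
proof -
  interpret R: cring R by (rule algebra.M_cring[OF assms])
  interpret KR: algebra K R by fact
  interpret F: module R "kaehler_free R" unfolding kaehler_free_eq by (rule R.fs_module_module)
  show "submodule (kaehler_submodule K R) R (kaehler_free R)" "kaehler_relations K R \<subseteq> kaehler_submodule K R"
    unfolding kaehler_submodule_def
    by (rule F.gen_submodule_submodule[OF kaehler_relations_closed[OF assms]])+
qed

lemma kaehler_module:
  assumes "algebra K R"
  shows "module R (kaehler K R)"
proof -
  interpret R: cring R by (rule algebra.M_cring[OF assms])
  interpret KR: algebra K R by fact
  interpret F: module R "kaehler_free R" unfolding kaehler_free_eq by (rule R.fs_module_module)
  show ?thesis unfolding kaehler_def by (rule F.quot_module_module[OF kaehler_submodule_submodule(1)[OF assms]])
qed

lemma kaehler_d_derivation: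
  assumes "algebra K R"
  shows "derivation K R (kaehler K R) (kaehler_d K R)"
proof -
  interpret R: cring R by (rule algebra.M_cring[OF assms])
  interpret KR: algebra K R by fact
  interpret F: module R "kaehler_free R" unfolding kaehler_free_eq by (rule R.fs_module_module)
  note N = kaehler_submodule_submodule[OF assms]
  let ?N = "kaehler_submodule K R" and ?F = "kaehler_free R" and ?d = "\<lambda>f. single R f \<one>\<^bsub>R\<^esub>"
  have s: "?d f \<in> carrier ?F" if "f \<in> carrier R" for f
    unfolding kaehler_free_eq by (rule R.single_closed) (use that in auto)
  note simps = F.quot_module_add[OF N(1)] F.quot_module_smult[OF N(1)]
  have eq: "?N +>\<^bsub>?F\<^esub> x = ?N +>\<^bsub>?F\<^esub> y" if "x \<ominus>\<^bsub>?F\<^esub> y \<in> kaehler_relations K R" "x \<in> carrier ?F" "y \<in> carrier ?F" for x y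
    using F.coset_eq_iff[OF N(1) that(2,3)] that(1) N(2) by blast
  show ?thesis
    unfolding derivation_def kaehler_def kaehler_d_def
  proof (intro conjI ballI funcsetI)
    fix f assume f: "f \<in> carrier R"
    show "?N +>\<^bsub>?F\<^esub> ?d f \<in> carrier (quot_module ?F ?N)"
      using s f by (simp add: F.quot_module_carrier)
    fix g assume g: "g \<in> carrier R"
    show "?N +>\<^bsub>?F\<^esub> ?d (f \<oplus>\<^bsub>R\<^esub> g) = (?N +>\<^bsub>?F\<^esub> ?d f) \<oplus>\<^bsub>quot_module ?F ?N\<^esub> (?N +>\<^bsub>?F\<^esub> ?d g)"
      unfolding simps(1)[OF s[OF f] s[OF g]]
      by (rule eq) (use f g s in \<open>auto simp: kaehler_relations_def Let_def\<close>)
    show "?N +>\<^bsub>?F\<^esub> ?d (f \<otimes>\<^bsub>R\<^esub> g) =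
      f \<odot>\<^bsub>quot_module ?F ?N\<^esub> (?N +>\<^bsub>?F\<^esub> ?d g) \<oplus>\<^bsub>quot_module ?F ?N\<^esub> g \<odot>\<^bsub>quot_module ?F ?N\<^esub> (?N +>\<^bsub>?F\<^esub> ?d f)"
      unfolding simps(2)[OF f s[OF g]] simps(2)[OF g s[OF f]]
        simps(1)[OF F.smult_closed[OF f s[OF g]] F.smult_closed[OF g s[OF f]]]
      by (rule eq) (use f g s in \<open>auto simp: kaehler_relations_def Let_def\<close>)
  next
    fix c f assume c: "c \<in> carrier K" and f: "f \<in> carrier R"
    have cR: "c \<odot>\<^bsub>R\<^esub> \<one>\<^bsub>R\<^esub> \<in> carrier R" using c by simp
    show "?N +>\<^bsub>?F\<^esub> ?d (c \<odot>\<^bsub>R\<^esub> f) = (c \<odot>\<^bsub>R\<^esub> \<one>\<^bsub>R\<^esub>) \<odot>\<^bsub>quot_module ?F ?N\<^esub> (?N +>\<^bsub>?F\<^esub> ?d f)"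
      unfolding simps(2)[OF cR s[OF f]]
      by (rule eq) (use c f s in \<open>auto simp: kaehler_relations_def Let_def\<close>)
  qed
qed

text \<open>The linear extension of \<open>D\<close> to the free module on symbols annihilates the
  defining relations, one family for each clause of \<open>derivation\<close> after the
  first.\<close>

lemma kaehler_universal:
  assumes R: "algebra K R" and T: "module R T" and D: "derivation K R T D"
  shows "\<exists>h. linear_map R (kaehler K R) T h \<and> (\<forall>f\<in>carrier R. h (kaehler_d K R f) = D f)"
proof -
  interpret R: cring R by (rule algebra.M_cring[OF R])
  interpret KR: algebra K R by fact
  interpret F: module R "kaehler_free R" unfolding kaehler_free_eq by (rule R.fs_module_module)
  interpret T: module R T by fact
  note N = kaehler_submodule_submodule[OF R]
  let ?F = "kaehler_free R" and ?d = "\<lambda>f. single R f \<one>\<^bsub>R\<^esub>"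
  have s: "?d f \<in> carrier ?F" if "f \<in> carrier R" for f
    unfolding kaehler_free_eq by (rule R.single_closed) (use that in auto)
  have Dc: "D \<in> carrier R \<rightarrow> carrier T" using D by (simp add: derivation_def)
  define h where "h = lin_ext R T D"
  have h: "linear_map R ?F T h"
    unfolding kaehler_free_eq h_def by (rule R.lin_ext_linear[OF T Dc])
  have hd: "h (?d f) = D f" if "f \<in> carrier R" for f
    unfolding h_def using R.lin_ext_single[OF T Dc that R.one_closed] T.smult_one[OF derivationD(1)[OF D that]] by simp
  let ?Z = "{x \<in> carrier ?F. h x = \<zero>\<^bsub>T\<^esub>}"
  have Z: "x \<ominus>\<^bsub>?F\<^esub> y \<in> ?Z" if "x \<in> carrier ?F" "y \<in> carrier ?F" "h x = h y" for x y
    using that linear_map_minus[OF F.module_axioms T h] linear_mapD(1)[OF h]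
    by (auto simp: T.M.minus_eq_zero_iff)
  have "kaehler_relations K R \<subseteq> ?Z"
    unfolding kaehler_relations_def Let_def
  proof (intro Un_least subsetI; elim CollectE exE conjE; hypsubst)
    fix f g assume f: "f \<in> carrier R" "g \<in> carrier R"
    show "?d (f \<oplus>\<^bsub>R\<^esub> g) \<ominus>\<^bsub>?F\<^esub> (?d f \<oplus>\<^bsub>?F\<^esub> ?d g) \<in> ?Z"
      by (rule Z) (use f s hd derivationD[OF D] linear_mapD[OF h] in auto)
    show "?d (f \<otimes>\<^bsub>R\<^esub> g) \<ominus>\<^bsub>?F\<^esub> (f \<odot>\<^bsub>?F\<^esub> ?d g \<oplus>\<^bsub>?F\<^esub> g \<odot>\<^bsub>?F\<^esub> ?d f) \<in> ?Z"
      by (rule Z) (use f s hd derivationD[OF D] linear_mapD[OF h] in auto)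
  next
    fix c f assume c: "c \<in> carrier K" and f: "f \<in> carrier R"
    show "?d (c \<odot>\<^bsub>R\<^esub> f) \<ominus>\<^bsub>?F\<^esub> ((c \<odot>\<^bsub>R\<^esub> \<one>\<^bsub>R\<^esub>) \<odot>\<^bsub>?F\<^esub> ?d f) \<in> ?Z"
      by (rule Z) (use c f s hd derivationD[OF D] linear_mapD[OF h] in auto)
  qed
  then have "kaehler_submodule K R \<subseteq> ?Z"
    unfolding kaehler_submodule_def
    by (intro F.gen_submodule_least linear_map_kernel_submodule[OF F.module_axioms T h])
  then obtain h' where "linear_map R (kaehler K R) T h'"
    "\<forall>x\<in>carrier ?F. h' (kaehler_submodule K R +>\<^bsub>?F\<^esub> x) = h x"
    unfolding kaehler_def using F.quot_module_lift[OF N(1) T h] by auto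
  then show ?thesis using hd s by (auto simp: kaehler_d_def)
qed

text \<open>This serves as an induction principle: a property of forms that defines a submodule need
  only be checked on exact differentials.\<close>

lemma kaehler_generated:
  assumes R: "algebra K R" and B: "submodule B R (kaehler K R)"
    and d: "\<And>f. f \<in> carrier R \<Longrightarrow> kaehler_d K R f \<in> B"
  shows "B = carrier (kaehler K R)"
proof -
  interpret R: cring R by (rule algebra.M_cring[OF R])
  interpret KR: algebra K R by fact
  interpret F: module R "kaehler_free R" unfolding kaehler_free_eq by (rule R.fs_module_module)
  interpret O: module R "kaehler K R" by (rule kaehler_module[OF R])
  note N = kaehler_submodule_submodule[OF R]
  let ?N = "kaehler_submodule K R" and ?F = "kaehler_free R"
  note simps = F.quot_module_add[OF N(1), folded kaehler_def] F.quot_module_smult[OF N(1), folded kaehler_def]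
    F.quot_module_zero[OF N(1), folded kaehler_def]
  have "?N +>\<^bsub>?F\<^esub> p \<in> B" if p: "p \<in> carrier (fs_module R (carrier R))" for p
    using p
  proof (induction rule: R.fs_module_induct)
    case zero
    have "\<zero>\<^bsub>kaehler K R\<^esub> \<in> B" using subgroup.one_closed[OF submodule.axioms(1)[OF B]] by simp
    then show ?case using simps(3) by (simp add: kaehler_free_def)
  next
    case (step f r p)
    have s: "single R f \<one>\<^bsub>R\<^esub> \<in> carrier ?F" "single R f r \<in> carrier ?F" "p \<in> carrier ?F"
      unfolding kaehler_free_eq
      using step(1-3) R.single_closed[OF step(1) R.one_closed] R.single_closed[OF step(1,2)] by auto
    have "single R f r = r \<odot>\<^bsub>?F\<^esub> single R f \<one>\<^bsub>R\<^esub>"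
      unfolding kaehler_free_eq using R.single_smult[OF step(2) R.one_closed, of "carrier R" f] step(2) by simp
    then have "?N +>\<^bsub>?F\<^esub> (single R f r \<oplus>\<^bsub>?F\<^esub> p) = r \<odot>\<^bsub>kaehler K R\<^esub> kaehler_d K R f \<oplus>\<^bsub>kaehler K R\<^esub> (?N +>\<^bsub>?F\<^esub> p)"
      using simps s step(2) by (simp add: kaehler_d_def)
    then show ?case using O.submoduleE(4,5)[OF B] step d by (simp add: kaehler_free_eq)
  qed
  then have "carrier (kaehler K R) \<subseteq> B"
    unfolding kaehler_def F.quot_module_carrier by (auto simp: kaehler_free_eq)
  then show ?thesis using O.submoduleE(1)[OF B] by blast
qed

text \<open>By the Leibniz rule, the functions whose differential lies in the span of the
  differentials of \<open>S\<close> form a subalgebra; when \<open>S\<close> generates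
  \<open>R\<close> as an algebra, it is everything.\<close>

lemma kaehler_fin_gen:
  assumes R: "algebra K R" and "fin_gen_algebra K R"
  shows "\<exists>S. finite S \<and> S \<subseteq> carrier R \<and>
    ispan R (kaehler K R) (carrier R) (kaehler_d K R ` S) = carrier (kaehler K R)"
proof -
  interpret R: cring R by (rule algebra.M_cring[OF assms(1)])
  interpret KR: algebra K R by fact
  interpret O: module R "kaehler K R" by (rule kaehler_module[OF R])
  note d = kaehler_d_derivation[OF R]
  obtain S where S: "finite S" "S \<subseteq> carrier R"
    and gen: "\<And>B. subring B R \<Longrightarrow> submodule B K R \<Longrightarrow> S \<subseteq> B \<Longrightarrow> B = carrier R"
    using assms(2) unfolding fin_gen_algebra_def by blast
  have dS: "kaehler_d K R ` S \<subseteq> carrier (kaehler K R)" using S derivationD(1)[OF d] by blast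
  let ?sp = "ispan R (kaehler K R) (carrier R) (kaehler_d K R ` S)"
  have sp: "submodule ?sp R (kaehler K R)" by (rule O.span_submodule[OF dS])
  define B where "B = {f \<in> carrier R. kaehler_d K R f \<in> ?sp}"
  have neg: "\<ominus>\<^bsub>R\<^esub> f = (\<ominus>\<^bsub>K\<^esub> \<one>\<^bsub>K\<^esub>) \<odot>\<^bsub>R\<^esub> f" if "f \<in> carrier R" for f
    using that KR.smult_l_minus[of "\<one>\<^bsub>K\<^esub>" f] by simp
  have smB: "c \<odot>\<^bsub>R\<^esub> f \<in> B" if "c \<in> carrier K" "f \<in> B" for c f
    using that derivationD(4)[OF d] O.submoduleE(4)[OF sp] by (simp add: B_def)
  have addB: "f \<oplus>\<^bsub>R\<^esub> g \<in> B" if "f \<in> B" "g \<in> B" for f g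
    using that derivationD(2)[OF d] O.submoduleE(5)[OF sp] by (simp add: B_def)
  have mulB: "f \<otimes>\<^bsub>R\<^esub> g \<in> B" if "f \<in> B" "g \<in> B" for f g
    using that derivationD(3)[OF d] O.submoduleE(4,5)[OF sp] by (simp add: B_def)
  have negB: "\<ominus>\<^bsub>R\<^esub> f \<in> B" if "f \<in> B" for f
    using smB[of "\<ominus>\<^bsub>K\<^esub> \<one>\<^bsub>K\<^esub>" f] that neg[of f] by (simp add: B_def)
  have one: "\<one>\<^bsub>R\<^esub> \<in> B"
    using derivation_scalar[OF R O.module_axioms d, of "\<one>\<^bsub>K\<^esub>"] ispan.zero by (fastforce simp: B_def)
  have zero: "\<zero>\<^bsub>R\<^esub> \<in> B" using addB[OF one negB[OF one]] by (simp add: R.r_neg)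
  have "subring B R" by (rule R.subringI) (use one mulB addB negB in \<open>auto simp: B_def\<close>)
  moreover have "submodule B K R"
    by (rule KR.submoduleI) (use zero smB addB negB in \<open>auto simp: B_def\<close>)
  moreover have "S \<subseteq> B" using S O.span_incl[OF dS] by (auto simp: B_def)
  ultimately have "B = carrier R" by (rule gen)
  then have "?sp = carrier (kaehler K R)" by (intro kaehler_generated[OF R sp]) (auto simp: B_def)
  then show ?thesis using S by blast
qed

section \<open>The exterior algebra\<close>

text \<open>The product of \<open>free_alg\<close>, taken on arbitrary functions rather than
  finitely supported ones. Its laws are proved by induction on the word, which replaces the left
  factor \<open>p\<close> by \<open>\<lambda>v. p (x # v)\<close>, and conditions on supports would
  only be carried along.\<close>

definition conv :: "('r, 'c) ring_scheme \<Rightarrow> ('m list \<Rightarrow> 'r) \<Rightarrow> ('m list \<Rightarrow> 'r) \<Rightarrow> 'm list \<Rightarrow> 'r"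
  where "conv R p q w = (\<Oplus>\<^bsub>R\<^esub>i\<in>{..length w}. p (take i w) \<otimes>\<^bsub>R\<^esub> q (drop i w))"

context cring
begin

lemma conv_closed:
  assumes "range p \<subseteq> carrier R" "range q \<subseteq> carrier R"
  shows "conv R p q w \<in> carrier R"
  unfolding conv_def using assms by (intro finsum_closed) (auto simp: subset_iff)

lemma conv_Nil:
  assumes "range p \<subseteq> carrier R" "range q \<subseteq> carrier R"
  shows "conv R p q [] = p [] \<otimes> q []"
  unfolding conv_def using assms by (simp add: subset_iff)

text \<open>The cut before the first letter is split off; the others are the cuts of
  \<open>w\<close>, with \<open>p\<close> shifted by \<open>x\<close>. This recursion replaces sums
  over cuts in the inductions that follow.\<close>

lemma conv_Cons:
  assumes "range p \<subseteq> carrier R" "range q \<subseteq> carrier R"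
  shows "conv R p q (x # w) = p [] \<otimes> q (x # w) \<oplus> conv R (\<lambda>v. p (x # v)) q w"
proof -
  have pq: "p v \<in> carrier R" "q v \<in> carrier R" for v using assms by auto
  have "conv R p q (x # w) = (\<Oplus>i\<in>{..length w}. p (x # take i w) \<otimes> q (drop i w)) \<oplus> p [] \<otimes> q (x # w)"
    unfolding conv_def list.size(4) add_Suc_right add_0_right using pq by (subst finsum_Suc2) auto
  then show ?thesis unfolding conv_def using pq by (simp add: a_comm)
qed

lemma conv_smult_left:
  assumes "range p \<subseteq> carrier R" "range q \<subseteq> carrier R" and a: "a \<in> carrier R"
  shows "conv R (\<lambda>v. a \<otimes> p v) q w = a \<otimes> conv R p q w"
  using assms(1)
proof (induction w arbitrary: p)
  case Nil
  then have p: "p v \<in> carrier R" for v by auto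
  have q: "q v \<in> carrier R" for v using assms(2) by auto
  have r: "range (\<lambda>v. a \<otimes> p v) \<subseteq> carrier R" using a p by auto
  show ?case using p q a conv_Nil[OF r assms(2)] conv_Nil[OF Nil assms(2)] by (simp add: m_assoc)
next
  case (Cons x w)
  then have p: "p v \<in> carrier R" for v by auto
  have q: "q v \<in> carrier R" for v using assms(2) by auto
  have r: "range (\<lambda>v. a \<otimes> p v) \<subseteq> carrier R" "range (\<lambda>v. p (x # v)) \<subseteq> carrier R" using a p by auto
  show ?case
    using p q a conv_Cons[OF r(1) assms(2), of x w] conv_Cons[OF Cons.prems assms(2), of x w] Cons.IH[OF r(2)]
      conv_closed[OF r(2) assms(2), of w]
    by (simp add: m_assoc r_distr)
qed

lemma conv_add_left:
  assumes "range p \<subseteq> carrier R" "range p' \<subseteq> carrier R" "range q \<subseteq> carrier R"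
  shows "conv R (\<lambda>v. p v \<oplus> p' v) q w = conv R p q w \<oplus> conv R p' q w"
proof -
  have pq: "p v \<in> carrier R" "p' v \<in> carrier R" "q v \<in> carrier R" for v using assms by auto
  have "conv R (\<lambda>v. p v \<oplus> p' v) q w =
    (\<Oplus>i\<in>{..length w}. p (take i w) \<otimes> q (drop i w) \<oplus> p' (take i w) \<otimes> q (drop i w))"
    unfolding conv_def using pq by (intro finsum_cong') (auto simp: l_distr)
  also have "\<dots> = conv R p q w \<oplus> conv R p' q w"
    unfolding conv_def using pq by (intro finsum_addf) auto
  finally show ?thesis .
qed

lemma conv_add_right:
  assumes "range p \<subseteq> carrier R" "range q \<subseteq> carrier R" "range q' \<subseteq> carrier R"
  shows "conv R p (\<lambda>v. q v \<oplus> q' v) w = conv R p q w \<oplus> conv R p q' w"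
proof -
  have pq: "p v \<in> carrier R" "q v \<in> carrier R" "q' v \<in> carrier R" for v using assms by auto
  have "conv R p (\<lambda>v. q v \<oplus> q' v) w =
    (\<Oplus>i\<in>{..length w}. p (take i w) \<otimes> q (drop i w) \<oplus> p (take i w) \<otimes> q' (drop i w))"
    unfolding conv_def using pq by (intro finsum_cong') (auto simp: r_distr)
  also have "\<dots> = conv R p q w \<oplus> conv R p q' w"
    unfolding conv_def using pq by (intro finsum_addf) auto
  finally show ?thesis .
qed

lemma conv_zero_left:
  assumes "range q \<subseteq> carrier R"
  shows "conv R (\<lambda>_. \<zero>) q w = \<zero>"
proof -
  have "conv R (\<lambda>_. \<zero>) q w = conv R (\<lambda>v. \<zero> \<otimes> (\<lambda>_. \<zero>) v) q w" by simp
  also have "\<dots> = \<zero>" using conv_smult_left[of "\<lambda>_. \<zero>" q \<zero> w] conv_closed[of "\<lambda>_. \<zero>" q w] assms by simp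
  finally show ?thesis .
qed

text \<open>Shifting \<open>conv R p q\<close> by a letter gives a multiple of the shifted
  \<open>q\<close> plus the convolution of the shifted \<open>p\<close> with \<open>q\<close>. The
  first term is covered by \<open>conv_smult_left\<close>, the second by the induction hypothesis,
  so no double sum over pairs of cuts appears.\<close>

lemma conv_assoc:
  assumes "range p \<subseteq> carrier R" "range q \<subseteq> carrier R" and r: "range r \<subseteq> carrier R"
  shows "conv R (conv R p q) r w = conv R p (conv R q r) w"
  using assms(1,2)
proof (induction w arbitrary: p q)
  case Nil
  then have pq: "p v \<in> carrier R" "q v \<in> carrier R" "r v \<in> carrier R" for v using r by auto
  have c: "range (conv R p q) \<subseteq> carrier R" "range (conv R q r) \<subseteq> carrier R"
    using conv_closed[OF Nil] conv_closed[OF Nil(2) r] by auto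
  show ?case
    using pq conv_Nil[OF c(1) r] conv_Nil[OF Nil(1) c(2)] conv_Nil[OF Nil] conv_Nil[OF Nil(2) r] by (simp add: m_assoc)
next
  case (Cons x w)
  have pq: "p v \<in> carrier R" "q v \<in> carrier R" "r v \<in> carrier R" for v using r Cons.prems by auto
  have c: "range (conv R p q) \<subseteq> carrier R" "range (conv R q r) \<subseteq> carrier R"
    using conv_closed[OF Cons.prems] conv_closed[OF Cons.prems(2) r] by auto
  have px: "range (\<lambda>v. p (x # v)) \<subseteq> carrier R" and qx: "range (\<lambda>v. q (x # v)) \<subseteq> carrier R" using pq by auto
  have c2: "range (conv R (\<lambda>v. p (x # v)) q) \<subseteq> carrier R" using conv_closed[OF px Cons.prems(2)] by auto
  have c3: "range (\<lambda>v. p [] \<otimes> q (x # v)) \<subseteq> carrier R" using pq by auto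
  have "conv R (conv R p q) r (x # w) = (p [] \<otimes> q []) \<otimes> r (x # w) \<oplus> conv R (\<lambda>v. conv R p q (x # v)) r w"
    using conv_Cons[OF c(1) r] conv_Nil[OF Cons.prems] by simp
  also have "conv R (\<lambda>v. conv R p q (x # v)) r w = conv R (\<lambda>v. p [] \<otimes> q (x # v) \<oplus> conv R (\<lambda>v. p (x # v)) q v) r w"
    using conv_Cons[OF Cons.prems] by simp
  also have "\<dots> = p [] \<otimes> conv R (\<lambda>v. q (x # v)) r w \<oplus> conv R (conv R (\<lambda>v. p (x # v)) q) r w"
    using conv_add_left[OF c3 c2 r] conv_smult_left[OF qx r pq(1)] by simp
  also have "conv R (conv R (\<lambda>v. p (x # v)) q) r w = conv R (\<lambda>v. p (x # v)) (conv R q r) w"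
    by (rule Cons.IH[OF px Cons.prems(2)])
  also have "(p [] \<otimes> q []) \<otimes> r (x # w) \<oplus> (p [] \<otimes> conv R (\<lambda>v. q (x # v)) r w \<oplus> conv R (\<lambda>v. p (x # v)) (conv R q r) w)
    = p [] \<otimes> conv R q r (x # w) \<oplus> conv R (\<lambda>v. p (x # v)) (conv R q r) w"
    using pq conv_closed[OF qx r, of w] conv_closed[OF px c(2), of w] conv_Cons[OF Cons.prems(2) r, of x w]
    by (simp add: r_distr m_assoc a_assoc)
  also have "\<dots> = conv R p (conv R q r) (x # w)"
    using conv_Cons[OF Cons.prems(1) c(2)] by simp
  finally show ?case .
qed

lemma range_single: "r \<in> carrier R \<Longrightarrow> range (single R w r) \<subseteq> carrier R"
  by (auto simp: single_def)

lemma conv_single: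
  assumes "r \<in> carrier R" "s \<in> carrier R"
  shows "conv R (single R v r) (single R w s) = single R (v @ w) (r \<otimes> s)"
proof
  fix u
  show "conv R (single R v r) (single R w s) u = single R (v @ w) (r \<otimes> s) u"
  proof (induction v arbitrary: u)
    case Nil
    note c = range_single[OF assms(1), of "[]"] range_single[OF assms(2), of w]
    show ?case
    proof (cases u)
      case Nil
      then show ?thesis using conv_Nil[OF c] assms by (auto simp: single_def)
    next
      case (Cons y u')
      have "(\<lambda>v. single R [] r (y # v)) = (\<lambda>_. \<zero>)" by (auto simp: single_def)
      then show ?thesis using conv_Cons[OF c, of y u'] conv_zero_left[OF c(2)] assms Cons by (auto simp: single_def)
    qed
  next
    case (Cons x v)
    note c = range_single[OF assms(1), of "x # v"] range_single[OF assms(2), of w]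
    show ?case
    proof (cases u)
      case Nil
      then show ?thesis using conv_Nil[OF c] assms by (auto simp: single_def)
    next
      case u: (Cons y u')
      have "(\<lambda>t. single R (x # v) r (y # t)) = (if x = y then single R v r else (\<lambda>_. \<zero>))"
        by (auto simp: single_def)
      moreover have "single R w s (y # u') \<in> carrier R" using c(2) by auto
      moreover have "single R (x # v) r [] = \<zero>" by (simp add: single_def)
      moreover have "single R (v @ w) (r \<otimes> s) u' \<in> carrier R" using assms by (simp add: single_def)
      ultimately show ?thesis
        using conv_Cons[OF c, of y u'] conv_zero_left[OF c(2)] Cons.IH[of u'] u by (auto simp: single_def)
    qed
  qed
qed

lemma conv_one_left:
  assumes "range q \<subseteq> carrier R"
  shows "conv R (single R [] \<one>) q w = q w"
proof (cases w)
  case Nil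
  then show ?thesis using conv_Nil[OF range_single[OF one_closed] assms] assms by (simp add: single_def subset_iff)
next
  case (Cons x u)
  have "(\<lambda>v. single R [] \<one> (x # v)) = (\<lambda>_. \<zero>)" by (auto simp: single_def)
  moreover have "q w \<in> carrier R" using assms by auto
  ultimately show ?thesis
    using conv_Cons[OF range_single[OF one_closed] assms] conv_zero_left[OF assms] Cons by (simp add: single_def)
qed

lemma conv_one_right:
  assumes "range p \<subseteq> carrier R"
  shows "conv R p (single R [] \<one>) w = p w"
  using assms
proof (induction w arbitrary: p)
  case Nil
  then show ?case using conv_Nil[OF Nil range_single[OF one_closed]] by (simp add: single_def subset_iff)
next
  case (Cons x w)
  have "range (\<lambda>v. p (x # v)) \<subseteq> carrier R" "p [] \<in> carrier R" "p (x # w) \<in> carrier R" using Cons.prems by auto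
  then show ?case
    using conv_Cons[OF Cons.prems range_single[OF one_closed]] Cons.IH by (simp add: single_def)
qed

lemma conv_nonzeroD:
  assumes "range p \<subseteq> carrier R" "range q \<subseteq> carrier R" "conv R p q w \<noteq> \<zero>"
  shows "\<exists>u v. w = u @ v \<and> p u \<noteq> \<zero> \<and> q v \<noteq> \<zero>"
proof (rule ccontr)
  assume neg: "\<not> ?thesis"
  have "p (take i w) \<otimes> q (drop i w) = \<zero>" for i
  proof -
    have "p (take i w) = \<zero> \<or> q (drop i w) = \<zero>" using neg append_take_drop_id[of i w] by metis
    moreover have "p (take i w) \<in> carrier R" "q (drop i w) \<in> carrier R" using assms(1,2) by auto
    ultimately show ?thesis by auto
  qed
  then have "conv R p q w = \<zero>" unfolding conv_def by (simp add: finsum_zero)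
  then show False using assms(3) by simp
qed

end

section \<open>The free algebra on words and quotients of superalgebras\<close>

definition words :: "('m, 'c) ring_scheme \<Rightarrow> 'm list set"
  where "words M = {w. set w \<subseteq> carrier M}"

lemma free_alg_simps:
  "carrier (free_alg R M) = carrier (fs_module R (words M))"
  "p \<oplus>\<^bsub>free_alg R M\<^esub> q = p \<oplus>\<^bsub>fs_module R (words M)\<^esub> q"
  "\<zero>\<^bsub>free_alg R M\<^esub> = \<zero>\<^bsub>fs_module R (words M)\<^esub>"
  "p \<otimes>\<^bsub>free_alg R M\<^esub> q = conv R p q"
  "\<one>\<^bsub>free_alg R M\<^esub> = single R [] \<one>\<^bsub>R\<^esub>"
  "even_part (free_alg R M) = carrier (fs_module R {w \<in> words M. even (length w)})"
  "odd_part (free_alg R M) = carrier (fs_module R {w \<in> words M. odd (length w)})"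
  by (auto simp: free_alg_def fs_module_def words_def conv_def Let_def fun_eq_iff)

lemma free_alg_smult: "c \<odot>\<^bsub>free_alg R M\<^esub> p = (\<lambda>w. c \<odot>\<^bsub>R\<^esub> p w)"
  by (simp add: free_alg_def Let_def)

lemma fs_module_range: "p \<in> carrier (fs_module R W) \<Longrightarrow> range p \<subseteq> carrier R"
  by (auto simp: fs_module_def)

lemma free_alg_ring:
  assumes "cring R"
  shows "ring (free_alg R M)"
proof -
  interpret R: cring R by fact
  interpret F: module R "fs_module R (words M)" by (rule R.fs_module_module)
  have cl: "conv R p q \<in> carrier (fs_module R (words M))"
    if p: "p \<in> carrier (fs_module R (words M))" and q: "q \<in> carrier (fs_module R (words M))" for p q
  proof -
    note r = fs_module_range[OF p] fs_module_range[OF q]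
    have sub: "{w. conv R p q w \<noteq> \<zero>\<^bsub>R\<^esub>} \<subseteq> (\<lambda>(u, v). u @ v) ` ({u. p u \<noteq> \<zero>\<^bsub>R\<^esub>} \<times> {v. q v \<noteq> \<zero>\<^bsub>R\<^esub>})"
      using R.conv_nonzeroD[OF r] by fastforce
    have "finite {w. conv R p q w \<noteq> \<zero>\<^bsub>R\<^esub>}"
      by (rule finite_subset[OF sub]) (use p q in \<open>auto simp: fs_module_def\<close>)
    moreover have "conv R p q w = \<zero>\<^bsub>R\<^esub>" if "w \<notin> words M" for w
    proof (rule ccontr)
      assume "conv R p q w \<noteq> \<zero>\<^bsub>R\<^esub>"
      then obtain u v where uv: "w = u @ v" "p u \<noteq> \<zero>\<^bsub>R\<^esub>" "q v \<noteq> \<zero>\<^bsub>R\<^esub>" using R.conv_nonzeroD[OF r] by blast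
      then have "u \<in> words M" "v \<in> words M" using p q by (auto simp: fs_module_def)
      then show False using that uv by (auto simp: words_def)
    qed
    ultimately show ?thesis using R.conv_closed[OF r] by (auto simp: fs_module_def)
  qed
  have add: "p \<oplus>\<^bsub>fs_module R (words M)\<^esub> q = (\<lambda>w. p w \<oplus>\<^bsub>R\<^esub> q w)" for p q
    by (simp add: fs_module_def)
  show ?thesis
  proof (rule ringI)
    show "abelian_group (free_alg R M)"
    proof (rule abelian_groupI)
      show "\<exists>y\<in>carrier (free_alg R M). y \<oplus>\<^bsub>free_alg R M\<^esub> p = \<zero>\<^bsub>free_alg R M\<^esub>"
        if "p \<in> carrier (free_alg R M)" for p
        using that F.M.l_neg F.M.a_inv_closed unfolding free_alg_simps by blast
    qed (auto simp only: free_alg_simps F.M.a_closed F.M.zero_closed F.M.l_zero intro!: F.M.a_assoc F.M.a_comm)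
    show "Group.monoid (free_alg R M)"
    proof (rule monoidI)
      show "\<one>\<^bsub>free_alg R M\<^esub> \<in> carrier (free_alg R M)"
        unfolding free_alg_simps by (rule R.single_closed) (auto simp: words_def)
    qed (auto simp: free_alg_simps cl fun_eq_iff R.conv_assoc R.conv_one_left R.conv_one_right fs_module_range)
  qed (auto simp: free_alg_simps add fun_eq_iff R.conv_add_left R.conv_add_right fs_module_range)
qed

text \<open>On its ring fields the record agrees with the quotient ring \<open>A Quot I\<close>,
  from which the axioms are transferred.\<close>

lemma quot_superalgebra_ring:
  assumes "ideal I A"
  shows "ring (quot_superalgebra A I)"
    and "(\<lambda>a. I +>\<^bsub>A\<^esub> a) \<in> ring_hom A (quot_superalgebra A I)"
    and "carrier (quot_superalgebra A I) = (\<lambda>a. I +>\<^bsub>A\<^esub> a) ` carrier A"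
proof -
  interpret I: ideal I A by fact
  show h: "(\<lambda>a. I +>\<^bsub>A\<^esub> a) \<in> ring_hom A (quot_superalgebra A I)"
    using I.rcos_ring_hom by (auto simp: ring_hom_def quot_superalgebra_def FactRing_def)
  show c: "carrier (quot_superalgebra A I) = (\<lambda>a. I +>\<^bsub>A\<^esub> a) ` carrier A"
    by (auto simp: quot_superalgebra_def A_RCOSETS_def')
  interpret Q: ring "A Quot I" by (rule I.quotient_is_ring)
  have eq: "carrier (quot_superalgebra A I) = carrier (A Quot I)"
    "add (quot_superalgebra A I) = add (A Quot I)" "monoid.mult (quot_superalgebra A I) = monoid.mult (A Quot I)"
    "\<zero>\<^bsub>quot_superalgebra A I\<^esub> = \<zero>\<^bsub>A Quot I\<^esub>" "\<one>\<^bsub>quot_superalgebra A I\<^esub> = \<one>\<^bsub>A Quot I\<^esub>"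
    by (simp_all add: quot_superalgebra_def FactRing_def)
  show "ring (quot_superalgebra A I)"
  proof (rule ringI)
    show "abelian_group (quot_superalgebra A I)"
    proof (rule abelian_groupI)
      show "\<exists>y\<in>carrier (quot_superalgebra A I). y \<oplus>\<^bsub>quot_superalgebra A I\<^esub> x = \<zero>\<^bsub>quot_superalgebra A I\<^esub>"
        if "x \<in> carrier (quot_superalgebra A I)" for x
        using that Q.l_neg Q.a_inv_closed unfolding eq by blast
      show "x \<oplus>\<^bsub>quot_superalgebra A I\<^esub> y = y \<oplus>\<^bsub>quot_superalgebra A I\<^esub> x"
        if "x \<in> carrier (quot_superalgebra A I)" "y \<in> carrier (quot_superalgebra A I)" for x y
        using that unfolding eq by (rule Q.a_comm)
    qed (simp_all add: eq Q.a_assoc)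
    show "Group.monoid (quot_superalgebra A I)"
      by (rule monoidI) (auto simp: eq Q.m_assoc)
  qed (auto simp: eq Q.l_distr Q.r_distr)
qed

section \<open>Products of letters and their spans by degree\<close>

definition wprod :: "('s, 'c) ring_scheme \<Rightarrow> ('m \<Rightarrow> 's) \<Rightarrow> 'm list \<Rightarrow> 's"
  where "wprod S g w = foldr (\<lambda>m a. g m \<otimes>\<^bsub>S\<^esub> a) w \<one>\<^bsub>S\<^esub>"

lemma wprod_simps [simp]:
  "wprod S g [] = \<one>\<^bsub>S\<^esub>"
  "wprod S g (m # w) = g m \<otimes>\<^bsub>S\<^esub> wprod S g w"
  by (simp_all add: wprod_def)

text \<open>\<open>L\<close> selects the admissible word lengths: the even or odd numbers give the
  parity parts, \<open>{p..}\<close> the filtration by degree, \<open>{0}\<close> and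
  \<open>{1}\<close> the images of \<open>R\<close> and \<open>M\<close>. Since \<open>S\<close> is
  arbitrary, spans for disjoint \<open>L\<close> may meet.\<close>

inductive_set wspan ::
    "('r, 'c) ring_scheme \<Rightarrow> ('r, 'm, 'd) module_scheme \<Rightarrow> ('s, 'e) ring_scheme \<Rightarrow> ('r \<Rightarrow> 's) \<Rightarrow> ('m \<Rightarrow> 's) \<Rightarrow> nat set \<Rightarrow> 's set"
  for R M S \<rho> g L where
    zero: "\<zero>\<^bsub>S\<^esub> \<in> wspan R M S \<rho> g L"
  | step: "r \<in> carrier R \<Longrightarrow> w \<in> words M \<Longrightarrow> length w \<in> L \<Longrightarrow> y \<in> wspan R M S \<rho> g L \<Longrightarrow>
      \<rho> r \<otimes>\<^bsub>S\<^esub> wprod S g w \<oplus>\<^bsub>S\<^esub> y \<in> wspan R M S \<rho> g L"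

text \<open>A ring \<open>S\<close> with the data that determine a homomorphism from the exterior algebra of \<open>M\<close>.\<close>

locale ext_rep = M: module R M + S: ring S
  for R :: "('k, 'r, 'c) module_scheme" and M :: "('r, 'm, 'd) module_scheme" and S :: "('s, 'e) ring_scheme" +
  fixes \<rho> :: "'r \<Rightarrow> 's" and g :: "'m \<Rightarrow> 's"
  assumes \<rho>_hom: "\<rho> \<in> ring_hom R S"
    and \<rho>_central: "r \<in> carrier R \<Longrightarrow> a \<in> carrier S \<Longrightarrow> \<rho> r \<otimes>\<^bsub>S\<^esub> a = a \<otimes>\<^bsub>S\<^esub> \<rho> r"
    and g_closed [simp]: "m \<in> carrier M \<Longrightarrow> g m \<in> carrier S"
    and g_add: "m \<in> carrier M \<Longrightarrow> n \<in> carrier M \<Longrightarrow> g (m \<oplus>\<^bsub>M\<^esub> n) = g m \<oplus>\<^bsub>S\<^esub> g n"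
    and g_smult: "r \<in> carrier R \<Longrightarrow> m \<in> carrier M \<Longrightarrow> g (r \<odot>\<^bsub>M\<^esub> m) = \<rho> r \<otimes>\<^bsub>S\<^esub> g m"
    and g_sq: "m \<in> carrier M \<Longrightarrow> g m \<otimes>\<^bsub>S\<^esub> g m = \<zero>\<^bsub>S\<^esub>"
begin

lemma \<rho>_simps [simp]:
  "r \<in> carrier R \<Longrightarrow> \<rho> r \<in> carrier S"
  "r \<in> carrier R \<Longrightarrow> s \<in> carrier R \<Longrightarrow> \<rho> (r \<otimes>\<^bsub>R\<^esub> s) = \<rho> r \<otimes>\<^bsub>S\<^esub> \<rho> s"
  "r \<in> carrier R \<Longrightarrow> s \<in> carrier R \<Longrightarrow> \<rho> (r \<oplus>\<^bsub>R\<^esub> s) = \<rho> r \<oplus>\<^bsub>S\<^esub> \<rho> s"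
  "\<rho> \<one>\<^bsub>R\<^esub> = \<one>\<^bsub>S\<^esub>" "\<rho> \<zero>\<^bsub>R\<^esub> = \<zero>\<^bsub>S\<^esub>"
  using \<rho>_hom ring_hom_zero[OF \<rho>_hom M.R.ring_axioms S.ring_axioms] by (auto simp: ring_hom_def)

lemma g_zero: "g \<zero>\<^bsub>M\<^esub> = \<zero>\<^bsub>S\<^esub>"
  using g_smult[of "\<zero>\<^bsub>R\<^esub>" "\<zero>\<^bsub>M\<^esub>"] by simp

text \<open>\<open>S\<close> as a module over \<open>R\<close> through \<open>\<rho>\<close>; linear
  extension and the universal property of differentials require such a target.\<close>

definition "smod = \<lparr>carrier = carrier S, monoid.mult = monoid.mult S, one = \<one>\<^bsub>S\<^esub>,
  ring.zero = \<zero>\<^bsub>S\<^esub>, add = add S, smult = (\<lambda>r a. \<rho> r \<otimes>\<^bsub>S\<^esub> a)\<rparr>"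

lemma smod_simps [simp]:
  "carrier smod = carrier S" "\<zero>\<^bsub>smod\<^esub> = \<zero>\<^bsub>S\<^esub>" "a \<oplus>\<^bsub>smod\<^esub> b = a \<oplus>\<^bsub>S\<^esub> b" "r \<odot>\<^bsub>smod\<^esub> a = \<rho> r \<otimes>\<^bsub>S\<^esub> a"
  by (simp_all add: smod_def)

lemma smod_module: "module R smod"
proof (rule moduleI[OF M.R.is_cring])
  show "abelian_group smod"
  proof (rule abelian_groupI)
    show "\<exists>y\<in>carrier smod. y \<oplus>\<^bsub>smod\<^esub> x = \<zero>\<^bsub>smod\<^esub>" if "x \<in> carrier smod" for x
      using that S.l_neg[of x] S.a_inv_closed[of x] by auto
    show "x \<oplus>\<^bsub>smod\<^esub> y = y \<oplus>\<^bsub>smod\<^esub> x" if "x \<in> carrier smod" "y \<in> carrier smod" for x y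
      using that S.a_comm by simp
  qed (simp_all add: S.a_assoc)
qed (simp_all add: S.l_distr S.r_distr S.m_assoc)

lemma words_simps [simp]: "[] \<in> words M" "m # w \<in> words M \<longleftrightarrow> m \<in> carrier M \<and> w \<in> words M"
  "v @ w \<in> words M \<longleftrightarrow> v \<in> words M \<and> w \<in> words M"
  by (auto simp: words_def)

lemma wprod_closed [simp]: "w \<in> words M \<Longrightarrow> wprod S g w \<in> carrier S"
  by (induction w) auto

lemma wprod_append: "v \<in> words M \<Longrightarrow> w \<in> words M \<Longrightarrow> wprod S g (v @ w) = wprod S g v \<otimes>\<^bsub>S\<^esub> wprod S g w"
  by (induction v) (auto simp: S.m_assoc)

abbreviation "WS \<equiv> wspan R M S \<rho> g"

lemma wspan_closed: "a \<in> WS L \<Longrightarrow> a \<in> carrier S"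
  by (induction rule: wspan.induct) auto

lemma wspan_single: "r \<in> carrier R \<Longrightarrow> w \<in> words M \<Longrightarrow> length w \<in> L \<Longrightarrow> \<rho> r \<otimes>\<^bsub>S\<^esub> wprod S g w \<in> WS L"
  using wspan.step[OF _ _ _ wspan.zero, of r R w M L S \<rho> g] by simp

lemma wspan_add:
  assumes "a \<in> WS L" "b \<in> WS L"
  shows "a \<oplus>\<^bsub>S\<^esub> b \<in> WS L"
  using assms(1)
proof induction
  case zero
  then show ?case using assms(2) wspan_closed by simp
next
  case (step r w y)
  have "\<rho> r \<otimes>\<^bsub>S\<^esub> wprod S g w \<oplus>\<^bsub>S\<^esub> y \<oplus>\<^bsub>S\<^esub> b = \<rho> r \<otimes>\<^bsub>S\<^esub> wprod S g w \<oplus>\<^bsub>S\<^esub> (y \<oplus>\<^bsub>S\<^esub> b)"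
    using step wspan_closed assms(2) by (simp add: S.a_assoc)
  then show ?case using step wspan.step by simp
qed

lemma wspan_induct_add [consumes 1, case_names single add zero]:
  assumes a: "a \<in> WS L"
    and single: "\<And>r w. r \<in> carrier R \<Longrightarrow> w \<in> words M \<Longrightarrow> length w \<in> L \<Longrightarrow> P (\<rho> r \<otimes>\<^bsub>S\<^esub> wprod S g w)"
    and add: "\<And>a b. a \<in> WS L \<Longrightarrow> b \<in> WS L \<Longrightarrow> P a \<Longrightarrow> P b \<Longrightarrow> P (a \<oplus>\<^bsub>S\<^esub> b)"
    and zero: "P \<zero>\<^bsub>S\<^esub>"
  shows "P a"
  using a by induction (auto intro: add single wspan_single zero)

lemma wspan_mono: "L \<subseteq> L' \<Longrightarrow> a \<in> WS L \<Longrightarrow> a \<in> WS L'"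
  by (rotate_tac, induction rule: wspan.induct) (auto intro: wspan.intros)

text \<open>Words concatenate and their lengths add; a scalar between two words moves to the front
  because the values of \<open>\<rho>\<close> are central.\<close>

lemma wspan_mult:
  assumes a: "a \<in> WS L" and b: "b \<in> WS L'" and L: "\<And>i j. i \<in> L \<Longrightarrow> j \<in> L' \<Longrightarrow> i + j \<in> L''"
  shows "a \<otimes>\<^bsub>S\<^esub> b \<in> WS L''"
  using a
proof (induction rule: wspan_induct_add)
  case (single r v)
  show ?case
    using b
  proof (induction rule: wspan_induct_add)
    case (single s w)
    have "\<rho> r \<otimes>\<^bsub>S\<^esub> wprod S g v \<otimes>\<^bsub>S\<^esub> (\<rho> s \<otimes>\<^bsub>S\<^esub> wprod S g w) = \<rho> r \<otimes>\<^bsub>S\<^esub> (wprod S g v \<otimes>\<^bsub>S\<^esub> \<rho> s) \<otimes>\<^bsub>S\<^esub> wprod S g w"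
      using single \<open>r \<in> carrier R\<close> \<open>v \<in> words M\<close> by (simp add: S.m_assoc)
    also have "\<dots> = \<rho> (r \<otimes>\<^bsub>R\<^esub> s) \<otimes>\<^bsub>S\<^esub> wprod S g (v @ w)"
      unfolding \<rho>_central[OF single(1) wprod_closed[OF \<open>v \<in> words M\<close>], symmetric]
      using single \<open>r \<in> carrier R\<close> \<open>v \<in> words M\<close> by (simp add: S.m_assoc wprod_append)
    finally show ?case using wspan_single[of "r \<otimes>\<^bsub>R\<^esub> s" "v @ w" L''] single \<open>r \<in> carrier R\<close> \<open>v \<in> words M\<close> \<open>length v \<in> L\<close> L by simp
  next
    case (add a b)
    then show ?case using wspan_add wspan_closed \<open>r \<in> carrier R\<close> \<open>v \<in> words M\<close> by (simp add: S.r_distr)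
  qed (use \<open>r \<in> carrier R\<close> \<open>v \<in> words M\<close> wspan.zero in simp)
next
  case (add c d)
  then show ?case using wspan_add wspan_closed b by (simp add: S.l_distr)
qed (use b wspan_closed wspan.zero in simp)

lemma wspan_smult:
  assumes "a \<in> WS L" "r \<in> carrier R"
  shows "\<rho> r \<otimes>\<^bsub>S\<^esub> a \<in> WS L"
  using wspan_mult[of "\<rho> r" "{0}" a L L] wspan_single[of r "[]" "{0}"] assms by simp

lemma wspan_a_inv:
  assumes "a \<in> WS L"
  shows "\<ominus>\<^bsub>S\<^esub> a \<in> WS L"
proof -
  have "\<rho> (\<ominus>\<^bsub>R\<^esub> \<one>\<^bsub>R\<^esub>) = \<ominus>\<^bsub>S\<^esub> \<one>\<^bsub>S\<^esub>"
    using \<rho>_simps(3)[of "\<ominus>\<^bsub>R\<^esub> \<one>\<^bsub>R\<^esub>" "\<one>\<^bsub>R\<^esub>"] by (intro S.minus_equality[symmetric]) (auto simp: M.R.l_neg)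
  then show ?thesis using wspan_smult[OF assms, of "\<ominus>\<^bsub>R\<^esub> \<one>\<^bsub>R\<^esub>"] wspan_closed[OF assms] by (simp add: S.l_minus)
qed

text \<open>The terms are sorted by the length of their words; the sum need not be direct.\<close>

lemma wspan_Un:
  assumes "a \<in> WS (L \<union> L')"
  shows "\<exists>b\<in>WS L. \<exists>c\<in>WS L'. a = b \<oplus>\<^bsub>S\<^esub> c"
  using assms
proof (induction rule: wspan_induct_add)
  case (single r w)
  let ?a = "\<rho> r \<otimes>\<^bsub>S\<^esub> wprod S g w"
  have a: "?a = ?a \<oplus>\<^bsub>S\<^esub> \<zero>\<^bsub>S\<^esub>" "?a = \<zero>\<^bsub>S\<^esub> \<oplus>\<^bsub>S\<^esub> ?a" using single by simp_all
  show ?case using single(3)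
  proof
    assume "length w \<in> L"
    then show ?thesis using a(1) wspan_single single wspan.zero by blast
  next
    assume "length w \<in> L'"
    then show ?thesis using a(2) wspan_single single wspan.zero by blast
  qed
next
  case (add a b)
  then obtain p q p' q' where *: "p \<in> WS L" "q \<in> WS L'" "a = p \<oplus>\<^bsub>S\<^esub> q" "p' \<in> WS L" "q' \<in> WS L'" "b = p' \<oplus>\<^bsub>S\<^esub> q'"
    by blast
  then have "a \<oplus>\<^bsub>S\<^esub> b = (p \<oplus>\<^bsub>S\<^esub> p') \<oplus>\<^bsub>S\<^esub> (q \<oplus>\<^bsub>S\<^esub> q')"
    using wspan_closed[of _ L] wspan_closed[of _ L'] by (simp add: S.a_assoc S.a_lcomm)
  then show ?case using * wspan_add by blast
next
  case zero
  then show ?case using wspan.zero[of S R M \<rho> g] by (intro bexI[of _ "\<zero>\<^bsub>S\<^esub>"]) auto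
qed

lemma wspan_0: "WS {0} = \<rho> ` carrier R"
proof (intro equalityI subsetI)
  fix a assume "a \<in> WS {0}"
  then show "a \<in> \<rho> ` carrier R"
  proof (induction rule: wspan_induct_add)
    case zero
    then show ?case by (metis M.R.zero_closed \<rho>_simps(5) imageI)
  qed (auto simp flip: \<rho>_simps(3))
next
  fix a assume "a \<in> \<rho> ` carrier R"
  then show "a \<in> WS {0}" using wspan_single[of _ "[]" "{0}"] by auto
qed

lemma wspan_1: "WS {1} = g ` carrier M"
proof (intro equalityI subsetI)
  fix a assume "a \<in> WS {1}"
  then show "a \<in> g ` carrier M"
  proof (induction rule: wspan_induct_add)
    case (single r w)
    then obtain m where "w = [m]" "m \<in> carrier M" by (cases w) auto
    then have "\<rho> r \<otimes>\<^bsub>S\<^esub> wprod S g w = g (r \<odot>\<^bsub>M\<^esub> m)" using single by (simp add: g_smult)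
    then show ?case using single \<open>m \<in> carrier M\<close> by simp
  next
    case zero
    then show ?case by (metis M.M.zero_closed g_zero imageI)
  qed (auto simp flip: g_add)
next
  fix a assume "a \<in> g ` carrier M"
  then obtain m where "m \<in> carrier M" "a = g m" by auto
  then show "a \<in> WS {1}" using wspan_single[of "\<one>\<^bsub>R\<^esub>" "[m]" "{1}"] by simp
qed

end

section \<open>The exterior algebra as a quotient, and its universal property\<close>

lemma ext_relations_closed:
  assumes R: "cring R" and M: "module R M"
  shows "ext_relations R M \<subseteq> carrier (free_alg R M)"
proof -
  interpret F: ring "free_alg R M" by (rule free_alg_ring[OF R])
  interpret M: module R M by fact
  have s: "single R w r \<in> carrier (free_alg R M)" if "set w \<subseteq> carrier M" "r \<in> carrier R" for w r
    unfolding free_alg_simps by (rule M.R.single_closed) (use that in \<open>auto simp: words_def\<close>)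
  show ?thesis unfolding ext_relations_def by (auto simp: s)
qed

lemma ext_ideal_ideal:
  assumes R: "cring R" and M: "module R M"
  shows "ideal (ext_ideal R M) (free_alg R M)" "ext_relations R M \<subseteq> ext_ideal R M"
  unfolding ext_ideal_def
  using ring.genideal_ideal[OF free_alg_ring[OF R] ext_relations_closed[OF R M]]
    ring.genideal_self[OF free_alg_ring[OF R] ext_relations_closed[OF R M]] by auto

lemma exterior_algebra_ring:
  assumes R: "cring R" and M: "module R M"
  shows "ring (exterior_algebra R M)"
    and "(\<lambda>p. ext_ideal R M +>\<^bsub>free_alg R M\<^esub> p) \<in> ring_hom (free_alg R M) (exterior_algebra R M)"
    and "carrier (exterior_algebra R M) = (\<lambda>p. ext_ideal R M +>\<^bsub>free_alg R M\<^esub> p) ` carrier (free_alg R M)"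
  unfolding exterior_algebra_def using quot_superalgebra_ring[OF ext_ideal_ideal(1)[OF R M]] by auto


lemma single_add:
  "cring R \<Longrightarrow> single R w r \<oplus>\<^bsub>free_alg R M\<^esub> single R w s = single R w (r \<oplus>\<^bsub>R\<^esub> s)"
  by (auto simp: free_alg_simps fs_module_def single_def cring.cring_simprules)

context ext_rep
begin

text \<open>Words are sent to the products of their letters. The linear extension is multiplicative,
  and \<open>g_add\<close>, \<open>g_smult\<close> and \<open>g_sq\<close> kill one family of
  relations each; the homomorphism then factors through the quotient.\<close>

lemma universal:
  "\<exists>H\<in>ring_hom (exterior_algebra R M) S.
    (\<forall>r\<in>carrier R. H (ext_scalar R M r) = \<rho> r) \<and> (\<forall>m\<in>carrier M. H (ext_vector R M m) = g m)"
proof -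
  let ?F = "free_alg R M" and ?V = "fs_module R (words M)" and ?I = "ext_ideal R M"
  let ?cls = "\<lambda>p. ?I +>\<^bsub>?F\<^esub> p"
  interpret F: ring ?F by (rule free_alg_ring[OF M.R.is_cring])
  interpret V: module R ?V by (rule M.R.fs_module_module)
  note I = ext_ideal_ideal[OF M.R.is_cring M.module_axioms]
  note Lam = exterior_algebra_ring[OF M.R.is_cring M.module_axioms]
  interpret I: ideal ?I ?F by (rule I(1))
  have wp: "wprod S g \<in> words M \<rightarrow> carrier smod" by simp
  define h where "h = lin_ext R smod (wprod S g)"
  have h: "linear_map R ?V smod h" unfolding h_def by (rule M.R.lin_ext_linear[OF smod_module wp])
  have hs: "h (single R w r) = \<rho> r \<otimes>\<^bsub>S\<^esub> wprod S g w" if "w \<in> words M" "r \<in> carrier R" for w r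
    unfolding h_def using M.R.lin_ext_single[OF smod_module wp that] by simp
  have sc: "single R w r \<in> carrier ?F" if "w \<in> words M" "r \<in> carrier R" for w r
    unfolding free_alg_simps by (rule M.R.single_closed[OF that])
  have hc: "h p \<in> carrier S" if "p \<in> carrier ?F" for p
    using linear_mapD(1)[OF h] that by (simp add: free_alg_simps)
  have ha: "h (p \<oplus>\<^bsub>?F\<^esub> q) = h p \<oplus>\<^bsub>S\<^esub> h q" if "p \<in> carrier ?F" "q \<in> carrier ?F" for p q
    using linear_mapD(2)[OF h] that by (simp add: free_alg_simps)
  have h0: "h \<zero>\<^bsub>?F\<^esub> = \<zero>\<^bsub>S\<^esub>"
    using linear_map_zero[OF V.module_axioms smod_module h] by (simp add: free_alg_simps)
  have z: "(\<lambda>_. \<zero>\<^bsub>R\<^esub>) = \<zero>\<^bsub>?F\<^esub>" by (simp add: free_alg_simps fs_module_def)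
  \<comment> \<open>Multiplicativity is checked first for a single word on the left and an arbitrary
    right factor, where a coefficient has to pass the word and centrality is used; then the left
    factor is built up.\<close>
  have h1: "h (single R v r \<otimes>\<^bsub>?F\<^esub> q) = h (single R v r) \<otimes>\<^bsub>S\<^esub> h q"
    if v: "v \<in> words M" "r \<in> carrier R" and q: "q \<in> carrier ?V" for v r q
    using q
  proof (induction rule: M.R.fs_module_induct)
    case zero
    then show ?case using sc[OF v] hc[OF sc[OF v]] by (simp add: z h0)
  next
    case (step w s q)
    have q: "q \<in> carrier ?F" using step by (simp add: free_alg_simps)
    note c = sc[OF v] sc[OF step(1,2)] q
    have "h (single R v r \<otimes>\<^bsub>?F\<^esub> single R w s) = h (single R v r) \<otimes>\<^bsub>S\<^esub> h (single R w s)"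
    proof -
      have "h (single R v r \<otimes>\<^bsub>?F\<^esub> single R w s) = \<rho> r \<otimes>\<^bsub>S\<^esub> (\<rho> s \<otimes>\<^bsub>S\<^esub> wprod S g v) \<otimes>\<^bsub>S\<^esub> wprod S g w"
        using v step M.R.conv_single[OF v(2) step(2), of v w] hs[of "v @ w" "r \<otimes>\<^bsub>R\<^esub> s"]
        by (simp add: free_alg_simps S.m_assoc wprod_append)
      also have "\<rho> s \<otimes>\<^bsub>S\<^esub> wprod S g v = wprod S g v \<otimes>\<^bsub>S\<^esub> \<rho> s"
        using v step by (intro \<rho>_central) auto
      finally show ?thesis using v step hs by (simp add: S.m_assoc)
    qed
    then have "h (single R v r \<otimes>\<^bsub>?F\<^esub> (single R w s \<oplus>\<^bsub>?F\<^esub> q)) = h (single R v r) \<otimes>\<^bsub>S\<^esub> h (single R w s \<oplus>\<^bsub>?F\<^esub> q)"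
      using c step.IH ha hc by (simp add: F.r_distr S.r_distr)
    then show ?case by (simp add: free_alg_simps)
  qed
  have hm: "h (p \<otimes>\<^bsub>?F\<^esub> q) = h p \<otimes>\<^bsub>S\<^esub> h q" if p: "p \<in> carrier ?V" and q: "q \<in> carrier ?V" for p q
    using p
  proof (induction rule: M.R.fs_module_induct)
    case zero
    then show ?case using q hc[of q] by (simp add: z h0 free_alg_simps(1)[symmetric])
  next
    case (step w s p)
    have c: "p \<in> carrier ?F" "q \<in> carrier ?F" using step q by (simp_all add: free_alg_simps)
    have "h ((single R w s \<oplus>\<^bsub>?F\<^esub> p) \<otimes>\<^bsub>?F\<^esub> q) = h (single R w s \<oplus>\<^bsub>?F\<^esub> p) \<otimes>\<^bsub>S\<^esub> h q"
      using c sc[OF step(1,2)] step.IH h1[OF step(1,2) q] ha hc by (simp add: F.l_distr S.l_distr)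
    then show ?case by (simp add: free_alg_simps(2))
  qed
  have hh: "h \<in> ring_hom ?F S"
    by (rule ring_hom_memI) (use hc ha hm hs[of "[]" "\<one>\<^bsub>R\<^esub>"] in \<open>auto simp: free_alg_simps(1,5)\<close>)
  interpret h: ring_hom_ring ?F S h by (rule ring_hom_ringI2[OF F.ring_axioms S.ring_axioms hh])
  have ker: "p \<ominus>\<^bsub>?F\<^esub> q \<in> a_kernel ?F S h" if "p \<in> carrier ?F" "q \<in> carrier ?F" "h p = h q" for p q
  proof -
    have "h (p \<ominus>\<^bsub>?F\<^esub> q) = h p \<ominus>\<^bsub>S\<^esub> h q"
      unfolding a_minus_def using that h.hom_add[of p "\<ominus>\<^bsub>?F\<^esub> q"] h.hom_a_inv[of q] by simp
    then have "h (p \<ominus>\<^bsub>?F\<^esub> q) = \<zero>\<^bsub>S\<^esub>" using that hc[of q] by (simp add: S.minus_eq S.r_neg)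
    then show ?thesis unfolding a_kernel_def' using that by simp
  qed
  have "ext_relations R M \<subseteq> a_kernel ?F S h"
    unfolding ext_relations_def
  proof (intro Un_least subsetI; elim CollectE exE conjE; hypsubst)
    fix m n assume m: "m \<in> carrier M" "n \<in> carrier M"
    show "single R [m \<oplus>\<^bsub>M\<^esub> n] \<one>\<^bsub>R\<^esub> \<ominus>\<^bsub>?F\<^esub> (single R [m] \<one>\<^bsub>R\<^esub> \<oplus>\<^bsub>?F\<^esub> single R [n] \<one>\<^bsub>R\<^esub>) \<in> a_kernel ?F S h"
      by (rule ker) (use m sc hs ha g_add in auto)
  next
    fix r m assume m: "r \<in> carrier R" "m \<in> carrier M"
    show "single R [r \<odot>\<^bsub>M\<^esub> m] \<one>\<^bsub>R\<^esub> \<ominus>\<^bsub>?F\<^esub> single R [m] r \<in> a_kernel ?F S h"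
      by (rule ker) (use m sc hs g_smult in auto)
  next
    fix m assume m: "m \<in> carrier M"
    show "single R [m, m] \<one>\<^bsub>R\<^esub> \<in> a_kernel ?F S h"
      unfolding a_kernel_def'
      using m sc[of "[m, m]" "\<one>\<^bsub>R\<^esub>"] hs[of "[m, m]" "\<one>\<^bsub>R\<^esub>"] g_sq[OF m] by simp
  qed
  then have I0: "?I \<subseteq> a_kernel ?F S h"
    unfolding ext_ideal_def by (intro F.genideal_minimal h.kernel_is_ideal)
  have "\<exists>\<phi>\<in>ring_hom ((exterior_algebra R M)\<lparr>carrier := ?cls ` carrier ?F\<rparr>) S. \<forall>p\<in>carrier ?F. \<phi> (?cls p) = h p"
  proof (rule ring_hom_factor[OF F.ring_axioms Lam(1) S.ring_axioms Lam(2) hh])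
    fix p assume p: "p \<in> carrier ?F" "?cls p = \<zero>\<^bsub>exterior_algebra R M\<^esub>"
    then have "p \<in> ?I" using I.a_rcos_self[OF p(1)] by (simp add: exterior_algebra_def quot_superalgebra_def)
    then show "h p = \<zero>\<^bsub>S\<^esub>" using I0 unfolding a_kernel_def' by blast
  qed
  then obtain \<phi> where \<phi>: "\<phi> \<in> ring_hom (exterior_algebra R M) S" "\<forall>p\<in>carrier ?F. \<phi> (?cls p) = h p"
    unfolding Lam(3)[symmetric] by auto
  show ?thesis
  proof (intro bexI[OF _ \<phi>(1)] conjI ballI)
    show "\<phi> (ext_scalar R M r) = \<rho> r" if "r \<in> carrier R" for r
      using \<phi>(2) sc[of "[]" r] hs[of "[]" r] that by (simp add: ext_scalar_def)
    show "\<phi> (ext_vector R M m) = g m" if "m \<in> carrier M" for m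
      using \<phi>(2) sc[of "[m]" "\<one>\<^bsub>R\<^esub>"] hs[of "[m]" "\<one>\<^bsub>R\<^esub>"] that by (simp add: ext_vector_def)
  qed
qed

lemma hom_wspan:
  assumes "ext_rep R M S' \<rho>' g'" and H: "H \<in> ring_hom S S'"
    and \<rho>: "\<And>r. r \<in> carrier R \<Longrightarrow> H (\<rho> r) = \<rho>' r" and g: "\<And>m. m \<in> carrier M \<Longrightarrow> H (g m) = g' m"
    and a: "a \<in> WS L"
  shows "H a \<in> wspan R M S' \<rho>' g' L"
proof -
  interpret S': ext_rep R M S' \<rho>' g' by fact
  interpret H: ring_hom_ring S S' H by (rule ring_hom_ringI2[OF S.ring_axioms S'.S.ring_axioms H])
  have w: "H (wprod S g w) = wprod S' g' w" if "w \<in> words M" for w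
    using that by (induction w) (auto simp: g)
  show ?thesis
    using a by induction (auto simp: w \<rho> wspan_closed intro: wspan.intros)
qed

lemma hom_wspan_image:
  assumes "ext_rep R M S' \<rho>' g'" and H: "H \<in> ring_hom S S'"
    and \<rho>: "\<And>r. r \<in> carrier R \<Longrightarrow> H (\<rho> r) = \<rho>' r" and g: "\<And>m. m \<in> carrier M \<Longrightarrow> H (g m) = g' m"
  shows "H ` WS L = wspan R M S' \<rho>' g' L"
proof
  show "H ` WS L \<subseteq> wspan R M S' \<rho>' g' L" using hom_wspan[OF assms] by blast
  interpret S': ext_rep R M S' \<rho>' g' by fact
  interpret H: ring_hom_ring S S' H by (rule ring_hom_ringI2[OF S.ring_axioms S'.S.ring_axioms H])
  have w: "H (wprod S g w) = wprod S' g' w" if "w \<in> words M" for w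
    using that by (induction w) (auto simp: g)
  show "wspan R M S' \<rho>' g' L \<subseteq> H ` WS L"
  proof
    fix a assume "a \<in> wspan R M S' \<rho>' g' L"
    then show "a \<in> H ` WS L"
    proof induction
      case zero
      from imageI[OF wspan.zero, of H S R M \<rho> g L] show ?case unfolding H.hom_zero .
    next
      case (step r w y)
      then obtain b where b: "b \<in> WS L" "y = H b" by auto
      then have "\<rho>' r \<otimes>\<^bsub>S'\<^esub> wprod S' g' w \<oplus>\<^bsub>S'\<^esub> y = H (\<rho> r \<otimes>\<^bsub>S\<^esub> wprod S g w \<oplus>\<^bsub>S\<^esub> b)"
        using step wspan_closed by (simp add: w \<rho>)
      then show ?case using wspan.step[OF step(1-3) b(1)] by blast
    qed
  qed
qed

end

text \<open>Each relation of the ideal provides one axiom for the canonical maps. The second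
  statement translates conditions on word lengths in the free algebra into spans in the quotient,
  from which the parity parts are read off.\<close>

lemma exterior_algebra_rep:
  fixes R :: "('k, 'r, 'c) module_scheme"
  assumes R: "cring R" and M: "module R M"
  shows "ext_rep R M (exterior_algebra R M) (ext_scalar R M) (ext_vector R M)"
    and "\<And>L. (\<lambda>p. ext_ideal R M +>\<^bsub>free_alg R M\<^esub> p) ` carrier (fs_module R {w \<in> words M. length w \<in> L}) =
      wspan R M (exterior_algebra R M) (ext_scalar R M) (ext_vector R M) L"
proof -
  let ?F = "free_alg R M" and ?V = "fs_module R (words M)" and ?I = "ext_ideal R M" and ?E = "exterior_algebra R M"
  let ?cls = "\<lambda>p. ?I +>\<^bsub>?F\<^esub> p"
  interpret M: module R M by fact
  interpret F: ring ?F by (rule free_alg_ring[OF R])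
  note I = ext_ideal_ideal[OF R M]
  note Lam = exterior_algebra_ring[OF R M]
  interpret I: ideal ?I ?F by (rule I(1))
  interpret E: ring ?E by (rule Lam(1))
  interpret c: ring_hom_ring ?F ?E ?cls by (rule ring_hom_ringI2[OF F.ring_axioms Lam(1,2)])
  have sc: "single R w r \<in> carrier ?F" if "set w \<subseteq> carrier M" "r \<in> carrier R" for w r
    unfolding free_alg_simps using M.R.single_closed[of w "words M"] that by (simp add: words_def)
  have sm: "single R v r \<otimes>\<^bsub>?F\<^esub> single R w s = single R (v @ w) (r \<otimes>\<^bsub>R\<^esub> s)" if "r \<in> carrier R" "s \<in> carrier R" for v w r s
    unfolding free_alg_simps by (rule M.R.conv_single[OF that])
  have z: "(\<lambda>_. \<zero>\<^bsub>R\<^esub>) = \<zero>\<^bsub>?F\<^esub>" by (simp add: free_alg_simps fs_module_def)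
  have zE: "\<zero>\<^bsub>?E\<^esub> = ?I" unfolding exterior_algebra_def quot_superalgebra_def by simp
  have I0: "?cls p = \<zero>\<^bsub>?E\<^esub>" if "p \<in> ?I" for p
    unfolding zE by (rule I.a_rcos_const[OF that])
  have eq: "?cls p = ?cls q" if "p \<ominus>\<^bsub>?F\<^esub> q \<in> ?I" "p \<in> carrier ?F" "q \<in> carrier ?F" for p q
  proof -
    have "?cls p \<ominus>\<^bsub>?E\<^esub> ?cls q = ?cls (p \<ominus>\<^bsub>?F\<^esub> q)"
      using that by (simp add: F.minus_eq E.minus_eq)
    then show ?thesis using I0[OF that(1)] that by simp
  qed
  have central: "single R [] r \<otimes>\<^bsub>?F\<^esub> p = p \<otimes>\<^bsub>?F\<^esub> single R [] r" if r: "r \<in> carrier R" and p: "p \<in> carrier ?V" for r p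
    using p
  proof (induction rule: M.R.fs_module_induct)
    case zero
    then show ?case using sc[of "[]" r] r by (simp add: z)
  next
    case (step w s p)
    have c: "p \<in> carrier ?F" "single R [] r \<in> carrier ?F" "single R w s \<in> carrier ?F"
      using step r sc by (auto simp: free_alg_simps(1) words_def)
    have "single R [] r \<otimes>\<^bsub>?F\<^esub> (single R w s \<oplus>\<^bsub>?F\<^esub> p) = (single R w s \<oplus>\<^bsub>?F\<^esub> p) \<otimes>\<^bsub>?F\<^esub> single R [] r"
      using c step r by (simp add: F.r_distr F.l_distr sm M.R.m_comm)
    then show ?case by (simp add: free_alg_simps(2))
  qed
  show rep: "ext_rep R M ?E (ext_scalar R M) (ext_vector R M)"
  proof (intro ext_rep.intro ext_rep_axioms.intro M E.ring_axioms)
    show "ext_scalar R M \<in> ring_hom R ?E"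
      unfolding ext_scalar_def
    proof (rule ring_hom_memI)
      fix r s assume r: "r \<in> carrier R" "s \<in> carrier R"
      show "?cls (single R [] (r \<otimes>\<^bsub>R\<^esub> s)) = ?cls (single R [] r) \<otimes>\<^bsub>?E\<^esub> ?cls (single R [] s)"
        using r sc[of "[]"] sm[of r s "[]" "[]"] by (simp flip: c.hom_mult)
      show "?cls (single R [] (r \<oplus>\<^bsub>R\<^esub> s)) = ?cls (single R [] r) \<oplus>\<^bsub>?E\<^esub> ?cls (single R [] s)"
        using r sc[of "[]"] by (simp add: single_add[OF R] flip: c.hom_add)
    next
      show "?cls (single R [] \<one>\<^bsub>R\<^esub>) = \<one>\<^bsub>?E\<^esub>" using c.hom_one by (simp add: free_alg_simps)
    qed (use sc in simp)
    show "ext_scalar R M r \<otimes>\<^bsub>?E\<^esub> a = a \<otimes>\<^bsub>?E\<^esub> ext_scalar R M r" if r: "r \<in> carrier R" and a: "a \<in> carrier ?E" for r a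
    proof -
      obtain p where p: "p \<in> carrier ?F" "a = ?cls p" using a unfolding Lam(3) by blast
      then show ?thesis using central[of r p] r sc[of "[]" r]
        by (simp add: ext_scalar_def free_alg_simps(1)[symmetric] flip: c.hom_mult)
    qed
    show "ext_vector R M m \<in> carrier ?E" if "m \<in> carrier M" for m
      using sc[of "[m]" "\<one>\<^bsub>R\<^esub>"] that by (simp add: ext_vector_def)
    fix m assume m: "m \<in> carrier M"
    show "ext_vector R M (m \<oplus>\<^bsub>M\<^esub> n) = ext_vector R M m \<oplus>\<^bsub>?E\<^esub> ext_vector R M n" if n: "n \<in> carrier M" for n
    proof -
      have "?cls (single R [m \<oplus>\<^bsub>M\<^esub> n] \<one>\<^bsub>R\<^esub>) = ?cls (single R [m] \<one>\<^bsub>R\<^esub> \<oplus>\<^bsub>?F\<^esub> single R [n] \<one>\<^bsub>R\<^esub>)"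
      proof (rule eq)
        show "single R [m \<oplus>\<^bsub>M\<^esub> n] \<one>\<^bsub>R\<^esub> \<ominus>\<^bsub>?F\<^esub> (single R [m] \<one>\<^bsub>R\<^esub> \<oplus>\<^bsub>?F\<^esub> single R [n] \<one>\<^bsub>R\<^esub>) \<in> ?I"
          using m n I(2) unfolding ext_relations_def by blast
      qed (use m n sc in auto)
      then show ?thesis using sc m n by (simp add: ext_vector_def)
    qed
    show "ext_vector R M (r \<odot>\<^bsub>M\<^esub> m) = ext_scalar R M r \<otimes>\<^bsub>?E\<^esub> ext_vector R M m" if r: "r \<in> carrier R" for r
    proof -
      have "?cls (single R [r \<odot>\<^bsub>M\<^esub> m] \<one>\<^bsub>R\<^esub>) = ?cls (single R [m] r)"
      proof (rule eq)
        show "single R [r \<odot>\<^bsub>M\<^esub> m] \<one>\<^bsub>R\<^esub> \<ominus>\<^bsub>?F\<^esub> single R [m] r \<in> ?I"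
          using m r I(2) unfolding ext_relations_def by blast
      qed (use m r sc in auto)
      also have "\<dots> = ?cls (single R [] r) \<otimes>\<^bsub>?E\<^esub> ?cls (single R [m] \<one>\<^bsub>R\<^esub>)"
        using r m sc sm[of r "\<one>\<^bsub>R\<^esub>" "[]" "[m]"] by (simp flip: c.hom_mult)
      finally show ?thesis by (simp add: ext_vector_def ext_scalar_def)
    qed
    show "ext_vector R M m \<otimes>\<^bsub>?E\<^esub> ext_vector R M m = \<zero>\<^bsub>?E\<^esub>"
    proof -
      have "single R [m, m] \<one>\<^bsub>R\<^esub> \<in> ?I" using m I(2) unfolding ext_relations_def by blast
      then show ?thesis using I0 sm[of "\<one>\<^bsub>R\<^esub>" "\<one>\<^bsub>R\<^esub>" "[m]" "[m]"] sc[of "[m]"] m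
        by (simp add: ext_vector_def flip: c.hom_mult)
    qed
  qed
  interpret r: ext_rep R M ?E "ext_scalar R M" "ext_vector R M" by (rule rep)
  let ?wp = "wprod ?E (ext_vector R M)"
  have wp1: "?cls (single R w \<one>\<^bsub>R\<^esub>) = ?wp w" if "w \<in> words M" for w
    using that
  proof (induction w)
    case Nil
    then show ?case using c.hom_one by (simp add: free_alg_simps)
  next
    case (Cons m w)
    then have "?wp (m # w) = ?cls (single R [m] \<one>\<^bsub>R\<^esub>) \<otimes>\<^bsub>?E\<^esub> ?cls (single R w \<one>\<^bsub>R\<^esub>)"
      unfolding ext_vector_def[of R M m, symmetric] by simp
    also have "\<dots> = ?cls (single R [m] \<one>\<^bsub>R\<^esub> \<otimes>\<^bsub>?F\<^esub> single R w \<one>\<^bsub>R\<^esub>)"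
      using Cons.prems by (intro c.hom_mult[symmetric] sc) (auto simp: words_def)
    finally show ?case using sm[of "\<one>\<^bsub>R\<^esub>" "\<one>\<^bsub>R\<^esub>" "[m]" w] by simp
  qed
  have wp: "?cls (single R w r) = ext_scalar R M r \<otimes>\<^bsub>?E\<^esub> ?wp w" if "w \<in> words M" "r \<in> carrier R" for w r
  proof -
    have "ext_scalar R M r \<otimes>\<^bsub>?E\<^esub> ?wp w = ?cls (single R [] r \<otimes>\<^bsub>?F\<^esub> single R w \<one>\<^bsub>R\<^esub>)"
      unfolding wp1[OF that(1), symmetric] ext_scalar_def
      using that by (intro c.hom_mult[symmetric] sc) (auto simp: words_def)
    then show ?thesis using sm[OF that(2) M.R.one_closed, of "[]" w] that by simp
  qed
  show "?cls ` carrier (fs_module R {w \<in> words M. length w \<in> L}) = r.WS L" for L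
  proof (intro equalityI subsetI)
    fix a assume "a \<in> ?cls ` carrier (fs_module R {w \<in> words M. length w \<in> L})"
    then obtain p where p: "p \<in> carrier (fs_module R {w \<in> words M. length w \<in> L})" "a = ?cls p" by auto
    have "?cls p \<in> r.WS L" using p(1)
    proof (induction rule: M.R.fs_module_induct)
      case zero
      then show ?case using wspan.zero c.hom_zero by (simp add: z)
    next
      case (step w s p)
      have c: "single R w s \<in> carrier ?F" "p \<in> carrier ?F"
        using step sc by (auto simp: words_def free_alg_simps(1) fs_module_def)
      have "?cls (single R w s \<oplus>\<^bsub>?F\<^esub> p) = ext_scalar R M s \<otimes>\<^bsub>?E\<^esub> ?wp w \<oplus>\<^bsub>?E\<^esub> ?cls p"
        using step c by (simp add: wp)
      then show ?case using step by (simp add: wspan.step free_alg_simps(2) fs_module_def)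
    qed
    then show "a \<in> r.WS L" using p by simp
  next
    fix a assume "a \<in> r.WS L"
    then show "a \<in> ?cls ` carrier (fs_module R {w \<in> words M. length w \<in> L})"
    proof induction
      case zero
      have "\<zero>\<^bsub>?F\<^esub> \<in> carrier (fs_module R {w \<in> words M. length w \<in> L})"
        by (simp add: free_alg_simps fs_module_def)
      from imageI[OF this, of ?cls] show ?case unfolding c.hom_zero .
    next
      case (step r w y)
      let ?U = "fs_module R {w \<in> words M. length w \<in> L}"
      interpret U: module R ?U by (rule M.R.fs_module_module)
      obtain p where p: "p \<in> carrier ?U" "y = ?cls p" using step by auto
      have s: "single R w r \<in> carrier ?U" using step by (intro M.R.single_closed) auto
      have c: "single R w r \<in> carrier ?F" "p \<in> carrier ?F"
        using step sc p by (auto simp: words_def free_alg_simps(1) fs_module_def)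
      have "ext_scalar R M r \<otimes>\<^bsub>?E\<^esub> ?wp w \<oplus>\<^bsub>?E\<^esub> y = ?cls (single R w r \<oplus>\<^bsub>?F\<^esub> p)"
        using step c p by (simp add: wp)
      moreover have "single R w r \<oplus>\<^bsub>?F\<^esub> p \<in> carrier ?U"
        using U.M.a_closed[OF s p(1)] by (simp add: free_alg_simps(2) fs_module_def)
      ultimately show ?case by blast
    qed
  qed
qed

lemma exterior_algebra_parts:
  fixes R :: "('k, 'r, 'c) module_scheme"
  assumes R: "cring R" and M: "module R M"
  shows "carrier (exterior_algebra R M) = wspan R M (exterior_algebra R M) (ext_scalar R M) (ext_vector R M) UNIV"
    and "even_part (exterior_algebra R M) = wspan R M (exterior_algebra R M) (ext_scalar R M) (ext_vector R M) {n. even n}"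
    and "odd_part (exterior_algebra R M) = wspan R M (exterior_algebra R M) (ext_scalar R M) (ext_vector R M) {n. odd n}"
  unfolding exterior_algebra_rep(2)[OF R M, symmetric]
  by (simp_all add: exterior_algebra_ring(3)[OF R M] free_alg_simps(1))
    (simp_all add: exterior_algebra_def quot_superalgebra_def free_alg_simps(6,7))

text \<open>The field acts on coefficients, which is convolution with a scalar of degree zero. The
  union over representatives in the quotient collapses because this product depends on the class
  only.\<close>

lemma exterior_algebra_smult:
  assumes KR: "algebra K R" and M: "module R M"
    and c: "c \<in> carrier K" and a: "a \<in> carrier (exterior_algebra R M)"
  shows "c \<odot>\<^bsub>exterior_algebra R M\<^esub> a = ext_scalar R M (c \<odot>\<^bsub>R\<^esub> \<one>\<^bsub>R\<^esub>) \<otimes>\<^bsub>exterior_algebra R M\<^esub> a"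
proof -
  let ?F = "free_alg R M" and ?I = "ext_ideal R M" and ?E = "exterior_algebra R M"
  let ?cls = "\<lambda>p. ?I +>\<^bsub>?F\<^esub> p"
  have sE: "c \<odot>\<^bsub>?E\<^esub> Y = (\<Union>q\<in>Y. ?cls (c \<odot>\<^bsub>?F\<^esub> q))" for Y
    unfolding exterior_algebra_def quot_superalgebra_def by simp
  interpret R: cring R by (rule algebra.M_cring[OF KR])
  interpret KR: algebra K R by fact
  interpret F: ring ?F by (rule free_alg_ring[OF R.is_cring])
  note I = ext_ideal_ideal[OF R.is_cring M]
  note Lam = exterior_algebra_ring[OF R.is_cring M]
  interpret I: ideal ?I ?F by (rule I(1))
  interpret E: ring ?E by (rule Lam(1))
  interpret h: ring_hom_ring ?F ?E ?cls by (rule ring_hom_ringI2[OF F.ring_axioms Lam(1,2)])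
  have cR: "c \<odot>\<^bsub>R\<^esub> \<one>\<^bsub>R\<^esub> \<in> carrier R" using c KR.smult_closed R.one_closed by blast
  have sc: "single R [] (c \<odot>\<^bsub>R\<^esub> \<one>\<^bsub>R\<^esub>) \<in> carrier ?F"
    unfolding free_alg_simps using R.single_closed[of "[]" "words M"] cR by (simp add: words_def)
  obtain p where p: "p \<in> carrier ?F" "a = ?cls p" using a unfolding Lam(3) by blast
  have eq: "?cls (c \<odot>\<^bsub>?F\<^esub> q) = ext_scalar R M (c \<odot>\<^bsub>R\<^esub> \<one>\<^bsub>R\<^esub>) \<otimes>\<^bsub>?E\<^esub> ?cls q" if q: "q \<in> carrier ?F" for q
  proof -
    have r: "range q \<subseteq> carrier R" using q fs_module_range by (simp add: free_alg_simps(1))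
    have "(\<lambda>v. (c \<odot>\<^bsub>R\<^esub> \<one>\<^bsub>R\<^esub>) \<otimes>\<^bsub>R\<^esub> single R [] \<one>\<^bsub>R\<^esub> v) = single R [] (c \<odot>\<^bsub>R\<^esub> \<one>\<^bsub>R\<^esub>)"
      using cR by (auto simp: single_def)
    then have "conv R (single R [] (c \<odot>\<^bsub>R\<^esub> \<one>\<^bsub>R\<^esub>)) q w = (c \<odot>\<^bsub>R\<^esub> \<one>\<^bsub>R\<^esub>) \<otimes>\<^bsub>R\<^esub> q w" for w
      using R.conv_smult_left[OF R.range_single[OF R.one_closed] r cR] R.conv_one_left[OF r] by metis
    moreover have "(c \<odot>\<^bsub>R\<^esub> \<one>\<^bsub>R\<^esub>) \<otimes>\<^bsub>R\<^esub> q w = c \<odot>\<^bsub>R\<^esub> q w" for w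
    proof -
      have "q w \<in> carrier R" using r by auto
      then show ?thesis using KR.smult_assoc2[OF c R.one_closed] by simp
    qed
    ultimately have "c \<odot>\<^bsub>?F\<^esub> q = single R [] (c \<odot>\<^bsub>R\<^esub> \<one>\<^bsub>R\<^esub>) \<otimes>\<^bsub>?F\<^esub> q"
      by (simp add: free_alg_smult free_alg_simps fun_eq_iff)
    then show ?thesis using h.hom_mult[OF sc q] by (simp add: ext_scalar_def)
  qed
  have "?cls (c \<odot>\<^bsub>?F\<^esub> q) = ext_scalar R M (c \<odot>\<^bsub>R\<^esub> \<one>\<^bsub>R\<^esub>) \<otimes>\<^bsub>?E\<^esub> a" if q: "q \<in> ?cls p" for q
    using eq[OF I.a_elemrcos_carrier[OF p(1) q]] I.a_repr_independence'[OF q p(1)] p(2) by simp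
  moreover have "?cls p \<noteq> {}" using I.a_rcos_self[OF p(1)] by blast
  ultimately have "(\<Union>q\<in>?cls p. ?cls (c \<odot>\<^bsub>?F\<^esub> q)) = ext_scalar R M (c \<odot>\<^bsub>R\<^esub> \<one>\<^bsub>R\<^esub>) \<otimes>\<^bsub>?E\<^esub> a"
    by (intro SUP_eq_const)
  then show ?thesis by (simp only: sE p(2)[symmetric])
qed

section \<open>Nilpotency and unipotent endomorphisms\<close>

context ext_rep
begin

text \<open>Polarisation of \<open>g_sq\<close>, applied to the sum of \<open>m\<close> and
  \<open>n\<close>.\<close>

lemma g_anticomm:
  assumes "m \<in> carrier M" "n \<in> carrier M"
  shows "g m \<otimes>\<^bsub>S\<^esub> g n = \<ominus>\<^bsub>S\<^esub> (g n \<otimes>\<^bsub>S\<^esub> g m)"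
proof -
  have "g (m \<oplus>\<^bsub>M\<^esub> n) \<otimes>\<^bsub>S\<^esub> g (m \<oplus>\<^bsub>M\<^esub> n) = g m \<otimes>\<^bsub>S\<^esub> g n \<oplus>\<^bsub>S\<^esub> g n \<otimes>\<^bsub>S\<^esub> g m"
    using assms g_sq[OF assms(1)] g_sq[OF assms(2)] by (simp add: g_add S.l_distr S.r_distr S.a_comm)
  then have "g m \<otimes>\<^bsub>S\<^esub> g n \<oplus>\<^bsub>S\<^esub> g n \<otimes>\<^bsub>S\<^esub> g m = \<zero>\<^bsub>S\<^esub>" using g_sq[of "m \<oplus>\<^bsub>M\<^esub> n"] assms by simp
  then show ?thesis using assms by (intro S.minus_equality[symmetric]) auto
qed

text \<open>Each transposition contributes a sign. The total sign is left open, since only the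
  vanishing of products is deduced from it.\<close>

lemma wprod_anticomm:
  assumes "w \<in> words M" "m \<in> carrier M"
  shows "wprod S g w \<otimes>\<^bsub>S\<^esub> g m \<in> {g m \<otimes>\<^bsub>S\<^esub> wprod S g w, \<ominus>\<^bsub>S\<^esub> (g m \<otimes>\<^bsub>S\<^esub> wprod S g w)}"
  using assms(1)
proof (induction w)
  case (Cons n w)
  then have n: "n \<in> carrier M" "w \<in> words M" by auto
  have "wprod S g (n # w) \<otimes>\<^bsub>S\<^esub> g m = g n \<otimes>\<^bsub>S\<^esub> (wprod S g w \<otimes>\<^bsub>S\<^esub> g m)"
    using n assms(2) by (simp add: S.m_assoc)
  moreover have "g n \<otimes>\<^bsub>S\<^esub> (g m \<otimes>\<^bsub>S\<^esub> wprod S g w) = \<ominus>\<^bsub>S\<^esub> (g m \<otimes>\<^bsub>S\<^esub> wprod S g (n # w))"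
    using n assms(2) g_anticomm[OF n(1) assms(2)] by (simp add: S.m_assoc[symmetric] S.l_minus)
  ultimately show ?case using Cons.IH[OF n(2)] n assms(2) by (auto simp: S.r_minus)
qed (use assms(2) in simp)

text \<open>Behind a factor \<open>g x\<close> a letter \<open>a x + b\<close> may be replaced by
  \<open>b\<close>, because \<open>g x\<close> squares to zero; two anticommutations carry
  \<open>g x\<close> past \<open>g b\<close> to the remaining letters and back.\<close>

lemma wprod_eliminate:
  assumes w: "set w \<subseteq> ispan R M (carrier R) (insert x G)" and G: "insert x G \<subseteq> carrier M"
  shows "\<exists>v. set v \<subseteq> ispan R M (carrier R) G \<and> length v = length w \<and>
    g x \<otimes>\<^bsub>S\<^esub> wprod S g w = g x \<otimes>\<^bsub>S\<^esub> wprod S g v"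
  using w
proof (induction w)
  case (Cons y w)
  obtain v where v: "set v \<subseteq> ispan R M (carrier R) G" "length v = length w" "g x \<otimes>\<^bsub>S\<^esub> wprod S g w = g x \<otimes>\<^bsub>S\<^esub> wprod S g v"
    using Cons by auto
  obtain a b where ab: "a \<in> carrier R" "b \<in> ispan R M (carrier R) G" "y = a \<odot>\<^bsub>M\<^esub> x \<oplus>\<^bsub>M\<^esub> b"
    using M.ispan_insertD[OF M.R.oneideal G, of y] Cons.prems by auto
  have sp: "ispan R M (carrier R) G \<subseteq> carrier M" "ispan R M (carrier R) (insert x G) \<subseteq> carrier M"
    using M.ispan_closed[OF M.R.oneideal, of G] M.ispan_closed[OF M.R.oneideal G] G by auto
  have c: "b \<in> carrier M" "x \<in> carrier M" "v \<in> words M" "w \<in> words M"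
    using ab(2) sp G v(1) Cons.prems by (auto simp: words_def)
  have "g x \<otimes>\<^bsub>S\<^esub> wprod S g (y # w) = \<rho> a \<otimes>\<^bsub>S\<^esub> (g x \<otimes>\<^bsub>S\<^esub> g x) \<otimes>\<^bsub>S\<^esub> wprod S g w \<oplus>\<^bsub>S\<^esub> g x \<otimes>\<^bsub>S\<^esub> g b \<otimes>\<^bsub>S\<^esub> wprod S g w"
  proof -
    have "g x \<otimes>\<^bsub>S\<^esub> \<rho> a = \<rho> a \<otimes>\<^bsub>S\<^esub> g x" using \<rho>_central[of a "g x"] ab c by simp
    then have "g x \<otimes>\<^bsub>S\<^esub> (\<rho> a \<otimes>\<^bsub>S\<^esub> g x) = \<rho> a \<otimes>\<^bsub>S\<^esub> (g x \<otimes>\<^bsub>S\<^esub> g x)"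
      using ab c by (simp add: S.m_assoc[symmetric])
    then have "g x \<otimes>\<^bsub>S\<^esub> g y = \<rho> a \<otimes>\<^bsub>S\<^esub> (g x \<otimes>\<^bsub>S\<^esub> g x) \<oplus>\<^bsub>S\<^esub> g x \<otimes>\<^bsub>S\<^esub> g b"
      using ab c by (simp add: g_add g_smult S.r_distr)
    moreover have "g x \<otimes>\<^bsub>S\<^esub> wprod S g (y # w) = g x \<otimes>\<^bsub>S\<^esub> g y \<otimes>\<^bsub>S\<^esub> wprod S g w"
      using ab c by (simp add: S.m_assoc)
    ultimately show ?thesis using ab c by (simp add: S.l_distr)
  qed
  also have "\<dots> = \<ominus>\<^bsub>S\<^esub> (g b \<otimes>\<^bsub>S\<^esub> (g x \<otimes>\<^bsub>S\<^esub> wprod S g w))"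
    using ab c g_sq[OF c(2)] g_anticomm[OF c(2,1)] by (simp add: S.m_assoc S.l_minus)
  also have "\<dots> = g x \<otimes>\<^bsub>S\<^esub> wprod S g (b # v)"
    unfolding v(3) using c g_anticomm[OF c(2,1)] by (simp add: S.m_assoc[symmetric] S.l_minus)
  finally show ?case using v ab by (intro exI[of _ "b # v"]) auto
qed simp

text \<open>Induction on the generators: a product can use a new generator \<open>x\<close> only
  once, since behind a factor \<open>g x\<close> the later occurrences of \<open>x\<close> drop out.
  The letters that remain form a word in the span of \<open>G\<close> that is still too
  long.\<close>

lemma wprod_eq_zero:
  assumes "finite G" "G \<subseteq> carrier M" "set w \<subseteq> ispan R M (carrier R) G" "card G < length w"
  shows "wprod S g w = \<zero>\<^bsub>S\<^esub>"
  using assms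
proof (induction G arbitrary: w)
  case empty
  then obtain m v where w: "w = m # v" "m \<in> ispan R M (carrier R) {}" "set v \<subseteq> ispan R M (carrier R) {}" by (cases w) auto
  have z: "n = \<zero>\<^bsub>M\<^esub>" if "n \<in> ispan R M (carrier R) {}" for n using that by (induction) auto
  then have "v \<in> words M" using w by (auto simp: words_def)
  then show ?case using w z g_zero by simp
next
  case (insert x G)
  let ?G = "ispan R M (carrier R) G" and ?G' = "ispan R M (carrier R) (insert x G)"
  have xM: "x \<in> carrier M" "G \<subseteq> carrier M" using insert.prems by auto
  have sp: "?G \<subseteq> carrier M" "?G' \<subseteq> carrier M"
    using M.ispan_closed[OF M.R.oneideal xM(2)] M.ispan_closed[OF M.R.oneideal insert.prems(1)] by auto
  have IH: "wprod S g v = \<zero>\<^bsub>S\<^esub>" if "set v \<subseteq> ?G" "card G < length v" for v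
    using insert.IH[OF xM(2) that] .
  \<comment> \<open>\<open>us\<close> is the part of the word already free of \<open>x\<close>.
    Expanding the first letter \<open>a x + b\<close> of \<open>ys\<close> gives a term in which
    \<open>b\<close> joins \<open>us\<close> and a term with a factor \<open>g x\<close>. The bound
    is one more than the cardinality of \<open>insert x G\<close>.\<close>
  have "wprod S g (us @ ys) = \<zero>\<^bsub>S\<^esub>"
    if "set us \<subseteq> ?G" "set ys \<subseteq> ?G'" "card G + 2 \<le> length us + length ys" for us ys
    using that
  proof (induction ys arbitrary: us)
    case Nil
    then show ?case using IH[of us] by simp
  next
    case (Cons y ys)
    obtain a b where ab: "a \<in> carrier R" "b \<in> ?G" "y = a \<odot>\<^bsub>M\<^esub> x \<oplus>\<^bsub>M\<^esub> b"
      using M.ispan_insertD[OF M.R.oneideal insert.prems(1), of y] Cons.prems by auto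
    have c: "b \<in> carrier M" "us \<in> words M" "ys \<in> words M" using ab sp Cons.prems by (auto simp: words_def)
    have "wprod S g (us @ y # ys) = wprod S g us \<otimes>\<^bsub>S\<^esub> (\<rho> a \<otimes>\<^bsub>S\<^esub> g x \<oplus>\<^bsub>S\<^esub> g b) \<otimes>\<^bsub>S\<^esub> wprod S g ys"
      using ab c xM by (simp add: wprod_append g_add g_smult S.m_assoc)
    also have "\<dots> = wprod S g us \<otimes>\<^bsub>S\<^esub> \<rho> a \<otimes>\<^bsub>S\<^esub> (g x \<otimes>\<^bsub>S\<^esub> wprod S g ys) \<oplus>\<^bsub>S\<^esub> wprod S g ((us @ [b]) @ ys)"
      using ab c xM by (simp add: wprod_append S.m_assoc S.l_distr S.r_distr)
    also have "wprod S g ((us @ [b]) @ ys) = \<zero>\<^bsub>S\<^esub>"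
      by (rule Cons.IH) (use ab Cons.prems in auto)
    \<comment> \<open>The letters behind \<open>g x\<close> may be taken in the span of
      \<open>G\<close>; moving \<open>g x\<close> to the front, up to sign, joins \<open>us\<close>
      and \<open>v\<close> to a word of more than \<open>card G\<close> letters.\<close>
    also have "wprod S g us \<otimes>\<^bsub>S\<^esub> \<rho> a \<otimes>\<^bsub>S\<^esub> (g x \<otimes>\<^bsub>S\<^esub> wprod S g ys) = \<zero>\<^bsub>S\<^esub>"
    proof -
      obtain v where v: "set v \<subseteq> ?G" "length v = length ys" "g x \<otimes>\<^bsub>S\<^esub> wprod S g ys = g x \<otimes>\<^bsub>S\<^esub> wprod S g v"
        using wprod_eliminate[of ys x G] insert.prems(1) Cons.prems by auto
      have vw: "v \<in> words M" using v sp by (auto simp: words_def)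
      have "wprod S g us \<otimes>\<^bsub>S\<^esub> \<rho> a \<otimes>\<^bsub>S\<^esub> (g x \<otimes>\<^bsub>S\<^esub> wprod S g v) = \<rho> a \<otimes>\<^bsub>S\<^esub> (wprod S g us \<otimes>\<^bsub>S\<^esub> g x) \<otimes>\<^bsub>S\<^esub> wprod S g v"
        unfolding \<rho>_central[OF ab(1) wprod_closed[OF c(2)], symmetric]
        using ab c xM vw by (simp add: S.m_assoc)
      moreover have "wprod S g us \<otimes>\<^bsub>S\<^esub> g x \<otimes>\<^bsub>S\<^esub> wprod S g v = \<zero>\<^bsub>S\<^esub>"
      proof -
        have "wprod S g us \<otimes>\<^bsub>S\<^esub> wprod S g v = \<zero>\<^bsub>S\<^esub>"
          using IH[of "us @ v"] v Cons.prems c vw by (simp add: wprod_append)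
        then have "g x \<otimes>\<^bsub>S\<^esub> wprod S g us \<otimes>\<^bsub>S\<^esub> wprod S g v = \<zero>\<^bsub>S\<^esub>"
          using xM c vw by (simp add: S.m_assoc)
        then show ?thesis using wprod_anticomm[OF c(2) xM(1)] xM c vw by (auto simp: S.l_minus)
      qed
      ultimately show ?thesis unfolding v(3) using ab c xM vw by (simp add: S.m_assoc)
    qed
    finally show ?case by simp
  qed
  from this[of "[]" w] show ?case using insert.prems insert.hyps by simp
qed

lemma wspan_eq_zero:
  assumes "finite G" "G \<subseteq> carrier M" "ispan R M (carrier R) G = carrier M" "a \<in> WS {Suc (card G)..}"
  shows "a = \<zero>\<^bsub>S\<^esub>"
  using assms(4)
proof induction
  case (step r w y)
  then have "wprod S g w = \<zero>\<^bsub>S\<^esub>" using assms(1-3) by (intro wprod_eq_zero[of G]) (auto simp: words_def)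
  then show ?case using step by simp
qed simp

end

text \<open>If \<open>\<theta> a\<close> is zero, then \<open>a\<close> is the negative of
  \<open>\<theta> a - a\<close> and climbs through the filtration until it vanishes. Preimages come
  from descending induction: if \<open>\<theta> b = \<theta> a - a\<close>, then
  \<open>\<theta> (a - b) = a\<close>.\<close>

lemma (in abelian_group) unipotent_bij:
  assumes \<theta>: "\<And>a. a \<in> carrier G \<Longrightarrow> \<theta> a \<in> carrier G"
    and add: "\<And>a b. a \<in> carrier G \<Longrightarrow> b \<in> carrier G \<Longrightarrow> \<theta> (a \<oplus> b) = \<theta> a \<oplus> \<theta> b"
    and F0: "F (0::nat) = carrier G" and FN: "F N \<subseteq> {\<zero>}"
    and Fs: "\<And>p. F p \<subseteq> carrier G" and Fneg: "\<And>p a. a \<in> F p \<Longrightarrow> \<ominus> a \<in> F p"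
    and unip: "\<And>p a. a \<in> F p \<Longrightarrow> \<theta> a \<ominus> a \<in> F (Suc p)"
  shows "bij_betw \<theta> (carrier G) (carrier G)"
proof (rule bij_betwI')
  have z: "a = \<zero>" if a: "a \<in> carrier G" "\<theta> a = \<zero>" for a
  proof -
    have "a \<in> F p" for p
    proof (induction p)
      case (Suc p)
      have "\<ominus> (\<theta> a \<ominus> a) \<in> F (Suc p)" using Suc unip Fneg by blast
      then show ?case using a by (simp add: minus_eq)
    qed (use F0 a in simp)
    then show ?thesis using FN by blast
  qed
  have neg: "\<theta> (\<ominus> a) = \<ominus> \<theta> a" if "a \<in> carrier G" for a
  proof -
    have "\<theta> \<zero> = \<zero>" using add[of \<zero> \<zero>] \<theta>[of \<zero>] by (metis add.l_cancel_one l_zero zero_closed)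
    then have "\<theta> (\<ominus> a) \<oplus> \<theta> a = \<zero>" using add[of "\<ominus> a" a] that by (simp add: l_neg)
    then show ?thesis using \<theta> that by (intro minus_equality[symmetric]) auto
  qed
  fix a b assume ab: "a \<in> carrier G" "b \<in> carrier G"
  show "\<theta> a = \<theta> b \<longleftrightarrow> a = b"
  proof
    assume "\<theta> a = \<theta> b"
    then have "\<theta> (a \<oplus> \<ominus> b) = \<zero>" using add[of a "\<ominus> b"] neg ab \<theta> by (simp add: r_neg)
    then have "a \<oplus> \<ominus> b = \<zero>" using z ab by simp
    then show "a = b" using minus_eq_zero_iff[OF ab] by (simp add: minus_eq)
  qed simp
next
  \<comment> \<open>\<open>q\<close> counts the steps down from stage \<open>N\<close>, where at
    most zero is left, to stage zero, which is the whole group.\<close>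
  have "F (N - q) \<subseteq> \<theta> ` carrier G" if "q \<le> N" for q
    using that
  proof (induction q)
    case 0
    have "\<theta> \<zero> = \<zero>" using add[of \<zero> \<zero>] \<theta>[of \<zero>] by (metis add.l_cancel_one l_zero zero_closed)
    then have "\<zero> \<in> \<theta> ` carrier G" by (metis imageI zero_closed)
    then show ?case using FN by auto
  next
    case (Suc q)
    show ?case
    proof
      fix a assume a: "a \<in> F (N - Suc q)"
      then have "\<theta> a \<ominus> a \<in> F (N - q)" using unip[OF a] Suc.prems by (simp add: Suc_diff_Suc)
      then obtain b where b: "b \<in> carrier G" "\<theta> a \<ominus> a = \<theta> b" using Suc by auto
      have aG: "a \<in> carrier G" using a Fs by auto
      have nb: "\<theta> (\<ominus> b) = \<ominus> \<theta> b"
      proof -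
        have "\<theta> \<zero> = \<zero>" using add[of \<zero> \<zero>] \<theta>[of \<zero>] by (metis add.l_cancel_one l_zero zero_closed)
        then have "\<theta> (\<ominus> b) \<oplus> \<theta> b = \<zero>" using add[of "\<ominus> b" b] b by (simp add: l_neg)
        then show ?thesis using \<theta> b by (intro minus_equality[symmetric]) auto
      qed
      have "\<theta> (a \<oplus> \<ominus> b) = \<theta> a \<oplus> \<ominus> (\<theta> a \<ominus> a)" using add[of a "\<ominus> b"] nb b aG by simp
      also have "\<dots> = a" using aG \<theta> by (simp add: minus_eq minus_add r_neg2)
      finally show "a \<in> \<theta> ` carrier G" using aG b by (metis a_closed a_inv_closed imageI)
    qed
  qed
  from this[of N] show "\<exists>x\<in>carrier G. y = \<theta> x" if "y \<in> carrier G" for y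
    using that F0 by auto
qed (use \<theta> in auto)

text \<open>The telescope \<open>\<theta> (x y) - x y = (\<theta> x - x) (\<theta> y) + x (\<theta>
  y - y)\<close>, with \<open>x\<close> the first letter of a word: in each summand one factor gains
  a degree and the other loses none.\<close>

lemma (in ext_rep) unipotent_step:
  assumes \<theta>: "\<theta> \<in> ring_hom S S" and \<rho>: "\<And>r. r \<in> carrier R \<Longrightarrow> \<theta> (\<rho> r) = \<rho> r"
    and g2: "\<And>m. m \<in> carrier M \<Longrightarrow> \<theta> (g m) \<ominus>\<^bsub>S\<^esub> g m \<in> WS {2..}"
    and a: "a \<in> WS {p..}"
  shows "\<theta> a \<ominus>\<^bsub>S\<^esub> a \<in> WS {Suc p..}"
proof -
  interpret t: ring_hom_ring S S \<theta> by (rule ring_hom_ringI2[OF S.ring_axioms S.ring_axioms \<theta>])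
  have w: "\<theta> (wprod S g w) \<ominus>\<^bsub>S\<^esub> wprod S g w \<in> WS {Suc (length w)..}" if "w \<in> words M" for w
    using that
  proof (induction w)
    case Nil
    then show ?case using wspan.zero[of S R M \<rho> g] by (simp add: S.minus_eq S.r_neg)
  next
    case (Cons m w)
    then have m: "m \<in> carrier M" "w \<in> words M" by auto
    let ?d = "\<theta> (wprod S g w) \<ominus>\<^bsub>S\<^esub> wprod S g w" and ?e = "\<theta> (g m) \<ominus>\<^bsub>S\<^esub> g m"
    have d: "?d \<in> WS {Suc (length w)..}" using Cons m by simp
    have wl: "wprod S g w \<in> WS {length w..}" using wspan_single[of "\<one>\<^bsub>R\<^esub>" w "{length w..}"] m by simp
    have tw: "\<theta> (wprod S g w) \<in> WS {length w..}"
    proof -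
      have "\<theta> (wprod S g w) = ?d \<oplus>\<^bsub>S\<^esub> wprod S g w" using m by (simp add: S.minus_eq S.a_assoc S.l_neg)
      then show ?thesis using wspan_add[OF wspan_mono[OF _ d] wl] by simp
    qed
    have gm: "g m \<in> WS {1..}" using wspan_single[of "\<one>\<^bsub>R\<^esub>" "[m]" "{1..}"] m by simp
    have "\<theta> (wprod S g (m # w)) \<ominus>\<^bsub>S\<^esub> wprod S g (m # w) = ?e \<otimes>\<^bsub>S\<^esub> \<theta> (wprod S g w) \<oplus>\<^bsub>S\<^esub> g m \<otimes>\<^bsub>S\<^esub> ?d"
      using m by (simp add: S.minus_eq S.l_distr S.r_distr S.l_minus S.r_minus S.a_assoc S.r_neg1)
    moreover have "?e \<otimes>\<^bsub>S\<^esub> \<theta> (wprod S g w) \<in> WS {Suc (length (m # w))..}"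
      by (rule wspan_mult[OF g2[OF m(1)] tw]) auto
    moreover have "g m \<otimes>\<^bsub>S\<^esub> ?d \<in> WS {Suc (length (m # w))..}"
      by (rule wspan_mult[OF gm d]) auto
    ultimately show ?case using wspan_add by simp
  qed
  show ?thesis
    using a
  proof (induction rule: wspan_induct_add)
    case (single r w)
    have "\<theta> (\<rho> r \<otimes>\<^bsub>S\<^esub> wprod S g w) \<ominus>\<^bsub>S\<^esub> \<rho> r \<otimes>\<^bsub>S\<^esub> wprod S g w = \<rho> r \<otimes>\<^bsub>S\<^esub> (\<theta> (wprod S g w) \<ominus>\<^bsub>S\<^esub> wprod S g w)"
      using single \<rho> by (simp add: S.minus_eq S.r_distr S.r_minus)
    moreover have "{Suc (length w)..} \<subseteq> {Suc p..}" using single by auto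
    ultimately show ?case using wspan_smult[OF wspan_mono[OF _ w]] single by simp
  next
    case (add a b)
    have "\<theta> (a \<oplus>\<^bsub>S\<^esub> b) \<ominus>\<^bsub>S\<^esub> (a \<oplus>\<^bsub>S\<^esub> b) = (\<theta> a \<ominus>\<^bsub>S\<^esub> a) \<oplus>\<^bsub>S\<^esub> (\<theta> b \<ominus>\<^bsub>S\<^esub> b)"
      using add wspan_closed by (simp add: S.minus_eq S.minus_add S.a_assoc S.a_lcomm)
    then show ?case using add wspan_add by simp
  next
    case zero
    then show ?case using wspan.zero[of S R M \<rho> g] by (simp add: S.minus_eq)
  qed
qed

lemma (in ext_rep) unipotent_iso:
  assumes \<theta>: "\<theta> \<in> ring_hom S S" and \<rho>: "\<And>r. r \<in> carrier R \<Longrightarrow> \<theta> (\<rho> r) = \<rho> r"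
    and g2: "\<And>m. m \<in> carrier M \<Longrightarrow> \<theta> (g m) \<ominus>\<^bsub>S\<^esub> g m \<in> WS {2..}"
    and G: "finite G" "G \<subseteq> carrier M" "ispan R M (carrier R) G = carrier M"
    and gen: "WS UNIV = carrier S"
  shows "bij_betw \<theta> (carrier S) (carrier S)"
\<comment> \<open>Products of more than \<open>card G\<close> letters vanish, which ends the
  filtration at \<open>Suc (card G)\<close>.\<close>
proof (rule S.unipotent_bij[where F = "\<lambda>p. WS {p..}" and N = "Suc (card G)"])
  show "WS {0..} = carrier S" using gen by (simp add: atLeast_0)
  show "WS {Suc (card G)..} \<subseteq> {\<zero>\<^bsub>S\<^esub>}" using wspan_eq_zero[OF G] by auto
  show "\<theta> a \<ominus>\<^bsub>S\<^esub> a \<in> WS {Suc p..}" if "a \<in> WS {p..}" for p a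
    by (rule unipotent_step[OF \<theta> \<rho> g2 that])
qed (use \<theta> wspan_closed wspan_a_inv in \<open>auto simp: ring_hom_def\<close>)

section \<open>The terms of degree zero and one\<close>

text \<open>The homomorphism from the exterior algebra to the square-zero extension of \<open>R\<close> by \<open>M\<close> reads off
  the terms of degree at most one.\<close>

definition sqz :: "('r, 'c) ring_scheme \<Rightarrow> ('r, 'm, 'd) module_scheme \<Rightarrow> ('r \<times> 'm) ring"
  where "sqz R M = \<lparr>carrier = carrier R \<times> carrier M,
    monoid.mult = (\<lambda>(r, m) (s, n). (r \<otimes>\<^bsub>R\<^esub> s, r \<odot>\<^bsub>M\<^esub> n \<oplus>\<^bsub>M\<^esub> s \<odot>\<^bsub>M\<^esub> m)),
    one = (\<one>\<^bsub>R\<^esub>, \<zero>\<^bsub>M\<^esub>), ring.zero = (\<zero>\<^bsub>R\<^esub>, \<zero>\<^bsub>M\<^esub>),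
    add = (\<lambda>(r, m) (s, n). (r \<oplus>\<^bsub>R\<^esub> s, m \<oplus>\<^bsub>M\<^esub> n))\<rparr>"

context module
begin

lemma sqz_ring: "ring (sqz R M)"
proof (rule ringI)
  show "abelian_group (sqz R M)"
  proof (rule abelian_groupI)
    fix x assume "x \<in> carrier (sqz R M)"
    then show "\<exists>y\<in>carrier (sqz R M). y \<oplus>\<^bsub>sqz R M\<^esub> x = \<zero>\<^bsub>sqz R M\<^esub>"
      by (intro bexI[of _ "(\<ominus> fst x, \<ominus>\<^bsub>M\<^esub> snd x)"]) (auto simp: sqz_def R.l_neg M.l_neg)
  next
    show "x \<oplus>\<^bsub>sqz R M\<^esub> y = y \<oplus>\<^bsub>sqz R M\<^esub> x" if "x \<in> carrier (sqz R M)" "y \<in> carrier (sqz R M)" for x y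
      using that by (auto simp: sqz_def R.a_comm M.a_comm)
  qed (auto simp: sqz_def R.a_assoc M.a_assoc)
  show "Group.monoid (sqz R M)"
  proof (rule monoidI)
    fix x y z assume "x \<in> carrier (sqz R M)" "y \<in> carrier (sqz R M)" "z \<in> carrier (sqz R M)"
    then obtain r m s n t k where "x = (r, m)" "y = (s, n)" "z = (t, k)"
      "r \<in> carrier R" "s \<in> carrier R" "t \<in> carrier R" "m \<in> carrier M" "n \<in> carrier M" "k \<in> carrier M"
      by (auto simp: sqz_def)
    then show "x \<otimes>\<^bsub>sqz R M\<^esub> y \<otimes>\<^bsub>sqz R M\<^esub> z = x \<otimes>\<^bsub>sqz R M\<^esub> (y \<otimes>\<^bsub>sqz R M\<^esub> z)"
      by (simp add: sqz_def R.m_assoc smult_r_distr smult_assoc1[symmetric] M.a_assoc R.m_comm[of t])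
  qed (auto simp: sqz_def)
qed (auto simp: sqz_def R.l_distr R.r_distr smult_l_distr smult_r_distr M.a_assoc M.a_lcomm)

end

lemma sqz_rep:
  fixes R :: "('k, 'r, 'c) module_scheme"
  assumes "module R M"
  shows "ext_rep R M (sqz R M) (\<lambda>r. (r, \<zero>\<^bsub>M\<^esub>)) (\<lambda>m. (\<zero>\<^bsub>R\<^esub>, m))"
proof -
  interpret module R M by fact
  show ?thesis
  proof (intro ext_rep.intro ext_rep_axioms.intro assms sqz_ring)
    show "(\<lambda>r. (r, \<zero>\<^bsub>M\<^esub>)) \<in> ring_hom R (sqz R M)"
      by (rule ring_hom_memI) (auto simp: sqz_def)
  qed (auto simp: sqz_def R.m_comm)
qed

text \<open>Generation by words gives every element a decomposition by degree; \<open>Q\<close>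
  makes its terms of degree zero and one unique.\<close>

locale ext_alg = ext_rep R M S \<rho> g
  for R :: "('k, 'r, 'c) module_scheme" and M :: "('r, 'm, 'd) module_scheme" and S :: "('s, 'e) ring_scheme"
    and \<rho> :: "'r \<Rightarrow> 's" and g :: "'m \<Rightarrow> 's" +
  fixes Q :: "'s \<Rightarrow> 'r \<times> 'm"
  assumes gen: "wspan R M S \<rho> g UNIV = carrier S"
    and Q_hom: "Q \<in> ring_hom S (sqz R M)"
    and Q_\<rho>: "r \<in> carrier R \<Longrightarrow> Q (\<rho> r) = (r, \<zero>\<^bsub>M\<^esub>)"
    and Q_g: "m \<in> carrier M \<Longrightarrow> Q (g m) = (\<zero>\<^bsub>R\<^esub>, m)"
begin

definition "deg0 a = fst (Q a)"
definition "deg1 a = snd (Q a)"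

lemma deg_simps [simp]:
  "a \<in> carrier S \<Longrightarrow> deg0 a \<in> carrier R"
  "a \<in> carrier S \<Longrightarrow> deg1 a \<in> carrier M"
  "a \<in> carrier S \<Longrightarrow> b \<in> carrier S \<Longrightarrow> deg0 (a \<oplus>\<^bsub>S\<^esub> b) = deg0 a \<oplus>\<^bsub>R\<^esub> deg0 b"
  "a \<in> carrier S \<Longrightarrow> b \<in> carrier S \<Longrightarrow> deg1 (a \<oplus>\<^bsub>S\<^esub> b) = deg1 a \<oplus>\<^bsub>M\<^esub> deg1 b"
  "a \<in> carrier S \<Longrightarrow> b \<in> carrier S \<Longrightarrow> deg0 (a \<otimes>\<^bsub>S\<^esub> b) = deg0 a \<otimes>\<^bsub>R\<^esub> deg0 b"
  "a \<in> carrier S \<Longrightarrow> b \<in> carrier S \<Longrightarrow> deg1 (a \<otimes>\<^bsub>S\<^esub> b) = deg0 a \<odot>\<^bsub>M\<^esub> deg1 b \<oplus>\<^bsub>M\<^esub> deg0 b \<odot>\<^bsub>M\<^esub> deg1 a"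
  "r \<in> carrier R \<Longrightarrow> deg0 (\<rho> r) = r" "r \<in> carrier R \<Longrightarrow> deg1 (\<rho> r) = \<zero>\<^bsub>M\<^esub>"
  "m \<in> carrier M \<Longrightarrow> deg0 (g m) = \<zero>\<^bsub>R\<^esub>" "m \<in> carrier M \<Longrightarrow> deg1 (g m) = m"
  using ring_hom_memE[OF Q_hom] Q_\<rho> Q_g
  by (auto simp: deg0_def deg1_def sqz_def mem_Times_iff split: prod.splits)

lemma deg_zero [simp]: "deg0 \<zero>\<^bsub>S\<^esub> = \<zero>\<^bsub>R\<^esub>" "deg1 \<zero>\<^bsub>S\<^esub> = \<zero>\<^bsub>M\<^esub>"
  using deg_simps(7,8)[of "\<zero>\<^bsub>R\<^esub>"] by simp_all

lemma deg_one [simp]: "deg0 \<one>\<^bsub>S\<^esub> = \<one>\<^bsub>R\<^esub>" "deg1 \<one>\<^bsub>S\<^esub> = \<zero>\<^bsub>M\<^esub>"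
  using deg_simps(7,8)[of "\<one>\<^bsub>R\<^esub>"] by simp_all

lemma deg_a_inv [simp]:
  assumes "a \<in> carrier S"
  shows "deg0 (\<ominus>\<^bsub>S\<^esub> a) = \<ominus>\<^bsub>R\<^esub> deg0 a" "deg1 (\<ominus>\<^bsub>S\<^esub> a) = \<ominus>\<^bsub>M\<^esub> deg1 a"
  using deg_simps(3,4)[of "\<ominus>\<^bsub>S\<^esub> a" a] assms
  by (simp_all add: S.l_neg M.R.minus_equality M.M.minus_equality)

lemma deg0_hom: "deg0 \<in> ring_hom S R"
  by (rule ring_hom_memI) auto

lemma deg0_wspan: "a \<in> WS L \<Longrightarrow> 0 \<notin> L \<Longrightarrow> deg0 a = \<zero>\<^bsub>R\<^esub>"
proof (induction rule: wspan_induct_add)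
  case (single r w)
  then obtain m v where "w = m # v" "m \<in> carrier M" "v \<in> words M" by (cases w) auto
  then show ?case using single by simp
qed (use wspan_closed in auto)

lemma deg1_wspan: "a \<in> WS L \<Longrightarrow> 1 \<notin> L \<Longrightarrow> deg1 a = \<zero>\<^bsub>M\<^esub>"
proof (induction rule: wspan_induct_add)
  case (single r w)
  show ?case
  proof (cases w)
    case (Cons m v)
    then obtain n t where "v = n # t" using single by (cases v) auto
    then show ?thesis using single Cons by simp
  qed (use single in simp)
qed (use wspan_closed in auto)

lemma decompose:
  assumes a: "a \<in> carrier S"
  shows "\<exists>f\<in>WS {2..}. a = \<rho> (deg0 a) \<oplus>\<^bsub>S\<^esub> g (deg1 a) \<oplus>\<^bsub>S\<^esub> f"
proof -
  have U: "UNIV = ({0} \<union> {1}) \<union> {2::nat..}" by auto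
  obtain b f where b: "b \<in> WS ({0} \<union> {1})" "f \<in> WS {2..}" "a = b \<oplus>\<^bsub>S\<^esub> f"
    using wspan_Un[of a "{0} \<union> {1}" "{2..}"] a gen U by auto
  then obtain c d where c: "c \<in> WS {0}" "d \<in> WS {1}" "b = c \<oplus>\<^bsub>S\<^esub> d" using wspan_Un by blast
  obtain r m where rm: "r \<in> carrier R" "c = \<rho> r" "m \<in> carrier M" "d = g m"
    using c wspan_0 wspan_1 by auto
  have f: "f \<in> carrier S" "deg0 f = \<zero>\<^bsub>R\<^esub>" "deg1 f = \<zero>\<^bsub>M\<^esub>"
    using b(2) wspan_closed deg0_wspan deg1_wspan by auto
  have "a = \<rho> r \<oplus>\<^bsub>S\<^esub> g m \<oplus>\<^bsub>S\<^esub> f" using b c rm by simp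
  moreover from this have "deg0 a = r" "deg1 a = m" using rm f by simp_all
  ultimately show ?thesis using b(2) by auto
qed

end

section \<open>Everywhere vanishing odd vector fields\<close>

text \<open>The algebra \<open>A\<close> with the structure of an exterior algebra of \<open>E\<close> over \<open>R\<close>, given by
  \<open>s : R \<rightarrow> A\<close> and \<open>j : E \<rightarrow> A\<close>.\<close>

locale odd_field = ext_alg R E A s j Q
  for K :: "'k ring" and R :: "('k, 'r, 'c) module_scheme" and E :: "('r, 'm, 'd) module_scheme"
    and A :: "('k, 'a) superalgebra" and s :: "'r \<Rightarrow> 'a" and j :: "'m \<Rightarrow> 'a" and Q :: "'a \<Rightarrow> 'r \<times> 'm" +
  fixes u :: "'a \<Rightarrow> 'a"
  assumes K: "algebraically_closed K"
    and char0: "\<And>n::nat. [n] \<cdot>\<^bsub>K\<^esub> \<one>\<^bsub>K\<^esub> = \<zero>\<^bsub>K\<^esub> \<Longrightarrow> n = 0"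
    and KR: "algebra K R" and fg: "fin_gen_algebra K R" and proj: "fg_projective R E"
    and A: "superalgebra K A"
    and even: "even_part A = wspan R E A s j {n. even n}"
    and odd: "odd_part A = wspan R E A s j {n. odd n}"
    and smult: "\<And>c a. c \<in> carrier K \<Longrightarrow> a \<in> carrier A \<Longrightarrow> c \<odot>\<^bsub>A\<^esub> a = s (c \<odot>\<^bsub>R\<^esub> \<one>\<^bsub>R\<^esub>) \<otimes>\<^bsub>A\<^esub> a"
    and u: "odd_superderivation K A u" and u2: "homological A u"
    and vanish: "everywhere_vanishing K A u"
    and bij: "\<And>x. x \<in> points K A \<Longrightarrow> bij_betw (cotangent_map K A u x)
      (even_part (cotangent_space K A x)) (odd_part (cotangent_space K A x))"
begin

lemma K_field: "field K"
  using K unfolding algebraically_closed_def by simp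

lemma K_ring: "ring K"
  using K_field by (simp add: field.is_ring field_def domain_def cring_def)

lemma scalar_closed: "c \<in> carrier K \<Longrightarrow> c \<odot>\<^bsub>R\<^esub> \<one>\<^bsub>R\<^esub> \<in> carrier R"
  using KR module.smult_closed[of K R c "\<one>\<^bsub>R\<^esub>"] by (simp add: algebra_def)

lemma R_smult: "c \<in> carrier K \<Longrightarrow> r \<in> carrier R \<Longrightarrow> c \<odot>\<^bsub>R\<^esub> r = (c \<odot>\<^bsub>R\<^esub> \<one>\<^bsub>R\<^esub>) \<otimes>\<^bsub>R\<^esub> r"
  using algebra.smult_assoc2[OF KR, of c "\<one>\<^bsub>R\<^esub>" r] by simp

lemma parts_closed: "a \<in> even_part A \<Longrightarrow> a \<in> carrier A" "a \<in> odd_part A \<Longrightarrow> a \<in> carrier A"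
  unfolding even odd using wspan_closed by auto

lemma parts_sum: "a \<in> carrier A \<Longrightarrow> \<exists>b\<in>even_part A. \<exists>c\<in>odd_part A. a = b \<oplus>\<^bsub>A\<^esub> c"
proof -
  assume "a \<in> carrier A"
  moreover have "even_part A <+>\<^bsub>A\<^esub> odd_part A = carrier A" using A unfolding superalgebra_def by simp
  ultimately have "a \<in> even_part A <+>\<^bsub>A\<^esub> odd_part A" by simp
  then show ?thesis unfolding set_add_def' by blast
qed

lemma s_even: "r \<in> carrier R \<Longrightarrow> s r \<in> even_part A"
  unfolding even using wspan_single[of r "[]" "{n. even n}"] by simp

lemma j_odd: "e \<in> carrier E \<Longrightarrow> j e \<in> odd_part A"
  unfolding odd using wspan_single[of "\<one>\<^bsub>R\<^esub>" "[e]" "{n. odd n}"] by simp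

lemma odd_deg0: "a \<in> odd_part A \<Longrightarrow> deg0 a = \<zero>\<^bsub>R\<^esub>"
  unfolding odd by (rule deg0_wspan) auto

lemma even_deg1: "a \<in> even_part A \<Longrightarrow> deg1 a = \<zero>\<^bsub>E\<^esub>"
  unfolding even by (rule deg1_wspan) auto

text \<open>Supercommutativity gives only that twice the square vanishes; two is invertible in
  \<open>K\<close> by \<open>char0\<close>. This supplies the relation \<open>g_sq\<close> for the
  map \<open>h\<close>.\<close>

lemma odd_square: "a \<in> odd_part A \<Longrightarrow> a \<otimes>\<^bsub>A\<^esub> a = \<zero>\<^bsub>A\<^esub>"
proof -
  assume a: "a \<in> odd_part A"
  interpret K: field K by (rule K_field)
  interpret KA: module K A using A by (simp add: superalgebra_def)
  have aA: "a \<in> carrier A" "a \<otimes>\<^bsub>A\<^esub> a \<in> carrier A" using a parts_closed by auto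
  have "a \<otimes>\<^bsub>A\<^esub> a = \<ominus>\<^bsub>A\<^esub> (a \<otimes>\<^bsub>A\<^esub> a)" using A a unfolding superalgebra_def by blast
  then have d: "a \<otimes>\<^bsub>A\<^esub> a \<oplus>\<^bsub>A\<^esub> a \<otimes>\<^bsub>A\<^esub> a = \<zero>\<^bsub>A\<^esub>" using S.l_neg[OF aA(2)] by simp
  define t where "t = \<one>\<^bsub>K\<^esub> \<oplus>\<^bsub>K\<^esub> \<one>\<^bsub>K\<^esub>"
  have "t = [(2::nat)] \<cdot>\<^bsub>K\<^esub> \<one>\<^bsub>K\<^esub>" by (simp add: t_def numeral_2_eq_2)
  then have "t \<noteq> \<zero>\<^bsub>K\<^esub>" using char0[of 2] by auto
  then have t: "t \<in> carrier K" "inv\<^bsub>K\<^esub> t \<in> carrier K" "inv\<^bsub>K\<^esub> t \<otimes>\<^bsub>K\<^esub> t = \<one>\<^bsub>K\<^esub>"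
    using K.field_Units K.Units_l_inv[of t] K.Units_inv_closed[of t] by (auto simp: t_def)
  have "t \<odot>\<^bsub>A\<^esub> (a \<otimes>\<^bsub>A\<^esub> a) = \<zero>\<^bsub>A\<^esub>" using d aA by (simp add: t_def KA.smult_l_distr)
  then have "inv\<^bsub>K\<^esub> t \<odot>\<^bsub>A\<^esub> (t \<odot>\<^bsub>A\<^esub> (a \<otimes>\<^bsub>A\<^esub> a)) = \<zero>\<^bsub>A\<^esub>" using t by simp
  then show ?thesis using t aA KA.smult_assoc1[OF t(2,1) aA(2)] by simp
qed

lemma u_simps:
  "a \<in> carrier A \<Longrightarrow> u a \<in> carrier A"
  "a \<in> carrier A \<Longrightarrow> b \<in> carrier A \<Longrightarrow> u (a \<oplus>\<^bsub>A\<^esub> b) = u a \<oplus>\<^bsub>A\<^esub> u b"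
  "c \<in> carrier K \<Longrightarrow> a \<in> carrier A \<Longrightarrow> u (c \<odot>\<^bsub>A\<^esub> a) = c \<odot>\<^bsub>A\<^esub> u a"
  "a \<in> even_part A \<Longrightarrow> u a \<in> odd_part A" "a \<in> odd_part A \<Longrightarrow> u a \<in> even_part A"
  "a \<in> even_part A \<Longrightarrow> b \<in> carrier A \<Longrightarrow> u (a \<otimes>\<^bsub>A\<^esub> b) = u a \<otimes>\<^bsub>A\<^esub> b \<oplus>\<^bsub>A\<^esub> a \<otimes>\<^bsub>A\<^esub> u b"
  "a \<in> odd_part A \<Longrightarrow> b \<in> carrier A \<Longrightarrow> u (a \<otimes>\<^bsub>A\<^esub> b) = u a \<otimes>\<^bsub>A\<^esub> b \<ominus>\<^bsub>A\<^esub> a \<otimes>\<^bsub>A\<^esub> u b"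
  "a \<in> carrier A \<Longrightarrow> u (u a) = \<zero>\<^bsub>A\<^esub>"
  using u u2 unfolding odd_superderivation_def linear_map_def homological_def by (auto simp: image_subset_iff)

text \<open>The left factor \<open>s f\<close> is even, so the Leibniz rule carries no sign, and
  centrality of \<open>s\<close> brings its other term into the form of a module action.\<close>

lemma u_derivation: "derivation K R smod (\<lambda>f. u (s f))"
  unfolding derivation_def
proof (intro conjI ballI funcsetI)
  fix f assume f: "f \<in> carrier R"
  show "u (s f) \<in> carrier smod" using f u_simps(1) by simp
  fix g assume g: "g \<in> carrier R"
  show "u (s (f \<oplus>\<^bsub>R\<^esub> g)) = u (s f) \<oplus>\<^bsub>smod\<^esub> u (s g)" using f g u_simps(2) by simp
  have "u (s (f \<otimes>\<^bsub>R\<^esub> g)) = u (s f) \<otimes>\<^bsub>A\<^esub> s g \<oplus>\<^bsub>A\<^esub> s f \<otimes>\<^bsub>A\<^esub> u (s g)"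
    using f g u_simps(6)[OF s_even[OF f]] by simp
  also have "u (s f) \<otimes>\<^bsub>A\<^esub> s g = s g \<otimes>\<^bsub>A\<^esub> u (s f)" using \<rho>_central[OF g u_simps(1)] f by simp
  finally show "u (s (f \<otimes>\<^bsub>R\<^esub> g)) = f \<odot>\<^bsub>smod\<^esub> u (s g) \<oplus>\<^bsub>smod\<^esub> g \<odot>\<^bsub>smod\<^esub> u (s f)"
    using f g u_simps(1) S.a_comm by simp
next
  fix c f assume c: "c \<in> carrier K" and f: "f \<in> carrier R"
  have "s (c \<odot>\<^bsub>R\<^esub> f) = c \<odot>\<^bsub>A\<^esub> s f" using c f smult scalar_closed R_smult[OF c f] by simp
  then show "u (s (c \<odot>\<^bsub>R\<^esub> f)) = (c \<odot>\<^bsub>R\<^esub> \<one>\<^bsub>R\<^esub>) \<odot>\<^bsub>smod\<^esub> u (s f)"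
    using c f u_simps(1,3) smult by simp
qed

definition "h = (SOME h. linear_map R (kaehler K R) smod h \<and> (\<forall>f\<in>carrier R. h (kaehler_d K R f) = u (s f)))"

lemma h: "linear_map R (kaehler K R) smod h" "f \<in> carrier R \<Longrightarrow> h (kaehler_d K R f) = u (s f)"
  using someI_ex[OF kaehler_universal[OF KR smod_module u_derivation]] unfolding h_def by blast+

text \<open>The forms with odd image are a submodule, and exact differentials belong to it because
  \<open>u\<close> makes the even elements \<open>s f\<close> odd.\<close>

lemma h_odd: "\<omega> \<in> carrier (kaehler K R) \<Longrightarrow> h \<omega> \<in> odd_part A"
proof -
  interpret O: module R "kaehler K R" by (rule kaehler_module[OF KR])
  define B where "B = {\<omega> \<in> carrier (kaehler K R). h \<omega> \<in> odd_part A}"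
  have "submodule B R (kaehler K R)"
  proof (rule O.submoduleI)
    show "\<zero>\<^bsub>kaehler K R\<^esub> \<in> B"
      using linear_map_zero[OF O.module_axioms smod_module h(1)] wspan.zero[of A] by (simp add: B_def odd)
  next
    fix a assume a: "a \<in> B"
    have "h (\<ominus>\<^bsub>kaehler K R\<^esub> a) = s (\<ominus>\<^bsub>R\<^esub> \<one>\<^bsub>R\<^esub>) \<otimes>\<^bsub>A\<^esub> h a"
      using linear_mapD(3)[OF h(1), of "\<ominus>\<^bsub>R\<^esub> \<one>\<^bsub>R\<^esub>" a] a by (simp add: B_def O.smult_l_minus)
    then show "\<ominus>\<^bsub>kaehler K R\<^esub> a \<in> B" using a wspan_smult by (simp add: B_def odd)
  next
    fix a b assume "a \<in> B" "b \<in> B"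
    then show "a \<oplus>\<^bsub>kaehler K R\<^esub> b \<in> B"
      using linear_mapD(2)[OF h(1)] wspan_add by (simp add: B_def odd)
  next
    fix r a assume "r \<in> carrier R" "a \<in> B"
    then show "r \<odot>\<^bsub>kaehler K R\<^esub> a \<in> B"
      using linear_mapD(3)[OF h(1)] wspan_smult by (simp add: B_def odd)
  qed (auto simp: B_def)
  moreover have "kaehler_d K R f \<in> B" if "f \<in> carrier R" for f
    using that derivationD(1)[OF kaehler_d_derivation[OF KR]] h(2) u_simps(4) s_even by (simp add: B_def)
  ultimately have "B = carrier (kaehler K R)" by (rule kaehler_generated[OF KR])
  then show "\<omega> \<in> carrier (kaehler K R) \<Longrightarrow> h \<omega> \<in> odd_part A" by (auto simp: B_def)
qed

lemma h_rep: "ext_rep R (kaehler K R) A s h"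
proof (intro ext_rep.intro ext_rep_axioms.intro kaehler_module[OF KR] S.ring_axioms \<rho>_hom)
  show "h m \<otimes>\<^bsub>A\<^esub> h m = \<zero>\<^bsub>A\<^esub>" if "m \<in> carrier (kaehler K R)" for m
    using odd_square h_odd that by blast
qed (use \<rho>_central linear_mapD[OF h(1)] in auto)

definition "h1 \<omega> = deg1 (h \<omega>)"

lemma h1: "linear_map R (kaehler K R) E h1"
  using linear_mapD[OF h(1)] by (intro linear_mapI) (auto simp: h1_def)

lemma h1_d: "f \<in> carrier R \<Longrightarrow> h1 (kaehler_d K R f) = deg1 (u (s f))"
  by (simp add: h1_def h(2))

section \<open>The action of \<open>u\<close> on the cotangent space over a point of
  \<open>R\<close>\<close>

context
  fixes x
  assumes x: "point K R x"
begin

abbreviation "mx \<equiv> a_kernel R K x"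
text \<open>The point of \<open>A\<close> over \<open>x\<close>, through the projection to degree
  zero; the hypotheses on cotangent spaces are applied at such points.\<close>

definition "pt = x \<circ> deg0"
abbreviation "my \<equiv> point_ideal K A pt"
abbreviation "my2 \<equiv> point_ideal_sq K A pt"

lemma x_hom: "ring_hom_ring R K x"
  using x K_ring M.R.ring_axioms by (auto simp: point_def intro: ring_hom_ringI2)

lemma mx_iff: "r \<in> mx \<longleftrightarrow> r \<in> carrier R \<and> x r = \<zero>\<^bsub>K\<^esub>"
  by (auto simp: a_kernel_def kernel_def)

lemma mx_ideal: "ideal mx R"
  by (rule ring_hom_ring.kernel_is_ideal[OF x_hom])

lemma pt_point: "pt \<in> points K A"
proof -
  have "pt \<in> ring_hom A K" using x by (auto simp: pt_def point_def intro: ring_hom_trans[OF deg0_hom])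
  moreover have "pt (c \<odot>\<^bsub>A\<^esub> a) = c \<otimes>\<^bsub>K\<^esub> pt a" if "c \<in> carrier K" "a \<in> carrier A" for c a
  proof -
    have "deg0 (c \<odot>\<^bsub>A\<^esub> a) = c \<odot>\<^bsub>R\<^esub> deg0 a"
      using that scalar_closed R_smult[of c "deg0 a"] by (simp add: smult)
    then show ?thesis using x that by (simp add: point_def pt_def)
  qed
  ultimately show ?thesis by (simp add: points_def)
qed

lemma pt_hom: "ring_hom_ring A K pt"
  using pt_point K_ring S.ring_axioms by (auto simp: points_def intro: ring_hom_ringI2)

lemma my_iff: "a \<in> my \<longleftrightarrow> a \<in> carrier A \<and> x (deg0 a) = \<zero>\<^bsub>K\<^esub>"
  by (auto simp: point_ideal_def a_kernel_def kernel_def pt_def)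

lemma my_iff': "a \<in> my \<longleftrightarrow> a \<in> carrier A \<and> deg0 a \<in> mx"
  by (auto simp: my_iff mx_iff)

lemma my_ideal: "ideal my A"
  unfolding point_ideal_def by (rule ring_hom_ring.kernel_is_ideal[OF pt_hom])

lemma my2_ideal: "ideal my2 A"
  unfolding point_ideal_sq_def by (rule S.ideal_prod_is_ideal[OF my_ideal my_ideal])

lemma my2_prod: "a \<in> my \<Longrightarrow> b \<in> my \<Longrightarrow> a \<otimes>\<^bsub>A\<^esub> b \<in> my2"
  unfolding point_ideal_sq_def by (rule ideal_prod.prod)

lemma my2_add: "a \<in> my2 \<Longrightarrow> b \<in> my2 \<Longrightarrow> a \<oplus>\<^bsub>A\<^esub> b \<in> my2"
  unfolding point_ideal_sq_def by (rule ideal_prod.sum)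

lemma my2_zero: "\<zero>\<^bsub>A\<^esub> \<in> my2"
  using additive_subgroup.zero_closed[OF ideal.axioms(1)[OF my2_ideal]] .

lemma my2_neg: "a \<in> my2 \<Longrightarrow> \<ominus>\<^bsub>A\<^esub> a \<in> my2"
  using additive_subgroup.a_inv_closed[OF ideal.axioms(1)[OF my2_ideal]] .

lemma my2_closed: "a \<in> my2 \<Longrightarrow> a \<in> carrier A"
  using ideal.Icarr[OF my2_ideal] .

lemma zero_mx: "\<zero>\<^bsub>R\<^esub> \<in> mx"
  using additive_subgroup.zero_closed[OF ideal.axioms(1)[OF mx_ideal]] .

lemma odd_my: "a \<in> odd_part A \<Longrightarrow> a \<in> my"
  using odd_deg0 parts_closed zero_mx by (simp add: my_iff')

lemma u_my: "a \<in> carrier A \<Longrightarrow> u a \<in> my"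
proof -
  assume a: "a \<in> carrier A"
  then have "pt (u a) = \<zero>\<^bsub>K\<^esub>" using vanish pt_point unfolding everywhere_vanishing_def by blast
  then have "x (deg0 (u a)) = \<zero>\<^bsub>K\<^esub>" by (simp add: pt_def)
  then show ?thesis using a u_simps(1) by (simp add: my_iff)
qed

text \<open>For a product, the component of degree one is
  \<open>deg0 a deg1 b + deg0 b deg1 a\<close> with both coefficients in m_x, and the component of
  degree zero is a product of two elements of m_x.\<close>

lemma my2_deg:
  assumes "a \<in> my2"
  shows "deg0 a \<in> ideal_prod R mx mx" "deg1 a \<in> ispan R E mx (carrier E)"
proof -
  have "deg0 a \<in> ideal_prod R mx mx \<and> deg1 a \<in> ispan R E mx (carrier E) \<and> a \<in> carrier A"
    using assms unfolding point_ideal_sq_def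
  proof induction
    case (prod a b)
    then have ab: "a \<in> carrier A" "b \<in> carrier A" "deg0 a \<in> mx" "deg0 b \<in> mx" by (auto simp: my_iff')
    then show ?case
      using M.ispan_add[OF mx_ideal subset_refl M.ispan_incl[OF mx_ideal subset_refl] M.ispan_incl[OF mx_ideal subset_refl]]
      by (simp add: ideal_prod.prod)
  next
    case (sum a b)
    then show ?case using M.ispan_add[OF mx_ideal subset_refl] by (simp add: ideal_prod.sum)
  qed
  then show "deg0 a \<in> ideal_prod R mx mx" "deg1 a \<in> ispan R E mx (carrier E)" by auto
qed

text \<open>\<open>u\<close> maps all of \<open>A\<close> into the maximal ideal, so the terms of
  the Leibniz rule are again products of two of its elements. The left factor is split into its
  parity parts because the sign in the rule depends on parity.\<close>

lemma u_my2: "a \<in> my2 \<Longrightarrow> u a \<in> my2"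
proof -
  assume "a \<in> my2"
  then show "u a \<in> my2"
    unfolding point_ideal_sq_def
  proof induction
    case (prod a b)
    then have ab: "a \<in> carrier A" "b \<in> carrier A" by (auto simp: my_iff)
    obtain c d where cd: "c \<in> even_part A" "d \<in> odd_part A" "a = c \<oplus>\<^bsub>A\<^esub> d" using parts_sum ab by blast
    have cdA: "c \<in> carrier A" "d \<in> carrier A" using cd parts_closed by auto
    have dm: "d \<in> my" using odd_my cd by blast
    have cm: "c \<in> my" using prod(1) cdA odd_deg0[OF cd(2)] by (simp add: my_iff cd(3))
    have "u (a \<otimes>\<^bsub>A\<^esub> b) = (u c \<otimes>\<^bsub>A\<^esub> b \<oplus>\<^bsub>A\<^esub> c \<otimes>\<^bsub>A\<^esub> u b) \<oplus>\<^bsub>A\<^esub> (u d \<otimes>\<^bsub>A\<^esub> b \<ominus>\<^bsub>A\<^esub> d \<otimes>\<^bsub>A\<^esub> u b)"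
      unfolding cd(3) using cdA ab u_simps(2) u_simps(6)[OF cd(1) ab(2)] u_simps(7)[OF cd(2) ab(2)] by (simp add: S.l_distr)
    moreover have "u c \<otimes>\<^bsub>A\<^esub> b \<in> my2" "c \<otimes>\<^bsub>A\<^esub> u b \<in> my2" "u d \<otimes>\<^bsub>A\<^esub> b \<in> my2" "d \<otimes>\<^bsub>A\<^esub> u b \<in> my2"
      using my2_prod u_my cdA ab cm dm prod by auto
    ultimately have "u (a \<otimes>\<^bsub>A\<^esub> b) \<in> my2" using my2_add my2_neg by (simp add: S.minus_eq)
    then show ?case unfolding point_ideal_sq_def .
  next
    case (sum a b)
    then have "a \<in> carrier A" "b \<in> carrier A" using my2_closed unfolding point_ideal_sq_def by auto
    then show ?case using sum u_simps(2) ideal_prod.sum by metis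
  qed
qed

text \<open>\<open>u\<close> may lower degrees, so terms of degree at least two can contribute to
  degree one. When a word is cut after its first letter, neither factor has a component of degree
  zero; in the Leibniz rule the coefficient in degree one is therefore the component of degree zero
  of a value of \<open>u\<close>, which lies in m_x because \<open>u\<close> vanishes at the
  point.\<close>

lemma u_deg2:
  assumes "f \<in> WS {2..}"
  shows "deg1 (u f) \<in> ispan R E mx (carrier E)"
  using assms
proof (induction rule: wspan_induct_add)
  case (single r w)
  then obtain e v where w: "w = e # v" "e \<in> carrier E" "v \<in> words E" "length v \<ge> 1"
    by (cases w) auto
  then obtain e' t where v: "v = e' # t" "e' \<in> carrier E" "t \<in> words E" by (cases v) auto
  let ?a = "s r \<otimes>\<^bsub>A\<^esub> j e" and ?b = "wprod A j v"
  have a: "?a \<in> odd_part A"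
    unfolding odd using wspan_single[of r "[e]" "{n. odd n}"] single w by simp
  have b: "?b \<in> carrier A" "deg0 ?b = \<zero>\<^bsub>R\<^esub>" using w v by simp_all
  have aA: "?a \<in> carrier A" "u ?a \<in> carrier A" "u ?b \<in> carrier A" using single w b u_simps(1) by simp_all
  have "s r \<otimes>\<^bsub>A\<^esub> wprod A j w = ?a \<otimes>\<^bsub>A\<^esub> ?b" using single w by (simp add: S.m_assoc)
  then have "u (s r \<otimes>\<^bsub>A\<^esub> wprod A j w) = u ?a \<otimes>\<^bsub>A\<^esub> ?b \<ominus>\<^bsub>A\<^esub> ?a \<otimes>\<^bsub>A\<^esub> u ?b"
    using u_simps(7)[OF a b(1)] by simp
  then have "deg1 (u (s r \<otimes>\<^bsub>A\<^esub> wprod A j w)) = deg1 (u ?a \<otimes>\<^bsub>A\<^esub> ?b) \<oplus>\<^bsub>E\<^esub> \<ominus>\<^bsub>E\<^esub> deg1 (?a \<otimes>\<^bsub>A\<^esub> u ?b)"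
    using aA b(1) by (simp only: S.minus_eq deg_simps deg_a_inv S.m_closed S.a_inv_closed)
  also have "deg1 (u ?a \<otimes>\<^bsub>A\<^esub> ?b) = deg0 (u ?a) \<odot>\<^bsub>E\<^esub> deg1 ?b"
    using aA b deg_simps(2)[OF aA(2)] by (simp only: deg_simps(6) b(2) M.smult_l_null) simp
  also have "deg1 (?a \<otimes>\<^bsub>A\<^esub> u ?b) = deg0 (u ?b) \<odot>\<^bsub>E\<^esub> deg1 ?a"
    using aA b deg_simps(2)[OF aA(3)] odd_deg0[OF a] by (simp only: deg_simps(6) M.smult_l_null) simp
  finally have eq: "deg1 (u (s r \<otimes>\<^bsub>A\<^esub> wprod A j w)) = deg0 (u ?a) \<odot>\<^bsub>E\<^esub> deg1 ?b \<oplus>\<^bsub>E\<^esub> deg0 (u ?b) \<odot>\<^bsub>E\<^esub> (\<ominus>\<^bsub>E\<^esub> deg1 ?a)"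
    using aA b by (simp add: M.smult_r_minus)
  have "deg0 (u ?a) \<in> mx" "deg0 (u ?b) \<in> mx" using u_my aA b by (auto simp: my_iff')
  then show ?case
    unfolding eq using aA b
    by (intro M.ispan_add[OF mx_ideal subset_refl] M.ispan_incl[OF mx_ideal subset_refl]) auto
next
  case (add a b)
  then show ?case using wspan_closed u_simps(1,2) M.ispan_add[OF mx_ideal subset_refl] by simp
next
  case zero
  have "u \<zero>\<^bsub>A\<^esub> = \<zero>\<^bsub>A\<^esub>" using u_simps(1)[of "\<zero>\<^bsub>A\<^esub>"] u_simps(2)[of "\<zero>\<^bsub>A\<^esub>" "\<zero>\<^bsub>A\<^esub>"] by (metis S.add.l_cancel_one S.l_zero S.zero_closed)
  then show ?case by (simp add: ispan.zero)
qed

lemma cot_parts: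
  "even_part (cotangent_space K A pt) = (\<lambda>a. my2 +>\<^bsub>A\<^esub> a) ` (even_part A \<inter> my)"
  "odd_part (cotangent_space K A pt) = (\<lambda>a. my2 +>\<^bsub>A\<^esub> a) ` (odd_part A \<inter> my)"
  by (simp_all add: cotangent_space_def quot_superalgebra_def a_r_coset_def r_coset_def)

lemma my2_subgroup: "abelian_subgroup my2 A"
  using ideal.axioms(1)[OF my2_ideal] S.abelian_group_axioms by (rule abelian_subgroupI3)

lemma coset_mem: "a \<in> carrier A \<Longrightarrow> b \<in> carrier A \<Longrightarrow> b \<in> my2 +>\<^bsub>A\<^esub> a \<longleftrightarrow> b \<ominus>\<^bsub>A\<^esub> a \<in> my2"
  using abelian_subgroup.a_rcos_module_minus[OF my2_subgroup S.ring_axioms, of a b] by simp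

text \<open>The class of \<open>j e\<close> is odd, so it is the class of \<open>u f\<close> for
  some even \<open>f\<close>. In degree one and modulo m_x \<open>E\<close>, the terms of
  \<open>f\<close> of degree at least two contribute nothing to \<open>u f\<close>, and the term of
  degree zero contributes \<open>h1\<close> of its differential.\<close>

lemma fibre_surj:
  assumes e: "e \<in> carrier E"
  shows "\<exists>f\<in>carrier R. \<exists>z\<in>ispan R E mx (carrier E). e = h1 (kaehler_d K R f) \<oplus>\<^bsub>E\<^esub> z"
proof -
  have je: "j e \<in> odd_part A \<inter> my" using j_odd odd_my e by blast
  then have "my2 +>\<^bsub>A\<^esub> j e \<in> odd_part (cotangent_space K A pt)" unfolding cot_parts by blast
  then have "my2 +>\<^bsub>A\<^esub> j e \<in> cotangent_map K A u pt ` even_part (cotangent_space K A pt)"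
    using bij[OF pt_point] by (simp add: bij_betw_def)
  then obtain f where f: "f \<in> even_part A" "f \<in> my" "cotangent_map K A u pt (my2 +>\<^bsub>A\<^esub> f) = my2 +>\<^bsub>A\<^esub> j e"
    unfolding cot_parts by blast
  have fA: "f \<in> carrier A" "u f \<in> carrier A" "j e \<in> carrier A" using f parts_closed u_simps(1) e by auto
  have self: "a \<in> my2 +>\<^bsub>A\<^esub> a" if "a \<in> carrier A" for a using coset_mem[OF that that] my2_zero that by (simp add: S.minus_eq S.r_neg)
  have "u f \<in> cotangent_map K A u pt (my2 +>\<^bsub>A\<^esub> f)"
    unfolding cotangent_map_def using self[OF fA(1)] self[OF fA(2)] by blast
  then have "u f \<ominus>\<^bsub>A\<^esub> j e \<in> my2" unfolding f(3) using coset_mem fA by simp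
  then have "deg1 (u f \<ominus>\<^bsub>A\<^esub> j e) \<in> ispan R E mx (carrier E)" by (rule my2_deg)
  then have z1: "deg1 (u f) \<ominus>\<^bsub>E\<^esub> e \<in> ispan R E mx (carrier E)" using fA e by (simp add: S.minus_eq M.M.minus_eq)
  obtain f2 where f2: "f2 \<in> WS {2..}" "f = s (deg0 f) \<oplus>\<^bsub>A\<^esub> j (deg1 f) \<oplus>\<^bsub>A\<^esub> f2" using decompose[OF fA(1)] by blast
  have f2A: "f2 \<in> carrier A" "u f2 \<in> carrier A" using f2 wspan_closed u_simps(1) by auto
  have c: "s (deg0 f) \<in> carrier A" "u (s (deg0 f)) \<in> carrier A" using fA u_simps(1) by auto
  have "u f = u (s (deg0 f)) \<oplus>\<^bsub>A\<^esub> u f2"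
  proof -
    \<comment> \<open>An even element has no term of degree one.\<close>
    have "f = s (deg0 f) \<oplus>\<^bsub>A\<^esub> f2" using f2(2) even_deg1[OF f(1)] c g_zero by simp
    then show ?thesis using u_simps(2)[OF c(1) f2A(1)] by simp
  qed
  then have d: "deg1 (u f) = h1 (kaehler_d K R (deg0 f)) \<oplus>\<^bsub>E\<^esub> deg1 (u f2)"
    using c f2A fA h1_d by simp
  have "(\<ominus>\<^bsub>R\<^esub> \<one>\<^bsub>R\<^esub>) \<odot>\<^bsub>E\<^esub> (deg1 (u f) \<ominus>\<^bsub>E\<^esub> e) \<in> ispan R E mx (carrier E)"
    by (rule M.ispan_smult[OF mx_ideal subset_refl _ z1]) simp
  then have n: "\<ominus>\<^bsub>E\<^esub> (deg1 (u f) \<ominus>\<^bsub>E\<^esub> e) \<in> ispan R E mx (carrier E)" using fA e by (simp add: M.smult_l_minus)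
  have "e = deg1 (u f) \<oplus>\<^bsub>E\<^esub> \<ominus>\<^bsub>E\<^esub> (deg1 (u f) \<ominus>\<^bsub>E\<^esub> e)"
    using fA e by (simp add: M.M.minus_eq M.M.minus_add M.M.r_neg2)
  also have "\<dots> = h1 (kaehler_d K R (deg0 f)) \<oplus>\<^bsub>E\<^esub> (deg1 (u f2) \<oplus>\<^bsub>E\<^esub> \<ominus>\<^bsub>E\<^esub> (deg1 (u f) \<ominus>\<^bsub>E\<^esub> e))"
    unfolding d[symmetric] using d fA f2A c e h1_d by (simp add: M.M.a_assoc)
  finally show ?thesis
    using fA M.ispan_add[OF mx_ideal subset_refl u_deg2[OF f2(1)] n] by (intro bexI[of _ "deg0 f"]) auto
qed

text \<open>Under the hypothesis \<open>u (s f)\<close> lies in the square of the maximal ideal, so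
  the class of \<open>s f\<close> has the same image as the class of zero. Injectivity puts
  \<open>s f\<close> into that square, and its component of degree zero is \<open>f\<close>.\<close>

lemma fibre_inj:
  assumes f: "f \<in> mx" and hf: "h1 (kaehler_d K R f) \<in> ispan R E mx (carrier E)"
  shows "f \<in> ideal_prod R mx mx"
proof -
  have fR: "f \<in> carrier R" using f by (simp add: mx_iff)
  let ?a = "s f"
  have a: "?a \<in> even_part A" "?a \<in> my" "?a \<in> carrier A" using s_even[OF fR] f fR by (auto simp: my_iff')
  have uA: "u ?a \<in> carrier A" "u ?a \<in> odd_part A" using u_simps a by auto
  \<comment> \<open>Two letters are two factors in the maximal ideal.\<close>
  have w2: "b \<in> my2" if "b \<in> WS {2..}" for b
    using that
  proof (induction rule: wspan_induct_add)
    case (single r w)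
    then obtain e v where w: "w = e # v" "e \<in> carrier E" "v \<in> words E" "length v \<ge> 1"
      by (cases w) auto
    then obtain e' t where v: "v = e' # t" "e' \<in> carrier E" "t \<in> words E" by (cases v) auto
    have "(s r \<otimes>\<^bsub>A\<^esub> j e) \<otimes>\<^bsub>A\<^esub> wprod A j v \<in> my2"
      by (rule my2_prod) (use single w v zero_mx in \<open>auto simp: my_iff'\<close>)
    moreover have "s r \<otimes>\<^bsub>A\<^esub> wprod A j w = (s r \<otimes>\<^bsub>A\<^esub> j e) \<otimes>\<^bsub>A\<^esub> wprod A j v"
      using single w by (simp add: S.m_assoc)
    ultimately show ?case by (simp only:)
  next
    case (add a b)
    then show ?case by (intro my2_add)
  next
    case zero
    show ?case by (rule my2_zero)
  qed
  have je: "j z \<in> my2" if "z \<in> ispan R E mx (carrier E)" for z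
    using that
  proof induction
    case zero
    then show ?case using my2_zero g_zero by simp
  next
    case (step a c z)
    have aR: "a \<in> carrier R" "z \<in> carrier E" using step M.ispan_closed[OF mx_ideal subset_refl] by (auto simp: mx_iff)
    have "s a \<otimes>\<^bsub>A\<^esub> j c \<in> my2"
      by (rule my2_prod) (use step aR zero_mx in \<open>auto simp: my_iff'\<close>)
    then show ?case using step aR my2_add by (simp add: g_add g_smult)
  qed
  \<comment> \<open>Degree zero is absent because \<open>u (s f)\<close> is odd; the term of degree
    one lies in the square by \<open>hf\<close>, the higher terms by \<open>w2\<close>.\<close>
  have ua: "u ?a \<in> my2"
  proof -
    obtain b where b: "b \<in> WS {2..}" "u ?a = s (deg0 (u ?a)) \<oplus>\<^bsub>A\<^esub> j (deg1 (u ?a)) \<oplus>\<^bsub>A\<^esub> b"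
      using decompose[OF uA(1)] by blast
    have "u ?a = j (h1 (kaehler_d K R f)) \<oplus>\<^bsub>A\<^esub> b"
      using b(2) odd_deg0[OF uA(2)] h1_d[OF fR] uA(1) wspan_closed[OF b(1)] by simp
    then show ?thesis using w2[OF b(1)] je[OF hf] my2_add by simp
  qed
  have coset: "my2 +>\<^bsub>A\<^esub> b = my2" if "b \<in> my2" for b
    by (rule abelian_subgroup.a_rcos_const[OF my2_subgroup that])
  \<comment> \<open>\<open>cotangent_map\<close> is a union over representatives; it collapses to a
    single coset because \<open>u\<close> preserves the square of the maximal ideal.\<close>
  have cm: "cotangent_map K A u pt (my2 +>\<^bsub>A\<^esub> b) = my2" if b: "b \<in> carrier A" "u b \<in> my2" for b
  proof -
    have "my2 +>\<^bsub>A\<^esub> u c = my2" if c: "c \<in> my2 +>\<^bsub>A\<^esub> b" for c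
    proof -
      obtain z where z: "z \<in> my2" "c = z \<oplus>\<^bsub>A\<^esub> b" using c by (auto simp: a_r_coset_def r_coset_def)
      then have "u c = u z \<oplus>\<^bsub>A\<^esub> u b" using u_simps(2) my2_closed b by simp
      then show ?thesis using coset my2_add u_my2 z b by simp
    qed
    moreover have "my2 +>\<^bsub>A\<^esub> b \<noteq> {}" using my2_zero by (auto simp: a_r_coset_def r_coset_def)
    ultimately show ?thesis unfolding cotangent_map_def by (intro SUP_eq_const)
  qed
  have u0: "u \<zero>\<^bsub>A\<^esub> \<in> my2" using u_my2 my2_zero by blast
  have z: "\<zero>\<^bsub>A\<^esub> \<in> even_part A \<inter> my"
    unfolding even using wspan.zero[of A] zero_mx by (simp add: my_iff')
  have "cotangent_map K A u pt (my2 +>\<^bsub>A\<^esub> ?a) = cotangent_map K A u pt (my2 +>\<^bsub>A\<^esub> \<zero>\<^bsub>A\<^esub>)"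
    using cm[OF a(3) ua] cm[OF S.zero_closed u0] by simp
  then have "my2 +>\<^bsub>A\<^esub> ?a = my2 +>\<^bsub>A\<^esub> \<zero>\<^bsub>A\<^esub>"
    using bij[OF pt_point] a z unfolding bij_betw_def inj_on_def cot_parts by blast
  then have "my2 +>\<^bsub>A\<^esub> ?a = my2" using coset[OF my2_zero] by simp
  moreover have "?a \<in> my2 +>\<^bsub>A\<^esub> ?a" using coset_mem[OF a(3,3)] my2_zero a by (simp add: S.minus_eq S.r_neg)
  ultimately have "?a \<in> my2" by simp
  then show ?thesis using my2_deg(1)[of ?a] fR by simp
qed

end

end

section \<open>Dual bases and fibrewise isomorphisms\<close>

lemma linear_map_finsum:
  assumes "module R M" "module R N" "linear_map R M N f" and a: "\<And>i. i < m \<Longrightarrow> a i \<in> carrier M"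
  shows "f (\<Oplus>\<^bsub>M\<^esub>i\<in>{..<m::nat}. a i) = (\<Oplus>\<^bsub>N\<^esub>i\<in>{..<m}. f (a i))"
proof -
  interpret M: module R M by fact
  interpret N: module R N by fact
  show ?thesis using a
  proof (induction m)
    case 0
    then show ?case using linear_map_zero[OF assms(1-3)] by simp
  next
    case (Suc m)
    have c: "a i \<in> carrier M" "f (a i) \<in> carrier N" if "i < Suc m" for i
      using Suc.prems that linear_mapD(1)[OF assms(3)] by auto
    have "(\<Oplus>\<^bsub>M\<^esub>i\<in>{..<Suc m}. a i) = a m \<oplus>\<^bsub>M\<^esub> (\<Oplus>\<^bsub>M\<^esub>i\<in>{..<m}. a i)"
      unfolding lessThan_Suc using c by (intro M.M.finsum_insert) auto
    moreover have "(\<Oplus>\<^bsub>N\<^esub>i\<in>{..<Suc m}. f (a i)) = f (a m) \<oplus>\<^bsub>N\<^esub> (\<Oplus>\<^bsub>N\<^esub>i\<in>{..<m}. f (a i))"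
      unfolding lessThan_Suc using c by (intro N.M.finsum_insert) auto
    moreover have "(\<Oplus>\<^bsub>M\<^esub>i\<in>{..<m}. a i) \<in> carrier M" using c by (intro M.M.finsum_closed) auto
    ultimately show ?case using Suc c linear_mapD(2)[OF assms(3), of "a m" "\<Oplus>\<^bsub>M\<^esub>i\<in>{..<m}. a i"] by simp
  qed
qed

text \<open>The dual basis form of finitely generated projectivity. The coordinates are written out
  as functions, so that later arguments take place in \<open>M\<close> and \<open>R\<close>
  alone.\<close>

definition dual_basis ::
    "('r, 'c) ring_scheme \<Rightarrow> ('r, 'm, 'd) module_scheme \<Rightarrow> nat \<Rightarrow> (nat \<Rightarrow> 'm) \<Rightarrow> (nat \<Rightarrow> 'm \<Rightarrow> 'r) \<Rightarrow> bool"
  where "dual_basis R M n b \<phi> \<longleftrightarrow>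
    (\<forall>i<n. b i \<in> carrier M) \<and> (\<forall>i<n. \<forall>e\<in>carrier M. \<phi> i e \<in> carrier R) \<and>
    (\<forall>i<n. \<forall>e\<in>carrier M. \<forall>e'\<in>carrier M. \<phi> i (e \<oplus>\<^bsub>M\<^esub> e') = \<phi> i e \<oplus>\<^bsub>R\<^esub> \<phi> i e') \<and>
    (\<forall>i<n. \<forall>r\<in>carrier R. \<forall>e\<in>carrier M. \<phi> i (r \<odot>\<^bsub>M\<^esub> e) = r \<otimes>\<^bsub>R\<^esub> \<phi> i e) \<and>
    (\<forall>e\<in>carrier M. e = (\<Oplus>\<^bsub>M\<^esub>i\<in>{..<n}. \<phi> i e \<odot>\<^bsub>M\<^esub> b i))"

lemma fg_projective_dual_basis:
  assumes "fg_projective R M"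
  shows "\<exists>n b \<phi>. dual_basis R M n b \<phi>"
proof -
  obtain n i p where M: "module R M" and i: "linear_map R M (free_module R n) i"
    and p: "linear_map R (free_module R n) M p" and pi: "\<And>x. x \<in> carrier M \<Longrightarrow> p (i x) = x"
    using assms unfolding fg_projective_def by blast
  interpret M: module R M by fact
  let ?V = "free_module R n"
  define unit where "unit = (\<lambda>l::nat. \<lambda>k\<in>{..<n}. if k = l then \<one>\<^bsub>R\<^esub> else \<zero>\<^bsub>R\<^esub>)"
  have unit: "unit l \<in> carrier ?V" for l by (auto simp: unit_def free_module_def)
  have p_sum: "p v = (\<Oplus>\<^bsub>M\<^esub>l\<in>{..<n}. v l \<odot>\<^bsub>M\<^esub> p (unit l))" if v: "v \<in> carrier ?V" for v
  proof -
    have vl: "v l \<in> carrier R" if "l < n" for l using v that by (auto simp: free_module_def)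
    have pu: "p (unit l) \<in> carrier M" for l using linear_mapD(1)[OF p unit] .
    \<comment> \<open>Truncating \<open>v\<close> to its first \<open>m\<close> coordinates turns
      the expansion in unit vectors into an induction on \<open>m\<close>; at \<open>m = n\<close>
      nothing is cut off.\<close>
    have "p (\<lambda>k\<in>{..<n}. if k < m then v k else \<zero>\<^bsub>R\<^esub>) = (\<Oplus>\<^bsub>M\<^esub>l\<in>{..<m}. v l \<odot>\<^bsub>M\<^esub> p (unit l))" if "m \<le> n" for m
      using that
    proof (induction m)
      case 0
      have z: "(\<lambda>k\<in>{..<n}. \<zero>\<^bsub>R\<^esub>) \<in> carrier ?V" by (auto simp: free_module_def)
      have "\<zero>\<^bsub>R\<^esub> \<odot>\<^bsub>?V\<^esub> (\<lambda>k\<in>{..<n}. \<zero>\<^bsub>R\<^esub>) = (\<lambda>k\<in>{..<n}. \<zero>\<^bsub>R\<^esub>)" by (auto simp: free_module_def)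
      then have "p (\<lambda>k\<in>{..<n}. \<zero>\<^bsub>R\<^esub>) = \<zero>\<^bsub>M\<^esub>"
        using linear_mapD(3)[OF p M.R.zero_closed z] linear_mapD(1)[OF p z] by simp
      then show ?case by (simp only: not_less_zero if_False lessThan_0 M.M.finsum_empty)
    next
      case (Suc m)
      let ?w = "\<lambda>m. \<lambda>k\<in>{..<n}. if k < m then v k else \<zero>\<^bsub>R\<^esub>"
      have w: "?w m \<in> carrier ?V" "v m \<odot>\<^bsub>?V\<^esub> unit m \<in> carrier ?V"
        using vl Suc.prems by (auto simp: free_module_def unit_def)
      have "?w (Suc m) = v m \<odot>\<^bsub>?V\<^esub> unit m \<oplus>\<^bsub>?V\<^esub> ?w m"
        using vl Suc.prems by (auto simp: free_module_def unit_def restrict_def fun_eq_iff less_Suc_eq)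
      then have "p (?w (Suc m)) = v m \<odot>\<^bsub>M\<^esub> p (unit m) \<oplus>\<^bsub>M\<^esub> p (?w m)"
        using linear_mapD(2)[OF p w(2,1)] linear_mapD(3)[OF p vl unit, of m m] Suc.prems by simp
      also have "p (?w m) = (\<Oplus>\<^bsub>M\<^esub>l\<in>{..<m}. v l \<odot>\<^bsub>M\<^esub> p (unit l))"
        by (rule Suc.IH) (use Suc.prems in simp)
      also have "v m \<odot>\<^bsub>M\<^esub> p (unit m) \<oplus>\<^bsub>M\<^esub> \<dots> = (\<Oplus>\<^bsub>M\<^esub>l\<in>{..<Suc m}. v l \<odot>\<^bsub>M\<^esub> p (unit l))"
        unfolding lessThan_Suc using vl pu Suc.prems by (intro M.M.finsum_insert[symmetric]) auto
      finally show ?case .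
    qed
    from this[OF order_refl] have "p (\<lambda>k\<in>{..<n}. if k < n then v k else \<zero>\<^bsub>R\<^esub>) =
      (\<Oplus>\<^bsub>M\<^esub>l\<in>{..<n}. v l \<odot>\<^bsub>M\<^esub> p (unit l))" .
    moreover have "(\<lambda>k\<in>{..<n}. if k < n then v k else \<zero>\<^bsub>R\<^esub>) = v"
      using v by (auto simp: free_module_def fun_eq_iff restrict_def PiE_def extensional_def)
    ultimately show ?thesis by (simp only:)
  qed
  have "dual_basis R M n (\<lambda>l. p (unit l)) (\<lambda>l e. i e l)"
    unfolding dual_basis_def
  proof (intro conjI allI impI ballI)
    show "p (unit l) \<in> carrier M" for l using linear_mapD(1)[OF p unit] .
    show "i e l \<in> carrier R" if "l < n" "e \<in> carrier M" for l e
      using linear_mapD(1)[OF i that(2)] that(1) by (auto simp: free_module_def)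
    show "i (e \<oplus>\<^bsub>M\<^esub> e') l = i e l \<oplus>\<^bsub>R\<^esub> i e' l" if "l < n" "e \<in> carrier M" "e' \<in> carrier M" for l e e'
      using linear_mapD(2)[OF i that(2,3)] that(1) by (simp add: free_module_def)
    show "i (r \<odot>\<^bsub>M\<^esub> e) l = r \<otimes>\<^bsub>R\<^esub> i e l" if "l < n" "r \<in> carrier R" "e \<in> carrier M" for l r e
      using linear_mapD(3)[OF i that(2,3)] that(1) by (simp add: free_module_def)
    show "e = (\<Oplus>\<^bsub>M\<^esub>l\<in>{..<n}. i e l \<odot>\<^bsub>M\<^esub> p (unit l))" if "e \<in> carrier M" for e
      using p_sum[OF linear_mapD(1)[OF i that]] pi[OF that] by simp
  qed
  then show ?thesis by blast
qed

lemma (in module) finsum_in_submodule: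
  assumes "submodule N R M" "\<And>i. i < m \<Longrightarrow> a i \<in> N"
  shows "(\<Oplus>\<^bsub>M\<^esub>i\<in>{..<m::nat}. a i) \<in> N"
  using assms(2)
proof (induction m)
  case 0
  then show ?case using subgroup.one_closed[OF submodule.axioms(1)[OF assms(1)]] by simp
next
  case (Suc m)
  have "(\<Oplus>\<^bsub>M\<^esub>i\<in>{..<Suc m}. a i) = a m \<oplus>\<^bsub>M\<^esub> (\<Oplus>\<^bsub>M\<^esub>i\<in>{..<m}. a i)"
    unfolding lessThan_Suc using Suc.prems submoduleE(1)[OF assms(1)] by (intro M.finsum_insert) auto
  then show ?case using Suc submoduleE(5)[OF assms(1)] by simp
qed

lemma (in module) ispan_carrier_subset:
  assumes I: "ideal I R" and F: "F \<subseteq> carrier M" "ispan R M (carrier R) F = carrier M"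
    and y: "y \<in> ispan R M I (carrier M)"
  shows "y \<in> ispan R M I F"
  using y
proof induction
  case (step a c y)
  then show ?case using ispan_smult_span[OF I F(1), of a c] F(2) ispan_add[OF I F(1)] by simp
qed (rule ispan.zero)

lemma ispan_image:
  assumes "module R M" "module R N" "linear_map R M N f" and I: "ideal I R" and F: "F \<subseteq> carrier M"
    and y: "y \<in> ispan R M I F"
  shows "f y \<in> ispan R N I (f ` F)"
proof -
  interpret M: module R M by fact
  interpret N: module R N by fact
  show ?thesis using y
  proof induction
    case zero
    then show ?case using linear_map_zero[OF assms(1-3)] by (simp add: ispan.zero)
  next
    case (step a c y)
    have "a \<in> carrier R" "c \<in> carrier M" "y \<in> carrier M"
      using step ideal.Icarr[OF I] F M.ispan_closed[OF I F] by auto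
    then have "f (a \<odot>\<^bsub>M\<^esub> c \<oplus>\<^bsub>M\<^esub> y) = a \<odot>\<^bsub>N\<^esub> f c \<oplus>\<^bsub>N\<^esub> f y"
      using linear_mapD[OF assms(3)] by simp
    then show ?case using step by (simp add: ispan.step)
  qed
qed

lemma (in module) ispan_mono: "F \<subseteq> F' \<Longrightarrow> y \<in> ispan R M I F \<Longrightarrow> y \<in> ispan R M I F'"
  by (rotate_tac, induction rule: ispan.induct) (auto intro: ispan.intros)

section \<open>Bijectivity of the map from forms to \<open>E\<close>\<close>

context odd_field
begin

abbreviation "\<Omega> \<equiv> kaehler K R"
abbreviation "dd \<equiv> kaehler_d K R"

lemma E_fin_gen: "\<exists>F. finite F \<and> F \<subseteq> carrier E \<and> ispan R E (carrier R) F = carrier E"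
proof -
  obtain n b \<phi> where db: "dual_basis R E n b \<phi>" using fg_projective_dual_basis[OF proj] by blast
  have b: "b i \<in> carrier E" if "i < n" for i using db that unfolding dual_basis_def by blast
  have \<phi>: "\<phi> i e \<in> carrier R" if "i < n" "e \<in> carrier E" for i e using db that unfolding dual_basis_def by blast
  have sum: "e = (\<Oplus>\<^bsub>E\<^esub>i\<in>{..<n}. \<phi> i e \<odot>\<^bsub>E\<^esub> b i)" if "e \<in> carrier E" for e
    using db that unfolding dual_basis_def by blast
  have F: "b ` {..<n} \<subseteq> carrier E" using b by auto
  have "carrier E \<subseteq> ispan R E (carrier R) (b ` {..<n})"
  proof
    fix e assume e: "e \<in> carrier E"
    have "(\<Oplus>\<^bsub>E\<^esub>i\<in>{..<n}. \<phi> i e \<odot>\<^bsub>E\<^esub> b i) \<in> ispan R E (carrier R) (b ` {..<n})"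
      by (rule M.finsum_in_submodule[OF M.span_submodule[OF F]])
        (use \<phi> e in \<open>auto intro!: M.ispan_incl[OF M.R.oneideal F]\<close>)
    then show "e \<in> ispan R E (carrier R) (b ` {..<n})" using sum[OF e] by simp
  qed
  then have "ispan R E (carrier R) (b ` {..<n}) = carrier E"
    using M.ispan_closed[OF M.R.oneideal F] by blast
  then show ?thesis using F by blast
qed

lemma h1_surj: "h1 ` carrier \<Omega> = carrier E"
proof -
  interpret O: module R \<Omega> by (rule kaehler_module[OF KR])
  obtain F where F: "finite F" "F \<subseteq> carrier E" "ispan R E (carrier R) F = carrier E" using E_fin_gen by blast
  have im: "submodule (h1 ` carrier \<Omega>) R E"
    by (rule linear_map_image_submodule[OF O.module_axioms M.module_axioms h1])
  have "F \<subseteq> h1 ` carrier \<Omega>"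
  proof (rule nakayama_points[OF K KR fg M.module_axioms im F(1,2)])
    fix x c assume x: "point K R x" and c: "c \<in> F"
    obtain f z where fz: "f \<in> carrier R" "z \<in> ispan R E (mx x) (carrier E)" "c = h1 (dd f) \<oplus>\<^bsub>E\<^esub> z"
      using fibre_surj[OF x, of c] c F by blast
    then have "z \<in> ispan R E (mx x) F" using M.ispan_carrier_subset[OF mx_ideal[OF x] F(2,3)] by blast
    moreover have "h1 (dd f) \<in> h1 ` carrier \<Omega>" using derivationD(1)[OF kaehler_d_derivation[OF KR] fz(1)] by simp
    ultimately show "\<exists>n\<in>h1 ` carrier \<Omega>. \<exists>y\<in>ispan R E (a_kernel R K x) F. c = n \<oplus>\<^bsub>E\<^esub> y" using fz(3) by blast
  qed
  then have "carrier E \<subseteq> h1 ` carrier \<Omega>" using M.span_least[OF im, of F] F(3) by blast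
  then show ?thesis using linear_mapD(1)[OF h1] by blast
qed

text \<open>The vectors \<open>b i\<close> are lifted to forms \<open>w i\<close>; the coordinates
  \<open>\<phi> i\<close> make the lift linear although the \<open>b i\<close> need not be linearly
  independent.\<close>

lemma h1_section: "\<exists>k. linear_map R E \<Omega> k \<and> (\<forall>e\<in>carrier E. h1 (k e) = e)"
proof -
  interpret O: module R \<Omega> by (rule kaehler_module[OF KR])
  obtain n b \<phi> where db: "dual_basis R E n b \<phi>" using fg_projective_dual_basis[OF proj] by blast
  have b: "b i \<in> carrier E" if "i < n" for i using db that unfolding dual_basis_def by blast
  have \<phi>: "\<phi> i e \<in> carrier R" if "i < n" "e \<in> carrier E" for i e using db that unfolding dual_basis_def by blast
  have sum: "e = (\<Oplus>\<^bsub>E\<^esub>i\<in>{..<n}. \<phi> i e \<odot>\<^bsub>E\<^esub> b i)" if "e \<in> carrier E" for e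
    using db that unfolding dual_basis_def by blast
  have add: "\<phi> i (e \<oplus>\<^bsub>E\<^esub> e') = \<phi> i e \<oplus>\<^bsub>R\<^esub> \<phi> i e'" if "i < n" "e \<in> carrier E" "e' \<in> carrier E" for i e e'
    using db that unfolding dual_basis_def by blast
  have sm: "\<phi> i (r \<odot>\<^bsub>E\<^esub> e) = r \<otimes>\<^bsub>R\<^esub> \<phi> i e" if "i < n" "r \<in> carrier R" "e \<in> carrier E" for i r e
    using db that unfolding dual_basis_def by blast
  have "\<forall>i. \<exists>w. i < n \<longrightarrow> w \<in> carrier \<Omega> \<and> h1 w = b i" using h1_surj b by (metis (no_types, lifting) imageE)
  then obtain w where w: "\<And>i. i < n \<Longrightarrow> w i \<in> carrier \<Omega>" "\<And>i. i < n \<Longrightarrow> h1 (w i) = b i" by metis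
  define k where "k = (\<lambda>e. \<Oplus>\<^bsub>\<Omega>\<^esub>i\<in>{..<n}. \<phi> i e \<odot>\<^bsub>\<Omega>\<^esub> w i)"
  have t: "\<phi> i e \<odot>\<^bsub>\<Omega>\<^esub> w i \<in> carrier \<Omega>" if "i < n" "e \<in> carrier E" for i e using \<phi> w that by simp
  have "linear_map R E \<Omega> k"
  proof (rule linear_mapI)
    fix e assume e: "e \<in> carrier E"
    show "k e \<in> carrier \<Omega>" unfolding k_def using t e by (intro O.M.finsum_closed) auto
    fix e' assume e': "e' \<in> carrier E"
    have "k (e \<oplus>\<^bsub>E\<^esub> e') = (\<Oplus>\<^bsub>\<Omega>\<^esub>i\<in>{..<n}. \<phi> i e \<odot>\<^bsub>\<Omega>\<^esub> w i \<oplus>\<^bsub>\<Omega>\<^esub> \<phi> i e' \<odot>\<^bsub>\<Omega>\<^esub> w i)"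
      unfolding k_def using t e e' add \<phi> w by (intro O.M.finsum_cong') (auto simp: O.smult_l_distr)
    also have "\<dots> = k e \<oplus>\<^bsub>\<Omega>\<^esub> k e'" unfolding k_def using t e e' by (intro O.M.finsum_addf) auto
    finally show "k (e \<oplus>\<^bsub>E\<^esub> e') = k e \<oplus>\<^bsub>\<Omega>\<^esub> k e'" .
  next
    fix r e assume r: "r \<in> carrier R" and e: "e \<in> carrier E"
    have "k (r \<odot>\<^bsub>E\<^esub> e) = (\<Oplus>\<^bsub>\<Omega>\<^esub>i\<in>{..<n}. r \<odot>\<^bsub>\<Omega>\<^esub> (\<phi> i e \<odot>\<^bsub>\<Omega>\<^esub> w i))"
      unfolding k_def using t r e sm \<phi> w by (intro O.M.finsum_cong') (auto simp: O.smult_assoc1)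
    also have "\<dots> = r \<odot>\<^bsub>\<Omega>\<^esub> k e" unfolding k_def using t r e by (intro O.finsum_smult_ldistr[symmetric]) auto
    finally show "k (r \<odot>\<^bsub>E\<^esub> e) = r \<odot>\<^bsub>\<Omega>\<^esub> k e" .
  qed
  moreover have "h1 (k e) = e" if e: "e \<in> carrier E" for e
  proof -
    have "h1 (k e) = (\<Oplus>\<^bsub>E\<^esub>i\<in>{..<n}. h1 (\<phi> i e \<odot>\<^bsub>\<Omega>\<^esub> w i))"
      unfolding k_def by (rule linear_map_finsum[OF O.module_axioms M.module_axioms h1 t[OF _ e]])
    also have "\<dots> = (\<Oplus>\<^bsub>E\<^esub>i\<in>{..<n}. \<phi> i e \<odot>\<^bsub>E\<^esub> b i)"
      using linear_mapD(3)[OF h1] \<phi> e w b by (intro M.M.finsum_cong') auto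
    finally show ?thesis using sum[OF e] by simp
  qed
  ultimately show ?thesis by blast
qed

text \<open>Modulo \<open>\<mm>\<^sub>x \<Omega>\<close> the coefficients of a differential form may be replaced by their values at \<open>x\<close>.\<close>

lemma form_at_point:
  assumes x: "point K R x" and S: "S \<subseteq> carrier R" and w: "w \<in> ispan R \<Omega> (carrier R) (dd ` S)"
  shows "\<exists>f\<in>mx x. \<exists>z\<in>ispan R \<Omega> (mx x) (dd ` S). w = dd f \<oplus>\<^bsub>\<Omega>\<^esub> z"
proof -
  interpret O: module R \<Omega> by (rule kaehler_module[OF KR])
  note d = kaehler_d_derivation[OF KR]
  interpret Kf: field K by (rule K_field)
  interpret xh: ring_hom_ring R K x by (rule x_hom[OF x])
  show ?thesis
    using w
  proof induction
    case zero
    show ?case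
      using derivation_zero[OF M.R.is_cring O.module_axioms d] ispan.zero zero_mx[OF x]
      by (intro bexI[of _ "\<zero>\<^bsub>R\<^esub>"] bexI[OF _ ispan.zero]) auto
  next
    case (step a c w)
    then obtain f z where fz: "f \<in> mx x" "z \<in> ispan R \<Omega> (mx x) (dd ` S)" "w = dd f \<oplus>\<^bsub>\<Omega>\<^esub> z" by blast
    obtain t where t: "t \<in> S" "c = dd t" using step by auto
    have tR: "t \<in> carrier R" "f \<in> carrier R" using t S fz mx_iff[OF x] by auto
    have dS: "dd ` S \<subseteq> carrier \<Omega>" using S derivationD(1)[OF d] by blast
    have zO: "z \<in> carrier \<Omega>" using O.ispan_closed[OF mx_ideal[OF x] dS fz(2)] .
    have xc: "x r \<in> carrier K" if "r \<in> carrier R" for r using that by (rule xh.hom_closed)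
    have xs: "x (k \<odot>\<^bsub>R\<^esub> r) = k \<otimes>\<^bsub>K\<^esub> x r" if "k \<in> carrier K" "r \<in> carrier R" for k r
      using x that unfolding point_def by blast
    have sub: "r \<ominus>\<^bsub>R\<^esub> x r \<odot>\<^bsub>R\<^esub> \<one>\<^bsub>R\<^esub> \<in> mx x" if r: "r \<in> carrier R" for r
    proof -
      have c: "x r \<odot>\<^bsub>R\<^esub> \<one>\<^bsub>R\<^esub> \<in> carrier R" by (rule scalar_closed[OF xc[OF r]])
      have "x (r \<ominus>\<^bsub>R\<^esub> x r \<odot>\<^bsub>R\<^esub> \<one>\<^bsub>R\<^esub>) = x r \<oplus>\<^bsub>K\<^esub> \<ominus>\<^bsub>K\<^esub> x (x r \<odot>\<^bsub>R\<^esub> \<one>\<^bsub>R\<^esub>)"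
        unfolding a_minus_def using r c by simp
      also have "x (x r \<odot>\<^bsub>R\<^esub> \<one>\<^bsub>R\<^esub>) = x r" using xs[OF xc[OF r] M.R.one_closed] xc[OF r] by simp
      finally have "x (r \<ominus>\<^bsub>R\<^esub> x r \<odot>\<^bsub>R\<^esub> \<one>\<^bsub>R\<^esub>) = \<zero>\<^bsub>K\<^esub>" using xc[OF r] Kf.r_neg by simp
      then show ?thesis unfolding mx_iff[OF x] using r c by simp
    qed
    \<comment> \<open>\<open>k\<close> is the constant function with the value of \<open>a\<close>
      at \<open>x\<close>, and \<open>t'\<close> is \<open>t\<close> minus its value at
      \<open>x\<close>. Constants have zero differential, so
      \<open>a dt = d (k t') + (a - k) dt\<close>, where \<open>k t'\<close> and
      \<open>a - k\<close> vanish at \<open>x\<close>.\<close>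
    define k where "k = x a \<odot>\<^bsub>R\<^esub> \<one>\<^bsub>R\<^esub>"
    define t' where "t' = t \<ominus>\<^bsub>R\<^esub> x t \<odot>\<^bsub>R\<^esub> \<one>\<^bsub>R\<^esub>"
    have k: "k \<in> carrier R" unfolding k_def by (rule scalar_closed[OF xc[OF step(1)]])
    have ct: "x t \<odot>\<^bsub>R\<^esub> \<one>\<^bsub>R\<^esub> \<in> carrier R" by (rule scalar_closed[OF xc[OF tR(1)]])
    have t': "t' \<in> mx x" "t' \<in> carrier R" using sub[OF tR(1)] tR ct by (auto simp: t'_def)
    have dt': "dd t' = dd t"
    proof -
      have "t = t' \<oplus>\<^bsub>R\<^esub> x t \<odot>\<^bsub>R\<^esub> \<one>\<^bsub>R\<^esub>" using tR ct by (simp add: t'_def M.R.minus_eq M.R.a_assoc M.R.l_neg)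
      then have "dd t = dd t' \<oplus>\<^bsub>\<Omega>\<^esub> dd (x t \<odot>\<^bsub>R\<^esub> \<one>\<^bsub>R\<^esub>)" using derivationD(2)[OF d t'(2) ct] by simp
      then show ?thesis
        using derivation_scalar[OF KR O.module_axioms d xc[OF tR(1)]] derivationD(1)[OF d t'(2)] by simp
    qed
    have kt': "k \<otimes>\<^bsub>R\<^esub> t' \<in> mx x" by (rule ideal.I_l_closed[OF mx_ideal[OF x] t'(1) k])
    have dk: "dd (k \<otimes>\<^bsub>R\<^esub> t') = k \<odot>\<^bsub>\<Omega>\<^esub> dd t"
      using derivationD(4)[OF d xc[OF step(1)] t'(2)] R_smult[OF xc[OF step(1)] t'(2)] dt' by (simp add: k_def)
    have ak: "a \<ominus>\<^bsub>R\<^esub> k \<in> mx x" using sub[OF step(1)] by (simp add: k_def)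
    have akR: "a = k \<oplus>\<^bsub>R\<^esub> (a \<ominus>\<^bsub>R\<^esub> k)" using step(1) k by (simp add: M.R.minus_eq M.R.a_lcomm M.R.r_neg)
    have dO: "dd t \<in> carrier \<Omega>" "dd f \<in> carrier \<Omega>" using derivationD(1)[OF d] tR by auto
    have "a \<odot>\<^bsub>\<Omega>\<^esub> c = k \<odot>\<^bsub>\<Omega>\<^esub> dd t \<oplus>\<^bsub>\<Omega>\<^esub> (a \<ominus>\<^bsub>R\<^esub> k) \<odot>\<^bsub>\<Omega>\<^esub> dd t"
      unfolding t(2) by (subst akR) (use k step(1) dO in \<open>simp add: O.smult_l_distr\<close>)
    then have "a \<odot>\<^bsub>\<Omega>\<^esub> c \<oplus>\<^bsub>\<Omega>\<^esub> w = (k \<odot>\<^bsub>\<Omega>\<^esub> dd t \<oplus>\<^bsub>\<Omega>\<^esub> dd f) \<oplus>\<^bsub>\<Omega>\<^esub> ((a \<ominus>\<^bsub>R\<^esub> k) \<odot>\<^bsub>\<Omega>\<^esub> dd t \<oplus>\<^bsub>\<Omega>\<^esub> z)"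
      using k step(1) dO zO fz(3) by (simp add: O.M.a_assoc O.M.a_lcomm)
    also have "k \<odot>\<^bsub>\<Omega>\<^esub> dd t \<oplus>\<^bsub>\<Omega>\<^esub> dd f = dd (k \<otimes>\<^bsub>R\<^esub> t' \<oplus>\<^bsub>R\<^esub> f)"
      using derivationD(2)[OF d, of "k \<otimes>\<^bsub>R\<^esub> t'" f] dk k t' tR by simp
    finally have eq: "a \<odot>\<^bsub>\<Omega>\<^esub> c \<oplus>\<^bsub>\<Omega>\<^esub> w = dd (k \<otimes>\<^bsub>R\<^esub> t' \<oplus>\<^bsub>R\<^esub> f) \<oplus>\<^bsub>\<Omega>\<^esub> ((a \<ominus>\<^bsub>R\<^esub> k) \<odot>\<^bsub>\<Omega>\<^esub> dd t \<oplus>\<^bsub>\<Omega>\<^esub> z)" .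
    have "(a \<ominus>\<^bsub>R\<^esub> k) \<odot>\<^bsub>\<Omega>\<^esub> dd t \<oplus>\<^bsub>\<Omega>\<^esub> z \<in> ispan R \<Omega> (mx x) (dd ` S)"
      using ak t fz(2) by (intro ispan.step) auto
    moreover have "k \<otimes>\<^bsub>R\<^esub> t' \<oplus>\<^bsub>R\<^esub> f \<in> mx x"
      using additive_subgroup.a_closed[OF ideal.axioms(1)[OF mx_ideal[OF x]] kt' fz(1)] .
    ultimately show ?case using eq by blast
  qed
qed

text \<open>Nakayama's lemma with the zero submodule, for the projections of the generators of
  \<open>\<Omega>\<close> to the kernel of \<open>h1\<close>; the section \<open>k\<close> is what
  makes these projections generate the kernel.\<close>

lemma h1_bij:
  assumes k: "linear_map R E \<Omega> k" "\<And>e. e \<in> carrier E \<Longrightarrow> h1 (k e) = e" and w: "w \<in> carrier \<Omega>"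
  shows "k (h1 w) = w"
proof -
  interpret O: module R \<Omega> by (rule kaehler_module[OF KR])
  note d = kaehler_d_derivation[OF KR]
  obtain S where S: "finite S" "S \<subseteq> carrier R" "ispan R \<Omega> (carrier R) (dd ` S) = carrier \<Omega>"
    using kaehler_fin_gen[OF KR fg] by blast
  have dS: "dd ` S \<subseteq> carrier \<Omega>" using S derivationD(1)[OF d] by blast
  \<comment> \<open>The projection to the kernel of \<open>h1\<close> along the image of
    \<open>k\<close>.\<close>
  define q where "q = (\<lambda>w. w \<ominus>\<^bsub>\<Omega>\<^esub> k (h1 w))"
  have c: "k (h1 w) \<in> carrier \<Omega>" "h1 w \<in> carrier E" if "w \<in> carrier \<Omega>" for w
    using linear_mapD(1)[OF k(1)] linear_mapD(1)[OF h1] that by auto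
  have q: "linear_map R \<Omega> \<Omega> q"
  proof (rule linear_mapI)
    fix v w assume v: "v \<in> carrier \<Omega>" and w: "w \<in> carrier \<Omega>"
    have "k (h1 (v \<oplus>\<^bsub>\<Omega>\<^esub> w)) = k (h1 v) \<oplus>\<^bsub>\<Omega>\<^esub> k (h1 w)"
      using linear_mapD(2)[OF h1 v w] linear_mapD(2)[OF k(1)] c v w by simp
    then show "q (v \<oplus>\<^bsub>\<Omega>\<^esub> w) = q v \<oplus>\<^bsub>\<Omega>\<^esub> q w"
      using v w c by (simp add: q_def O.M.minus_eq O.M.minus_add O.M.a_assoc O.M.a_lcomm)
  next
    fix r w assume r: "r \<in> carrier R" and w: "w \<in> carrier \<Omega>"
    have "k (h1 (r \<odot>\<^bsub>\<Omega>\<^esub> w)) = r \<odot>\<^bsub>\<Omega>\<^esub> k (h1 w)"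
      using linear_mapD(3)[OF h1 r w] linear_mapD(3)[OF k(1) r] c w by simp
    then show "q (r \<odot>\<^bsub>\<Omega>\<^esub> w) = r \<odot>\<^bsub>\<Omega>\<^esub> q w"
      using r w c by (simp add: q_def O.M.minus_eq O.smult_r_distr O.smult_r_minus)
  qed (use c in \<open>simp add: q_def\<close>)
  have h1q: "h1 (q w) = \<zero>\<^bsub>E\<^esub>" if w: "w \<in> carrier \<Omega>" for w
    using linear_map_minus[OF O.module_axioms M.module_axioms h1 w c(1)[OF w]] k(2)[OF c(2)[OF w]] c(2)[OF w]
    by (simp add: q_def M.M.minus_eq M.M.r_neg)
  have q_id: "q w = w" if w: "w \<in> carrier \<Omega>" "h1 w = \<zero>\<^bsub>E\<^esub>" for w
    using linear_map_zero[OF M.module_axioms O.module_axioms k(1)] w by (simp add: q_def O.M.minus_eq)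
  have "q ` dd ` S \<subseteq> {\<zero>\<^bsub>\<Omega>\<^esub>}"
  proof (rule nakayama_points[OF K KR fg O.module_axioms])
    show "submodule {\<zero>\<^bsub>\<Omega>\<^esub>} R \<Omega>" by (rule O.submoduleI) auto
    show "finite (q ` dd ` S)" using S by simp
    show "q ` dd ` S \<subseteq> carrier \<Omega>" using dS linear_mapD(1)[OF q] by blast
    fix x c assume x: "point K R x" and "c \<in> q ` dd ` S"
    then obtain w where w: "w \<in> carrier \<Omega>" "c = q w" using dS by blast
    have cO: "c \<in> carrier \<Omega>" "h1 c = \<zero>\<^bsub>E\<^esub>" using w linear_mapD(1)[OF q] h1q by auto
    note mx = mx_ideal[OF x]
    obtain f z where fz: "f \<in> mx x" "z \<in> ispan R \<Omega> (mx x) (dd ` S)" "c = dd f \<oplus>\<^bsub>\<Omega>\<^esub> z"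
      using form_at_point[OF x S(2), of c] cO S(3) by blast
    have fO: "dd f \<in> carrier \<Omega>" "z \<in> carrier \<Omega>"
      using fz derivationD(1)[OF d] mx_iff[OF x] O.ispan_closed[OF mx dS] by auto
    have hz: "h1 z \<in> ispan R E (mx x) (carrier E)"
    proof (rule M.ispan_mono)
      show "h1 z \<in> ispan R E (mx x) (h1 ` dd ` S)"
        by (rule ispan_image[OF O.module_axioms M.module_axioms h1 mx dS fz(2)])
      show "h1 ` dd ` S \<subseteq> carrier E" using dS linear_mapD(1)[OF h1] by blast
    qed
    \<comment> \<open>\<open>h1\<close> kills \<open>c\<close>, so \<open>h1 (dd f)\<close> is the
      negative of an element of m_x \<open>E\<close>, as \<open>fibre_inj\<close> requires.\<close>
    have "h1 (dd f) \<oplus>\<^bsub>E\<^esub> h1 z = \<zero>\<^bsub>E\<^esub>" using cO(2) linear_mapD(2)[OF h1 fO] fz(3) by simp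
    then have "h1 (dd f) = \<ominus>\<^bsub>E\<^esub> h1 z" using linear_mapD(1)[OF h1] fO M.M.minus_equality by metis
    also have "\<dots> = (\<ominus>\<^bsub>R\<^esub> \<one>\<^bsub>R\<^esub>) \<odot>\<^bsub>E\<^esub> h1 z" using linear_mapD(1)[OF h1 fO(2)] by (simp add: M.smult_l_minus)
    finally have "h1 (dd f) \<in> ispan R E (mx x) (carrier E)"
      using M.ispan_smult[OF mx subset_refl _ hz, of "\<ominus>\<^bsub>R\<^esub> \<one>\<^bsub>R\<^esub>"] by simp
    then have "f \<in> ideal_prod R (mx x) (mx x)" by (rule fibre_inj[OF x fz(1)])
    \<comment> \<open>For \<open>a\<close> and \<open>b\<close> in m_x, both terms of the Leibniz
      rule for the product \<open>a b\<close> have a coefficient in m_x.\<close>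
    then have "f \<in> carrier R \<and> dd f \<in> ispan R \<Omega> (mx x) (dd ` S)"
    proof induction
      case (prod a b)
      then have ab: "a \<in> carrier R" "b \<in> carrier R" using mx_iff[OF x] by auto
      have "a \<odot>\<^bsub>\<Omega>\<^esub> dd b \<oplus>\<^bsub>\<Omega>\<^esub> b \<odot>\<^bsub>\<Omega>\<^esub> dd a \<in> ispan R \<Omega> (mx x) (dd ` S)"
        using prod derivationD(1)[OF d] ab S(3)
        by (intro O.ispan_add[OF mx dS] O.ispan_smult_span[OF mx dS]) auto
      then show ?case using derivationD(3)[OF d ab] ab by simp
    next
      case (sum a b)
      then show ?case using derivationD(2)[OF d] O.ispan_add[OF mx dS] by simp
    qed
    then have "c \<in> ispan R \<Omega> (mx x) (dd ` S)" using fz O.ispan_add[OF mx dS] by simp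
    \<comment> \<open>\<open>q\<close> is linear and fixes \<open>c\<close>; applying it replaces
      the generators of \<open>\<Omega>\<close> by those of the kernel, over which Nakayama's lemma
      needs the relation.\<close>
    then have "q c \<in> ispan R \<Omega> (mx x) (q ` dd ` S)"
      by (rule ispan_image[OF O.module_axioms O.module_axioms q mx dS])
    then have cq: "c \<in> ispan R \<Omega> (mx x) (q ` dd ` S)" unfolding q_id[OF cO] .
    have "c = \<zero>\<^bsub>\<Omega>\<^esub> \<oplus>\<^bsub>\<Omega>\<^esub> c" using cO(1) by simp
    with cq show "\<exists>n\<in>{\<zero>\<^bsub>\<Omega>\<^esub>}. \<exists>y\<in>ispan R \<Omega> (a_kernel R K x) (q ` dd ` S). c = n \<oplus>\<^bsub>\<Omega>\<^esub> y" by blast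
  qed
  then have "dd ` S \<subseteq> {w \<in> carrier \<Omega>. q w = \<zero>\<^bsub>\<Omega>\<^esub>}" using dS by blast
  then have "w \<in> {w \<in> carrier \<Omega>. q w = \<zero>\<^bsub>\<Omega>\<^esub>}"
    using O.span_least[OF linear_map_kernel_submodule[OF O.module_axioms O.module_axioms q]] S(3) w by blast
  then show ?thesis using c w by (simp add: q_def O.M.minus_eq_zero_iff)
qed

end

section \<open>The isomorphism with the de Rham algebra\<close>

text \<open>The universal property concerns \<open>exterior_algebra R E\<close>;
  \<open>\<psi>\<close> turns it into a source of homomorphisms out of \<open>A\<close>, here of the
  one to the de Rham algebra that inverts \<open>H\<close> up to higher terms.\<close>

locale odd_field_model = odd_field K R E A s j Q u
  for K :: "'k ring" and R :: "('k, 'r, 'c) module_scheme" and E :: "('r, 'm, 'd) module_scheme"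
    and A :: "('k, 'a) superalgebra" and s :: "'r \<Rightarrow> 'a" and j :: "'m \<Rightarrow> 'a" and Q :: "'a \<Rightarrow> 'r \<times> 'm"
    and u :: "'a \<Rightarrow> 'a" +
  fixes \<psi> :: "'a \<Rightarrow> ('m list \<Rightarrow> 'r) set"
  assumes \<psi>: "\<psi> \<in> ring_hom A (exterior_algebra R E)"
    and \<psi>_s: "\<And>r. r \<in> carrier R \<Longrightarrow> \<psi> (s r) = ext_scalar R E r"
    and \<psi>_j: "\<And>e. e \<in> carrier E \<Longrightarrow> \<psi> (j e) = ext_vector R E e"
begin

abbreviation "DR \<equiv> de_rham_algebra K R"
abbreviation "\<iota> \<equiv> ext_scalar R \<Omega>"
abbreviation "\<nu> \<equiv> ext_vector R \<Omega>"

lemma DR_rep: "ext_rep R \<Omega> DR \<iota> \<nu>"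
  unfolding de_rham_algebra_def by (rule exterior_algebra_rep(1)[OF M.R.is_cring kaehler_module[OF KR]])

sublocale D: ext_rep R \<Omega> DR \<iota> \<nu> by (rule DR_rep)
sublocale H: ext_rep R \<Omega> A s h by (rule h_rep)

lemma DR_parts:
  "carrier DR = D.WS UNIV" "even_part DR = D.WS {n. even n}" "odd_part DR = D.WS {n. odd n}"
  unfolding de_rham_algebra_def by (rule exterior_algebra_parts[OF M.R.is_cring kaehler_module[OF KR]])+

lemma DR_smult: "c \<in> carrier K \<Longrightarrow> a \<in> carrier DR \<Longrightarrow> c \<odot>\<^bsub>DR\<^esub> a = \<iota> (c \<odot>\<^bsub>R\<^esub> \<one>\<^bsub>R\<^esub>) \<otimes>\<^bsub>DR\<^esub> a"
  unfolding de_rham_algebra_def by (rule exterior_algebra_smult[OF KR kaehler_module[OF KR]])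

definition "H = (SOME H. H \<in> ring_hom DR A \<and>
  (\<forall>r\<in>carrier R. H (\<iota> r) = s r) \<and> (\<forall>m\<in>carrier \<Omega>. H (\<nu> m) = h m))"

lemma H: "H \<in> ring_hom DR A" "r \<in> carrier R \<Longrightarrow> H (\<iota> r) = s r" "m \<in> carrier \<Omega> \<Longrightarrow> H (\<nu> m) = h m"
proof -
  have "\<exists>H. H \<in> ring_hom DR A \<and> (\<forall>r\<in>carrier R. H (\<iota> r) = s r) \<and> (\<forall>m\<in>carrier \<Omega>. H (\<nu> m) = h m)"
    using H.universal unfolding de_rham_algebra_def by blast
  then have "H \<in> ring_hom DR A \<and> (\<forall>r\<in>carrier R. H (\<iota> r) = s r) \<and> (\<forall>m\<in>carrier \<Omega>. H (\<nu> m) = h m)"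
    unfolding H_def by (rule someI_ex)
  then show "H \<in> ring_hom DR A" "r \<in> carrier R \<Longrightarrow> H (\<iota> r) = s r" "m \<in> carrier \<Omega> \<Longrightarrow> H (\<nu> m) = h m"
    by blast+
qed

lemma H_ring: "ring_hom_ring DR A H"
  by (rule ring_hom_ringI2[OF D.S.ring_axioms S.ring_axioms H(1)])

text \<open>With \<open>k\<close> inverse to \<open>\<Omega> \<rightarrow> E\<close> and \<open>G\<close> the homomorphism induced by \<open>k\<close>, the composite \<open>H \<circ> G\<close>
  is unipotent for the filtration of \<open>A\<close> by degree, and \<open>G\<close> is surjective.\<close>

lemma H_bij: "bij_betw H (carrier DR) (carrier A)"
proof -
  obtain k where k: "linear_map R E \<Omega> k" "\<And>e. e \<in> carrier E \<Longrightarrow> h1 (k e) = e" using h1_section by blast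
  have kO: "k e \<in> carrier \<Omega>" if "e \<in> carrier E" for e using linear_mapD(1)[OF k(1) that] .
  \<comment> \<open>Sections of \<open>E\<close>, regarded as forms through \<open>k\<close>,
    satisfy in the de Rham algebra the relations of the exterior algebra of
    \<open>E\<close>.\<close>
  interpret k: ext_rep R E DR \<iota> "\<lambda>e. \<nu> (k e)"
  proof (intro ext_rep.intro ext_rep_axioms.intro M.module_axioms D.S.ring_axioms D.\<rho>_hom)
    show "\<nu> (k m) \<otimes>\<^bsub>DR\<^esub> \<nu> (k m) = \<zero>\<^bsub>DR\<^esub>" if "m \<in> carrier E" for m
      by (rule D.g_sq[OF kO[OF that]])
    show "\<iota> r \<otimes>\<^bsub>DR\<^esub> a = a \<otimes>\<^bsub>DR\<^esub> \<iota> r" if "r \<in> carrier R" "a \<in> carrier DR" for r a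
      by (rule D.\<rho>_central[OF that])
  qed (use kO linear_mapD[OF k(1)] D.g_add D.g_smult in simp_all)
  obtain G where G: "G \<in> ring_hom (exterior_algebra R E) DR"
    "\<forall>r\<in>carrier R. G (ext_scalar R E r) = \<iota> r" "\<forall>m\<in>carrier E. G (ext_vector R E m) = \<nu> (k m)"
    using k.universal by blast
  define P where "P = G \<circ> \<psi>"
  have P: "P \<in> ring_hom A DR" unfolding P_def by (rule ring_hom_trans[OF \<psi> G(1)])
  interpret P: ring_hom_ring A DR P by (rule ring_hom_ringI2[OF S.ring_axioms D.S.ring_axioms P])
  interpret Hr: ring_hom_ring DR A H by (rule H_ring)
  have Ps: "P (s r) = \<iota> r" if "r \<in> carrier R" for r using G(2) \<psi>_s that by (simp add: P_def)
  have Pj: "P (j e) = \<nu> (k e)" if "e \<in> carrier E" for e using G(3) \<psi>_j that by (simp add: P_def)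
  define \<theta> where "\<theta> = H \<circ> P"
  have \<theta>: "\<theta> \<in> ring_hom A A" unfolding \<theta>_def by (rule ring_hom_trans[OF P H(1)])
  obtain F where F: "finite F" "F \<subseteq> carrier E" "ispan R E (carrier R) F = carrier E" using E_fin_gen by blast
  have \<theta>_bij: "bij_betw \<theta> (carrier A) (carrier A)"
  proof (rule unipotent_iso[OF \<theta> _ _ F gen])
    show "\<theta> (s r) = s r" if "r \<in> carrier R" for r using Ps H(2) that by (simp add: \<theta>_def)
    fix e assume e: "e \<in> carrier E"
    have te: "\<theta> (j e) = h (k e)" using Pj H(3) kO e by (simp add: \<theta>_def)
    \<comment> \<open>Values of \<open>h\<close> are odd, and the component of degree one is
      \<open>h1 (k e) = e\<close>; so \<open>\<theta> (j e)\<close> differs from \<open>j e\<close>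
      only in higher degrees.\<close>
    have hA: "h (k e) \<in> carrier A" "deg0 (h (k e)) = \<zero>\<^bsub>R\<^esub>" "deg1 (h (k e)) = e"
      using h_odd[OF kO[OF e]] parts_closed odd_deg0 k(2)[OF e] by (auto simp: h1_def)
    obtain f where f: "f \<in> WS {2..}" "h (k e) = s (deg0 (h (k e))) \<oplus>\<^bsub>A\<^esub> j (deg1 (h (k e))) \<oplus>\<^bsub>A\<^esub> f"
      using decompose[OF hA(1)] by blast
    have fA: "f \<in> carrier A" using wspan_closed[OF f(1)] .
    have "h (k e) = j e \<oplus>\<^bsub>A\<^esub> f" using f(2) hA e fA by simp
    then have "h (k e) \<ominus>\<^bsub>A\<^esub> j e = f"
      using e fA by (simp add: S.minus_eq S.a_assoc S.a_comm[of "j e" f] S.r_neg)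
    then show "\<theta> (j e) \<ominus>\<^bsub>A\<^esub> j e \<in> WS {2..}" using f(1) te by simp
  qed
  \<comment> \<open>By \<open>h1_bij\<close> every one-form is \<open>k\<close> of its image in
    \<open>E\<close>, so \<open>P\<close> reaches all generators of the de Rham algebra.\<close>
  have P_surj: "w \<in> P ` carrier A" if "w \<in> carrier DR" for w
  proof -
    have mul: "a \<otimes>\<^bsub>DR\<^esub> b \<in> P ` carrier A" if "a \<in> P ` carrier A" "b \<in> P ` carrier A" for a b
      using that by (auto simp flip: P.hom_mult)
    have add: "a \<oplus>\<^bsub>DR\<^esub> b \<in> P ` carrier A" if "a \<in> P ` carrier A" "b \<in> P ` carrier A" for a b
      using that by (auto simp flip: P.hom_add)
    have i: "\<iota> r \<in> P ` carrier A" if "r \<in> carrier R" for r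
      by (rule image_eqI[of _ _ "s r"]) (use Ps that in simp_all)
    have n: "\<nu> m \<in> P ` carrier A" if "m \<in> carrier \<Omega>" for m
    proof (rule image_eqI[of _ _ "j (h1 m)"])
      have c: "h1 m \<in> carrier E" using linear_mapD(1)[OF h1 that] .
      show "\<nu> m = P (j (h1 m))" using Pj[OF c] h1_bij[OF k that] by simp
      show "j (h1 m) \<in> carrier A" using c by simp
    qed
    have wp: "wprod DR \<nu> v \<in> P ` carrier A" if "v \<in> words \<Omega>" for v
      using that
    proof (induction v)
      case Nil
      show ?case using i[OF M.R.one_closed] by simp
    next
      case (Cons m v)
      then show ?case using mul n by simp
    qed
    have "w \<in> D.WS UNIV" using that DR_parts(1) by simp
    then show ?thesis
    proof induction
      case zero
      show ?case using i[OF M.R.zero_closed] by simp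
    next
      case (step r v y)
      then show ?case by (intro add mul i wp)
    qed
  qed
  \<comment> \<open>Injectivity of the composite \<open>\<theta>\<close> together with surjectivity
    of \<open>P\<close> makes \<open>H\<close> injective; surjectivity of \<open>\<theta>\<close>
    makes \<open>H\<close> surjective.\<close>
  show ?thesis
    unfolding bij_betw_def
  proof
    show "inj_on H (carrier DR)"
    proof (rule inj_onI)
      fix v w assume vw: "v \<in> carrier DR" "w \<in> carrier DR" "H v = H w"
      obtain a b where ab: "a \<in> carrier A" "v = P a" "b \<in> carrier A" "w = P b" using P_surj vw by blast
      then have "\<theta> a = \<theta> b" using vw by (simp add: \<theta>_def)
      then have "a = b" using \<theta>_bij ab by (auto simp: bij_betw_def inj_on_def)
      then show "v = w" using ab by simp
    qed
    show "H ` carrier DR = carrier A"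
    proof
      show "H ` carrier DR \<subseteq> carrier A" using Hr.hom_closed by blast
      show "carrier A \<subseteq> H ` carrier DR"
      proof
        fix a assume "a \<in> carrier A"
        then obtain b where "b \<in> carrier A" "a = \<theta> b" using \<theta>_bij by (auto simp: bij_betw_def)
        then show "a \<in> H ` carrier DR" by (auto simp: \<theta>_def)
      qed
    qed
  qed
qed

lemma H_smult: "c \<in> carrier K \<Longrightarrow> a \<in> carrier DR \<Longrightarrow> H (c \<odot>\<^bsub>DR\<^esub> a) = c \<odot>\<^bsub>A\<^esub> H a"
proof -
  assume c: "c \<in> carrier K" and a: "a \<in> carrier DR"
  interpret Hr: ring_hom_ring DR A H by (rule H_ring)
  have "H (c \<odot>\<^bsub>DR\<^esub> a) = H (\<iota> (c \<odot>\<^bsub>R\<^esub> \<one>\<^bsub>R\<^esub>)) \<otimes>\<^bsub>A\<^esub> H a"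
    unfolding DR_smult[OF c a] by (rule Hr.hom_mult[OF D.\<rho>_simps(1)[OF scalar_closed[OF c]] a])
  then show ?thesis using H(2)[OF scalar_closed[OF c]] smult[OF c Hr.hom_closed[OF a]] by simp
qed

text \<open>\<open>h\<close> is odd but need not be homogeneous, so of the word length only its
  parity survives in \<open>A\<close>.\<close>

lemma wprod_h_parity: "w \<in> words \<Omega> \<Longrightarrow>
  (even (length w) \<longrightarrow> wprod A h w \<in> even_part A) \<and> (odd (length w) \<longrightarrow> wprod A h w \<in> odd_part A)"
proof (induction w)
  case Nil
  then show ?case using s_even[OF M.R.one_closed] by simp
next
  case (Cons m w)
  then have m: "h m \<in> odd_part A" "w \<in> words \<Omega>" using h_odd by auto
  have oo: "a \<otimes>\<^bsub>A\<^esub> b \<in> even_part A" if "a \<in> odd_part A" "b \<in> odd_part A" for a b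
    unfolding even by (rule wspan_mult[OF that[unfolded odd]]) auto
  have oe: "a \<otimes>\<^bsub>A\<^esub> b \<in> odd_part A" if "a \<in> odd_part A" "b \<in> even_part A" for a b
    unfolding odd by (rule wspan_mult[OF that[unfolded odd even]]) auto
  show ?case using Cons.IH[OF m(2)] oo[OF m(1)] oe[OF m(1)] by auto
qed

lemma H_even: "a \<in> even_part DR \<Longrightarrow> H a \<in> even_part A"
  and H_odd: "a \<in> odd_part DR \<Longrightarrow> H a \<in> odd_part A"
proof -
  have "a \<in> even_part A" if "a \<in> H.WS {n. even n}" for a
    using that
  proof induction
    case zero
    show ?case unfolding even by (rule wspan.zero)
  next
    case (step r w y)
    then have "wprod A h w \<in> even_part A" using wprod_h_parity by simp
    then show ?case using step wspan_smult wspan_add unfolding even by simp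
  qed
  then show "a \<in> even_part DR \<Longrightarrow> H a \<in> even_part A"
    using D.hom_wspan[OF h_rep H] unfolding DR_parts by blast
  have "a \<in> odd_part A" if "a \<in> H.WS {n. odd n}" for a
    using that
  proof induction
    case zero
    show ?case unfolding odd by (rule wspan.zero)
  next
    case (step r w y)
    then have "wprod A h w \<in> odd_part A" using wprod_h_parity by simp
    then show ?case using step wspan_smult wspan_add unfolding odd by simp
  qed
  then show "a \<in> odd_part DR \<Longrightarrow> H a \<in> odd_part A"
    using D.hom_wspan[OF h_rep H] unfolding DR_parts by blast
qed

lemma DR_sum:
  assumes "w \<in> carrier DR"
  shows "\<exists>v\<in>even_part DR. \<exists>v'\<in>odd_part DR. w = v \<oplus>\<^bsub>DR\<^esub> v'"
proof -
  have "{n. even n} \<union> {n. odd n} = (UNIV :: nat set)" by auto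
  then show ?thesis using D.wspan_Un[of w "{n. even n}" "{n. odd n}"] assms unfolding DR_parts by simp
qed

lemma DR_parts_closed: "a \<in> even_part DR \<Longrightarrow> a \<in> carrier DR" "a \<in> odd_part DR \<Longrightarrow> a \<in> carrier DR"
  unfolding DR_parts(2,3) using D.wspan_closed by auto

lemma parts_Int: "a \<in> even_part A \<Longrightarrow> a \<in> odd_part A \<Longrightarrow> a = \<zero>\<^bsub>A\<^esub>"
  using A unfolding superalgebra_def by blast

text \<open>If the image is even, the odd part of the element has an image that is both even and
  odd, hence zero, and \<open>H\<close> is injective; the other case is symmetric.\<close>

lemma H_parts_iff:
  assumes w: "w \<in> carrier DR"
  shows "H w \<in> even_part A \<longleftrightarrow> w \<in> even_part DR" "H w \<in> odd_part A \<longleftrightarrow> w \<in> odd_part DR"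
proof -
  interpret Hr: ring_hom_ring DR A H by (rule H_ring)
  obtain v v' where v: "v \<in> even_part DR" "v' \<in> odd_part DR" "w = v \<oplus>\<^bsub>DR\<^esub> v'" using DR_sum[OF w] by blast
  have c: "v \<in> carrier DR" "v' \<in> carrier DR" using v DR_parts_closed by auto
  have Hv: "H v \<in> even_part A" "H v' \<in> odd_part A" using v H_even H_odd by auto
  have Hc: "H v \<in> carrier A" "H v' \<in> carrier A" using c by auto
  have eq: "H w = H v \<oplus>\<^bsub>A\<^esub> H v'" using v(3) c by simp
  have inj: "a = \<zero>\<^bsub>DR\<^esub>" if "a \<in> carrier DR" "H a = \<zero>\<^bsub>A\<^esub>" for a
    using H_bij that Hr.hom_zero unfolding bij_betw_def inj_on_def by (metis D.S.zero_closed)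
  show "H w \<in> even_part A \<longleftrightarrow> w \<in> even_part DR"
  proof
    assume e: "H w \<in> even_part A"
    have "H v' = H w \<oplus>\<^bsub>A\<^esub> \<ominus>\<^bsub>A\<^esub> H v" 
      unfolding eq using Hc by (simp add: S.a_comm[of "H v" "H v'"] S.a_assoc S.r_neg)
    then have "H v' \<in> even_part A" using e Hv(1) wspan_add wspan_a_inv unfolding even by simp
    then have "H v' = \<zero>\<^bsub>A\<^esub>" using parts_Int Hv by blast
    then show "w \<in> even_part DR" using inj[OF c(2)] v c by simp
  qed (rule H_even)
  show "H w \<in> odd_part A \<longleftrightarrow> w \<in> odd_part DR"
  proof
    assume e: "H w \<in> odd_part A"
    have "H v = H w \<oplus>\<^bsub>A\<^esub> \<ominus>\<^bsub>A\<^esub> H v'" using eq Hc by (simp add: S.a_assoc S.r_neg)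
    then have "H v \<in> odd_part A" using e Hv(2) wspan_add wspan_a_inv unfolding odd by simp
    then have "H v = \<zero>\<^bsub>A\<^esub>" using parts_Int Hv by blast
    then show "w \<in> odd_part DR" using inj[OF c(1)] v c by simp
  qed (rule H_odd)
qed

section \<open>The inverse isomorphism and the transport of \<open>u\<close>\<close>

definition "\<phi> = inv_into (carrier DR) H"

lemma \<phi>_H: "w \<in> carrier DR \<Longrightarrow> \<phi> (H w) = w"
  unfolding \<phi>_def using H_bij by (intro inv_into_f_f) (auto simp: bij_betw_def)

lemma H_\<phi>: "a \<in> carrier A \<Longrightarrow> H (\<phi> a) = a"
  unfolding \<phi>_def using H_bij by (intro f_inv_into_f) (auto simp: bij_betw_def)

lemma \<phi>_closed: "a \<in> carrier A \<Longrightarrow> \<phi> a \<in> carrier DR"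
  unfolding \<phi>_def using H_bij by (intro inv_into_into) (auto simp: bij_betw_def)

lemma \<phi>_hom: "\<phi> \<in> ring_hom A DR"
proof -
  interpret Hr: ring_hom_ring DR A H by (rule H_ring)
  show ?thesis
  proof (rule ring_hom_memI)
    fix a b assume a: "a \<in> carrier A" and b: "b \<in> carrier A"
    note c = \<phi>_closed[OF a] \<phi>_closed[OF b]
    have "H (\<phi> a \<otimes>\<^bsub>DR\<^esub> \<phi> b) = a \<otimes>\<^bsub>A\<^esub> b" using c a b H_\<phi> by simp
    then show "\<phi> (a \<otimes>\<^bsub>A\<^esub> b) = \<phi> a \<otimes>\<^bsub>DR\<^esub> \<phi> b" using \<phi>_H[of "\<phi> a \<otimes>\<^bsub>DR\<^esub> \<phi> b"] c by simp
    have "H (\<phi> a \<oplus>\<^bsub>DR\<^esub> \<phi> b) = a \<oplus>\<^bsub>A\<^esub> b" using c a b H_\<phi> by simp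
    then show "\<phi> (a \<oplus>\<^bsub>A\<^esub> b) = \<phi> a \<oplus>\<^bsub>DR\<^esub> \<phi> b" using \<phi>_H[of "\<phi> a \<oplus>\<^bsub>DR\<^esub> \<phi> b"] c by simp
  next
    show "\<phi> \<one>\<^bsub>A\<^esub> = \<one>\<^bsub>DR\<^esub>" using \<phi>_H[of "\<one>\<^bsub>DR\<^esub>"] Hr.hom_one by simp
  qed (rule \<phi>_closed)
qed

lemma \<phi>_smult: "c \<in> carrier K \<Longrightarrow> a \<in> carrier A \<Longrightarrow> \<phi> (c \<odot>\<^bsub>A\<^esub> a) = c \<odot>\<^bsub>DR\<^esub> \<phi> a"
proof -
  assume c: "c \<in> carrier K" and a: "a \<in> carrier A"
  have d: "c \<odot>\<^bsub>DR\<^esub> \<phi> a \<in> carrier DR"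
    unfolding DR_smult[OF c \<phi>_closed[OF a]] using \<phi>_closed[OF a] scalar_closed[OF c] by simp
  show ?thesis using \<phi>_H[OF d] H_smult[OF c \<phi>_closed[OF a]] H_\<phi>[OF a] by simp
qed

lemma \<phi>_parts: "\<phi> ` even_part A = even_part DR" "\<phi> ` odd_part A = odd_part DR"
proof -
  have "\<phi> a \<in> even_part DR" if "a \<in> even_part A" for a
    using H_parts_iff(1)[OF \<phi>_closed[OF parts_closed(1)[OF that]]] H_\<phi>[OF parts_closed(1)[OF that]] that by simp
  moreover have "w \<in> \<phi> ` even_part A" if "w \<in> even_part DR" for w
    using \<phi>_H[OF DR_parts_closed(1)[OF that]] H_even[OF that] by (intro image_eqI[of _ _ "H w"]) simp_all
  ultimately show "\<phi> ` even_part A = even_part DR" by blast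
  have "\<phi> a \<in> odd_part DR" if "a \<in> odd_part A" for a
    using H_parts_iff(2)[OF \<phi>_closed[OF parts_closed(2)[OF that]]] H_\<phi>[OF parts_closed(2)[OF that]] that by simp
  moreover have "w \<in> \<phi> ` odd_part A" if "w \<in> odd_part DR" for w
    using \<phi>_H[OF DR_parts_closed(2)[OF that]] H_odd[OF that] by (intro image_eqI[of _ _ "H w"]) simp_all
  ultimately show "\<phi> ` odd_part A = odd_part DR" by blast
qed

lemma \<phi>_iso: "superalgebra_iso K A DR \<phi>"
  unfolding superalgebra_iso_def
proof (intro conjI \<phi>_parts)
  have "bij_betw \<phi> (carrier A) (carrier DR)" unfolding \<phi>_def by (rule bij_betw_inv_into[OF H_bij])
  then show "\<phi> \<in> ring_iso A DR" using \<phi>_hom by (simp add: ring_iso_def)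
  show "linear_map K A DR \<phi>"
    by (rule linear_mapI) (use \<phi>_closed \<phi>_smult ring_hom_add[OF \<phi>_hom] in auto)
qed

text \<open>The restriction to the carrier matches the normalisation in
  \<open>de_rham_d\<close>.\<close>

definition "d = (\<lambda>w\<in>carrier DR. \<phi> (u (H w)))"

abbreviation "dR_spec \<delta> \<equiv> \<delta> \<in> extensional (carrier DR) \<and> odd_superderivation K DR \<delta> \<and>
  (\<forall>f\<in>carrier R. \<delta> (\<iota> f) = \<nu> (dd f)) \<and> (\<forall>w\<in>carrier DR. \<delta> (\<delta> w) = \<zero>\<^bsub>DR\<^esub>)"

text \<open>Identities are compared after applying the injective map \<open>H\<close>, which turns
  \<open>d\<close> into \<open>u\<close>. On functions the value is right because
  \<open>H (\<nu> (dd f)) = h (dd f) = u (s f)\<close>, and the square vanishes because that of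
  \<open>u\<close> does.\<close>

lemma d_spec: "dR_spec d"
proof (intro conjI ballI)
  interpret Hr: ring_hom_ring DR A H by (rule H_ring)
  interpret p: ring_hom_ring A DR \<phi> by (rule ring_hom_ringI2[OF S.ring_axioms D.S.ring_axioms \<phi>_hom])
  have dc: "d w \<in> carrier DR" if "w \<in> carrier DR" for w
    using that \<phi>_closed u_simps(1) Hr.hom_closed by (simp add: d_def)
  have Hd: "H (d w) = u (H w)" if "w \<in> carrier DR" for w
    using that H_\<phi> u_simps(1) Hr.hom_closed by (simp add: d_def)
  have eqI: "v = w" if "v \<in> carrier DR" "w \<in> carrier DR" "H v = H w" for v w
    using that \<phi>_H by metis
  have Hc: "H w \<in> carrier A" if "w \<in> carrier DR" for w using that by (rule Hr.hom_closed)
  show "d \<in> extensional (carrier DR)" by (simp add: d_def)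
  show "odd_superderivation K DR d"
    unfolding odd_superderivation_def
  proof (intro conjI ballI)
    show "linear_map K DR DR d"
    proof (rule linear_mapI)
      fix v w assume v: "v \<in> carrier DR" and w: "w \<in> carrier DR"
      show "d (v \<oplus>\<^bsub>DR\<^esub> w) = d v \<oplus>\<^bsub>DR\<^esub> d w"
        by (rule eqI) (use v w dc Hd Hc u_simps(2) in simp_all)
    next
      fix c w assume c: "c \<in> carrier K" and w: "w \<in> carrier DR"
      have cl: "c \<odot>\<^bsub>DR\<^esub> v \<in> carrier DR" if "v \<in> carrier DR" for v
        using DR_smult[OF c that] that scalar_closed[OF c] by simp
      show "d (c \<odot>\<^bsub>DR\<^esub> w) = c \<odot>\<^bsub>DR\<^esub> d w"
        by (rule eqI) (use c w cl dc Hd Hc H_smult u_simps(3) in simp_all)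
    qed (rule dc)
    show "d ` even_part DR \<subseteq> odd_part DR"
    proof
      fix w assume "w \<in> d ` even_part DR"
      then obtain v where v: "v \<in> even_part DR" "w = d v" by auto
      have "H w \<in> odd_part A" using Hd[OF DR_parts_closed(1)[OF v(1)]] u_simps(4)[OF H_even[OF v(1)]] v(2) by simp
      then show "w \<in> odd_part DR" using H_parts_iff(2)[OF dc[OF DR_parts_closed(1)[OF v(1)]]] v(2) by simp
    qed
    show "d ` odd_part DR \<subseteq> even_part DR"
    proof
      fix w assume "w \<in> d ` odd_part DR"
      then obtain v where v: "v \<in> odd_part DR" "w = d v" by auto
      have "H w \<in> even_part A" using Hd[OF DR_parts_closed(2)[OF v(1)]] u_simps(5)[OF H_odd[OF v(1)]] v(2) by simp
      then show "w \<in> even_part DR" using H_parts_iff(1)[OF dc[OF DR_parts_closed(2)[OF v(1)]]] v(2) by simp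
    qed
    fix w assume w: "w \<in> carrier DR"
    show "d (v \<otimes>\<^bsub>DR\<^esub> w) = d v \<otimes>\<^bsub>DR\<^esub> w \<oplus>\<^bsub>DR\<^esub> v \<otimes>\<^bsub>DR\<^esub> d w" if v: "v \<in> even_part DR" for v
      by (rule eqI) (use v w dc Hd Hc u_simps(6)[OF H_even[OF v]] DR_parts_closed(1)[OF v] in simp_all)
    show "d (v \<otimes>\<^bsub>DR\<^esub> w) = d v \<otimes>\<^bsub>DR\<^esub> w \<ominus>\<^bsub>DR\<^esub> v \<otimes>\<^bsub>DR\<^esub> d w" if v: "v \<in> odd_part DR" for v
      by (rule eqI) (use v w dc Hd Hc u_simps(7)[OF H_odd[OF v]] DR_parts_closed(2)[OF v] in
        \<open>simp_all add: S.minus_eq D.S.minus_eq\<close>)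
  qed
  show "d (\<iota> f) = \<nu> (dd f)" if f: "f \<in> carrier R" for f
  proof (rule eqI)
    have df: "dd f \<in> carrier \<Omega>" by (rule derivationD(1)[OF kaehler_d_derivation[OF KR] f])
    show "d (\<iota> f) \<in> carrier DR" "\<nu> (dd f) \<in> carrier DR" using dc f df by simp_all
    show "H (d (\<iota> f)) = H (\<nu> (dd f))" using Hd[of "\<iota> f"] f H(2)[OF f] H(3)[OF df] h(2)[OF f] by simp
  qed
  show "d (d w) = \<zero>\<^bsub>DR\<^esub>" if w: "w \<in> carrier DR" for w
    by (rule eqI) (use w dc Hd Hc u_simps(8) in simp_all)
qed

text \<open>Two such derivations agree on functions by assumption and on exact differentials because
  both kill them. The one-forms on which they agree are a submodule, hence all of them, and the
  Leibniz rule extends the agreement to products.\<close>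

lemma dR_unique:
  assumes d1: "dR_spec d1" and d2: "dR_spec d2"
  shows "d1 = d2"
proof (rule extensionalityI)
  show "d1 \<in> extensional (carrier DR)" "d2 \<in> extensional (carrier DR)" using d1 d2 by auto
  define Z where "Z = {w \<in> carrier DR. d1 w = d2 w}"
  have sd: "odd_superderivation K DR d1" "odd_superderivation K DR d2" using d1 d2 by auto
  note D1 = sd(1)[unfolded odd_superderivation_def linear_map_def]
  note D2 = sd(2)[unfolded odd_superderivation_def linear_map_def]
  have add: "a \<oplus>\<^bsub>DR\<^esub> b \<in> Z" if "a \<in> Z" "b \<in> Z" for a b
    using that D1 D2 by (simp add: Z_def)
  \<comment> \<open>The Leibniz rule is available for a homogeneous left factor only; functions and
    one-forms, from which all words are built, are homogeneous.\<close>
  have mul: "a \<otimes>\<^bsub>DR\<^esub> b \<in> Z" if "a \<in> Z" "b \<in> Z" "a \<in> even_part DR \<or> a \<in> odd_part DR" for a b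
    using that D1 D2 unfolding Z_def by auto
  have ev: "\<iota> f \<in> even_part DR" if "f \<in> carrier R" for f
    unfolding DR_parts using D.wspan_single[of f "[]" "{n. even n}"] that by simp
  have od: "\<nu> m \<in> odd_part DR" if "m \<in> carrier \<Omega>" for m
    unfolding DR_parts using D.wspan_single[of "\<one>\<^bsub>R\<^esub>" "[m]" "{n. odd n}"] that by simp
  have i: "\<iota> f \<in> Z" if "f \<in> carrier R" for f using that d1 d2 by (simp add: Z_def)
  note der = kaehler_d_derivation[OF KR]
  define B where "B = {m \<in> carrier \<Omega>. \<nu> m \<in> Z}"
  have sm: "r \<odot>\<^bsub>\<Omega>\<^esub> m \<in> B" if "r \<in> carrier R" "m \<in> B" for r m
    using that mul[OF i _ disjI1[OF ev]] by (simp add: B_def D.g_smult)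
  have "submodule B R \<Omega>"
  proof (rule D.M.submoduleI)
    show "\<zero>\<^bsub>\<Omega>\<^esub> \<in> B" using i[OF M.R.zero_closed] by (simp add: B_def D.g_zero)
    show "\<ominus>\<^bsub>\<Omega>\<^esub> m \<in> B" if "m \<in> B" for m
      using sm[of "\<ominus>\<^bsub>R\<^esub> \<one>\<^bsub>R\<^esub>" m] that by (simp add: B_def D.M.smult_l_minus)
    show "m \<oplus>\<^bsub>\<Omega>\<^esub> n \<in> B" if "m \<in> B" "n \<in> B" for m n
      using add that by (simp add: B_def D.g_add)
  qed (use sm in \<open>auto simp: B_def\<close>)
  moreover have "dd f \<in> B" if f: "f \<in> carrier R" for f
  proof -
    have df: "dd f \<in> carrier \<Omega>" by (rule derivationD(1)[OF der f])
    \<comment> \<open>An exact differential is the derivative of a function under either derivation,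
      so both squares being zero makes both values zero.\<close>
    have "d1 (\<nu> (dd f)) = d1 (d1 (\<iota> f))" using d1 f by simp
    also have "\<dots> = d2 (d2 (\<iota> f))" using d1 d2 D.\<rho>_simps(1)[OF f] by simp
    also have "\<dots> = d2 (\<nu> (dd f))" using d2 f by simp
    finally show ?thesis using df by (simp add: B_def Z_def)
  qed
  ultimately have "B = carrier \<Omega>" by (rule kaehler_generated[OF KR])
  then have n: "\<nu> m \<in> Z" if "m \<in> carrier \<Omega>" for m using that by (auto simp: B_def)
  have wp: "wprod DR \<nu> w \<in> Z" if "w \<in> words \<Omega>" for w
    using that
  proof (induction w)
    case Nil
    show ?case using i[OF M.R.one_closed] by simp
  next
    case (Cons m w)
    then show ?case using mul[OF n _ disjI2[OF od]] by simp
  qed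
  fix w assume "w \<in> carrier DR"
  then have "w \<in> D.WS UNIV" using DR_parts(1) by simp
  then have "w \<in> Z"
  proof induction
    case zero
    show ?case using i[OF M.R.zero_closed] by simp
  next
    case (step r v y)
    then show ?case using mul[OF i wp disjI1[OF ev]] add by simp
  qed
  then show "d1 w = d2 w" by (simp add: Z_def)
qed

lemma de_rham_d_eq: "de_rham_d K R = d"
proof -
  have "(THE \<delta>. dR_spec \<delta>) = d" 
  proof (rule the_equality)
    show "dR_spec d" by (rule d_spec)
    show "\<delta> = d" if "dR_spec \<delta>" for \<delta> by (rule dR_unique[OF that d_spec])
  qed
  then show ?thesis unfolding de_rham_d_def .
qed

theorem de_rham:
  "\<exists>\<phi>. superalgebra_iso K A DR \<phi> \<and> (\<forall>f\<in>carrier A. \<phi> (u f) = de_rham_d K R (\<phi> f))"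
proof (intro exI[of _ \<phi>] conjI ballI \<phi>_iso)
  fix f assume f: "f \<in> carrier A"
  show "\<phi> (u f) = de_rham_d K R (\<phi> f)"
    unfolding de_rham_d_eq using \<phi>_closed[OF f] H_\<phi>[OF f] by (simp add: d_def)
qed

end

text \<open>Surjectivity of \<open>\<chi>\<close> carries the centrality of \<open>\<rho>\<close>
  over to all of \<open>S'\<close>. This moves the canonical maps of an exterior algebra to an
  algebra isomorphic to it.\<close>

lemma (in ext_rep) transport:
  assumes S': "ring S'" and \<chi>: "\<chi> \<in> ring_iso S S'"
  shows "ext_rep R M S' (\<lambda>r. \<chi> (\<rho> r)) (\<lambda>m. \<chi> (g m))"
proof -
  interpret S': ring S' by fact
  have \<chi>h: "\<chi> \<in> ring_hom S S'" and onto: "\<chi> ` carrier S = carrier S'"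
    using \<chi> by (auto simp: ring_iso_def bij_betw_def)
  interpret c: ring_hom_ring S S' \<chi> by (rule ring_hom_ringI2[OF S.ring_axioms S' \<chi>h])
  show ?thesis
  proof (intro ext_rep.intro ext_rep_axioms.intro M.module_axioms S')
    show "(\<lambda>r. \<chi> (\<rho> r)) \<in> ring_hom R S'" by (rule ring_hom_memI) simp_all
    show "\<chi> (\<rho> r) \<otimes>\<^bsub>S'\<^esub> a = a \<otimes>\<^bsub>S'\<^esub> \<chi> (\<rho> r)" if r: "r \<in> carrier R" and a: "a \<in> carrier S'" for r a
    proof -
      obtain b where b: "b \<in> carrier S" "a = \<chi> b" using a onto by auto
      have "\<chi> (\<rho> r \<otimes>\<^bsub>S\<^esub> b) = \<chi> (b \<otimes>\<^bsub>S\<^esub> \<rho> r)" using \<rho>_central[OF r b(1)] by simp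
      then show ?thesis using r b by simp
    qed
    show "\<chi> (g m) \<otimes>\<^bsub>S'\<^esub> \<chi> (g m) = \<zero>\<^bsub>S'\<^esub>" if "m \<in> carrier M" for m
      using c.hom_mult[of "g m" "g m"] g_sq[OF that] that by simp
  qed (simp_all add: g_add g_smult)
qed

theorem lemma5p7:
  fixes K :: "'k ring"
    and A :: "('k, 'a) superalgebra"
    and E :: "('a set, 'e) module"
    and u :: "'a \<Rightarrow> 'a"
  assumes "algebraically_closed K"
    and "\<And>n::nat. [n] \<cdot>\<^bsub>K\<^esub> \<one>\<^bsub>K\<^esub> = \<zero>\<^bsub>K\<^esub> \<Longrightarrow> n = 0"
    and "smooth_affine_supervariety K A E"
    and "odd_superderivation K A u"
    and "homological A u"
    and "everywhere_vanishing K A u"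
    and "\<And>x Y. x \<in> points K A \<Longrightarrow> Y \<in> odd_part (cotangent_space K A x) \<Longrightarrow>
           cotangent_map K A u x Y = \<zero>\<^bsub>cotangent_space K A x\<^esub>"
    and "\<And>x. x \<in> points K A \<Longrightarrow>
           bij_betw (cotangent_map K A u x)
             (even_part (cotangent_space K A x)) (odd_part (cotangent_space K A x))"
  shows "\<exists>\<phi>. superalgebra_iso K A (de_rham_algebra K (even_subscheme A)) \<phi> \<and>
           (\<forall>f\<in>carrier A. \<phi> (u f) = de_rham_d K (even_subscheme A) (\<phi> f))"
proof -
  define R where "R = even_subscheme A"
  define L where "L = exterior_algebra R E"
  have sA: "superalgebra K A" and KR: "algebra K R" and fg: "fin_gen_algebra K R" and proj: "fg_projective R E"
    using assms(3) by (auto simp: smooth_affine_supervariety_def smooth_affine_variety_def affine_variety_def R_def)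
  obtain \<psi> where \<psi>: "superalgebra_iso K A L \<psi>"
    using assms(3) by (auto simp: smooth_affine_supervariety_def R_def L_def)
  have R: "cring R" by (rule algebra.M_cring[OF KR])
  have E: "module R E" using proj by (simp add: fg_projective_def)
  have A: "ring A" using sA by (simp add: superalgebra_def)
  interpret A: ring A by (rule A)
  interpret L: ext_rep R E L "ext_scalar R E" "ext_vector R E"
    unfolding L_def by (rule exterior_algebra_rep(1)[OF R E])
  note L_parts = exterior_algebra_parts[OF R E, folded L_def]
  have \<psi>h: "\<psi> \<in> ring_hom A L" and \<psi>b: "bij_betw \<psi> (carrier A) (carrier L)"
    and \<psi>p: "\<psi> ` even_part A = even_part L" "\<psi> ` odd_part A = odd_part L"
    and \<psi>s: "\<And>c a. c \<in> carrier K \<Longrightarrow> a \<in> carrier A \<Longrightarrow> \<psi> (c \<odot>\<^bsub>A\<^esub> a) = c \<odot>\<^bsub>L\<^esub> \<psi> a"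
    using \<psi> by (auto simp: superalgebra_iso_def ring_iso_def linear_map_def)
  interpret p: ring_hom_ring A L \<psi> by (rule ring_hom_ringI2[OF A L.S.ring_axioms \<psi>h])
  define \<chi> where "\<chi> = inv_into (carrier A) \<psi>"
  have \<chi>: "\<chi> \<in> ring_iso L A"
    unfolding \<chi>_def by (rule ring_iso_set_sym[OF A]) (use \<psi> in \<open>simp add: superalgebra_iso_def\<close>)
  have \<chi>h: "\<chi> \<in> ring_hom L A" using \<chi> by (simp add: ring_iso_def)
  have \<chi>\<psi>: "\<chi> (\<psi> a) = a" if "a \<in> carrier A" for a
    unfolding \<chi>_def using \<psi>b that by (intro inv_into_f_f) (auto simp: bij_betw_def)
  have \<psi>\<chi>: "\<psi> (\<chi> a) = a" if "a \<in> carrier L" for a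
    unfolding \<chi>_def using \<psi>b that by (intro f_inv_into_f) (auto simp: bij_betw_def)
  \<comment> \<open>The isomorphism is not part of the supervariety, so the splitting
    \<open>s\<close> and the odd generators \<open>j\<close> come from a choice of
    \<open>\<psi>\<close>.\<close>
  define s where "s = (\<lambda>r. \<chi> (ext_scalar R E r))"
  define j where "j = (\<lambda>e. \<chi> (ext_vector R E e))"
  interpret B: ext_rep R E A s j
    unfolding s_def j_def by (rule L.transport[OF A \<chi>])
  have spn: "\<chi> ` L.WS N = B.WS N" for N
    by (rule L.hom_wspan_image[OF B.ext_rep_axioms \<chi>h]) (simp_all add: s_def j_def)
  have inv_image: "\<chi> ` \<psi> ` T = T" if "T \<subseteq> carrier A" for T
  proof -
    have "(\<lambda>a. \<chi> (\<psi> a)) ` T = (\<lambda>a. a) ` T" by (rule image_cong) (use \<chi>\<psi> that in blast)+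
    then show ?thesis by (simp add: image_image)
  qed
  have sub: "even_part A \<subseteq> carrier A" "odd_part A \<subseteq> carrier A"
    using sA module.submoduleE(1)[of K A] by (simp_all add: superalgebra_def)
  \<comment> \<open>The projection to degrees zero and one, from the universal property applied to
    the square-zero extension.\<close>
  obtain Pr where Pr: "Pr \<in> ring_hom L (sqz R E)"
    "\<And>r. r \<in> carrier R \<Longrightarrow> Pr (ext_scalar R E r) = (r, \<zero>\<^bsub>E\<^esub>)"
    "\<And>m. m \<in> carrier E \<Longrightarrow> Pr (ext_vector R E m) = (\<zero>\<^bsub>R\<^esub>, m)"
    using ext_rep.universal[OF sqz_rep[OF E]] unfolding L_def by blast
  interpret odd_field_model K R E A s j "Pr \<circ> \<psi>" u \<psi>
  proof (intro odd_field_model.intro odd_field.intro ext_alg.intro B.ext_rep_axioms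
      ext_alg_axioms.intro odd_field_axioms.intro odd_field_model_axioms.intro)
    show "B.WS UNIV = carrier A"
      using spn[of UNIV] L_parts(1) \<psi>b inv_image[of "carrier A"] by (simp add: bij_betw_def)
    show "Pr \<circ> \<psi> \<in> ring_hom A (sqz R E)" by (rule ring_hom_trans[OF \<psi>h Pr(1)])
    show "even_part A = B.WS {n. even n}" "odd_part A = B.WS {n. odd n}"
      using spn[of "{n. even n}"] spn[of "{n. odd n}"] inv_image[OF sub(1)] inv_image[OF sub(2)] L_parts(2,3) \<psi>p
      by simp_all
    show "c \<odot>\<^bsub>A\<^esub> a = s (c \<odot>\<^bsub>R\<^esub> \<one>\<^bsub>R\<^esub>) \<otimes>\<^bsub>A\<^esub> a" if c: "c \<in> carrier K" and a: "a \<in> carrier A" for c a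
    proof -
      have cR: "c \<odot>\<^bsub>R\<^esub> \<one>\<^bsub>R\<^esub> \<in> carrier R"
        using KR c module.smult_closed[of K R c "\<one>\<^bsub>R\<^esub>"] by (simp add: algebra_def)
      have cA: "c \<odot>\<^bsub>A\<^esub> a \<in> carrier A"
        using sA c a module.smult_closed[of K A c a] by (simp add: superalgebra_def)
      have "\<psi> (c \<odot>\<^bsub>A\<^esub> a) = ext_scalar R E (c \<odot>\<^bsub>R\<^esub> \<one>\<^bsub>R\<^esub>) \<otimes>\<^bsub>L\<^esub> \<psi> a"
        using \<psi>s[OF c a] exterior_algebra_smult[OF KR E c, of "\<psi> a"] p.hom_closed[OF a] by (simp add: L_def)
      then have "\<chi> (\<psi> (c \<odot>\<^bsub>A\<^esub> a)) = s (c \<odot>\<^bsub>R\<^esub> \<one>\<^bsub>R\<^esub>) \<otimes>\<^bsub>A\<^esub> \<chi> (\<psi> a)"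
        using ring_hom_mult[OF \<chi>h L.\<rho>_simps(1)[OF cR] p.hom_closed[OF a]] by (simp add: s_def)
      then show ?thesis using \<chi>\<psi>[OF cA] \<chi>\<psi>[OF a] by simp
    qed
    show "\<psi> \<in> ring_hom A (exterior_algebra R E)" using \<psi>h by (simp add: L_def)
    fix n :: nat assume "[n] \<cdot>\<^bsub>K\<^esub> \<one>\<^bsub>K\<^esub> = \<zero>\<^bsub>K\<^esub>"
    then show "n = 0" by (rule assms(2))
  qed (use assms(1,4-6,8) KR fg proj sA Pr \<psi>\<chi> in \<open>auto simp: s_def j_def\<close>)
  show ?thesis using de_rham by (simp add: R_def)
qed

end
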